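(* Let $\rho>0$, let $B(\rho)=\{x\in M:|x|<\rho\}$, and let $f:B(\rho)\rightarrow\mathbb{A}$ be a (left) monogenic function. Then, for all $x\in B(\rho)$, $$f(x)=\sum_{k=0}^{+\infty}\Big(\sum_{|\mathrm{k}|=k}\mathcal{P}_{\mathrm{k}}(x)\,\partial_{\mathrm{k}}f(0)\Big),\qquad \mathrm{k}=(k_1,\ldots,k_m)\in\mathbb{N}^m,$$ where the series converges normally on $B(\rho)$.
   Context: $\mathbb{A}$ is a real algebra with unity (with $\mathbb{R}$ identified with $\mathbb{R}\cdot 1$), of finite real dimension greater than $1$, which is alternative (not necessarily associative or commutative): the associator $[a,b,c]=(ab)c-a(bc)$ is an alternating trilinear function. It is equipped with an anti-involution $a\mapsto a^{c}$, i.e. a real linear map with $a^{c}=a$ for $a\in\mathbb{R}$, $(a^{c})^{c}=a$, $(ab)^{c}=b^{c}a^{c}$. Put $t(x)=x+x^{c}$, $n(x)=xx^{c}$, $\mathbb{S}_{\mathbb{A}}=\{x\in\mathbb{A}: t(x)=0,\ n(x)=1\}$ (assumed nonempty), and $Q_{\mathbb{A}}=\mathbb{R}\cup\{x\in\mathbb{A}: t(x)\in\mathbb{R},\ n(x)\in\mathbb{R},\ 4n(x)>t(x)^2\}$. $M$ is a fixed hypercomplex subspace of $\mathbb{A}$, i.e. a real vector subspace with $\mathbb{R}\subsetneq M\subseteq Q_{\mathbb{A}}$, with a fixed hypercomplex basis $\mathcal{B}=(v_0,v_1,\ldots,v_m)$, $m\ge 1$: a real vector basis of $M$ with $v_0=1$,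 $v_s\in\mathbb{S}_{\mathbb{A}}$ for $1\le s\le m$ and $v_sv_t=-v_tv_s$ for distinct $s,t\in\{1,\ldots,m\}$. The basis $\mathcal{B}$ is completed to a real vector basis of $\mathbb{A}$, and $\mathbb{A}$ carries the Euclidean scalar product and norm $|\cdot|$ for which that basis is orthonormal. $\mathbb{R}^{m+1}$ is identified with $M$ via $(x_0,\ldots,x_m)\mapsto x=\sum_{s=0}^m x_sv_s$. Differentiability classes of $\mathbb{A}$-valued functions are understood componentwise; $\partial_s=\partial/\partial x_s$. A function $f\in C^1(\Omega,\mathbb{A})$ on a domain $\Omega\subseteq M$ is (left) monogenic if $\overline{\partial}_{\mathcal{B}}f:=\sum_{s=0}^m v_s\,\partial_s f=0$ in $\Omega$; monogenic functions are $C^\infty$. $\mathbb{N}=\{0,1,2,\ldots\}$; for $\mathrm{k}=(k_1,\ldots,k_m)\in\mathbb{N}^m$, $|\mathrm{k}|=k_1+\cdots+k_m$, and $\partial_{\mathrm{k}}=\partial_1^{k_1}\cdots\partial_m^{k_m}$. The Fueter variables are $z_\ell=z_\ell(x)=x_\ell-x_0v_\ell$, $\ell=1,\ldots,m$. For $\mathrm{k}\in\mathbb{N}^m$ with $k=|\mathrm{k}|\ge1$, $$\mathcal{P}_{\mathrm{k}}(x)=\frac{1}{k!}\sum_{(i_1,\ldots,i_k)}z_{i_1}z_{i_2}\cdots z_{i_k},$$ the sum running over all distinct sequences $(i_1,\ldots,i_k)$ in which each $\ell\in\{1,\ldots,m\}$ occurs exactly $k_\ell$ times, all products being formed in one fixed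 associative order, e.g. $(\cdots((z_{i_1}z_{i_2})z_{i_3})\cdots)z_{i_k}$ (the sum does not depend on the order chosen); $\mathcal{P}_{(0,\ldots,0)}=1$. A series $\sum_k g_k$ converges normally on an open set $U$ if $\sum_k\sup_{K}|g_k|<\infty$ for every compact $K\subset U$. *)

theory Defs
  imports "HOL-Analysis.Analysis"
begin

text \<open>The algebra lives on a Euclidean space \<open>'a\<close> (hence finite-dimensional), with product
  \<open>mul\<close>, unit \<open>e\<close> and anti-involution \<open>cj\<close>. The reals are identified with the
  multiples of \<open>e\<close>.\<close>

definition associator :: "('a::euclidean_space \<Rightarrow> 'a \<Rightarrow> 'a) \<Rightarrow> 'a \<Rightarrow> 'a \<Rightarrow> 'a \<Rightarrow> 'a" where
  "associator mul a b c = mul (mul a b) c - mul a (mul b c)"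

definition alg_trace :: "('a::euclidean_space \<Rightarrow> 'a) \<Rightarrow> 'a \<Rightarrow> 'a" where
  "alg_trace cj x = x + cj x"

definition alg_norm :: "('a::euclidean_space \<Rightarrow> 'a \<Rightarrow> 'a) \<Rightarrow> ('a \<Rightarrow> 'a) \<Rightarrow> 'a \<Rightarrow> 'a" where
  "alg_norm mul cj x = mul x (cj x)"

definition real_line :: "'a::euclidean_space \<Rightarrow> 'a set" where
  "real_line e = range (\<lambda>r::real. r *\<^sub>R e)"

definition imaginary_units ::
  "('a::euclidean_space \<Rightarrow> 'a \<Rightarrow> 'a) \<Rightarrow> 'a \<Rightarrow> ('a \<Rightarrow> 'a) \<Rightarrow> 'a set" where
  "imaginary_units mul e cj = {x. alg_trace cj x = 0 \<and> alg_norm mul cj x = e}"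

definition quadratic_cone ::
  "('a::euclidean_space \<Rightarrow> 'a \<Rightarrow> 'a) \<Rightarrow> 'a \<Rightarrow> ('a \<Rightarrow> 'a) \<Rightarrow> 'a set" where
  "quadratic_cone mul e cj = real_line e \<union>
     {x. \<exists>\<tau> \<nu> :: real. alg_trace cj x = \<tau> *\<^sub>R e \<and> alg_norm mul cj x = \<nu> *\<^sub>R e \<and> 4 * \<nu> > \<tau>\<^sup>2}"

locale alternative_star_algebra =
  fixes mul :: "'a::euclidean_space \<Rightarrow> 'a \<Rightarrow> 'a" and e :: 'a and cj :: "'a \<Rightarrow> 'a"
  assumes dim_gt_1: "DIM('a) > 1"
    and bilinear_mul: "bilinear mul"
    and unit_left: "mul e a = a"
    and unit_right: "mul a e = a"
    and associator_alternating:
      "associator mul a a b = 0" "associator mul a b b = 0" "associator mul a b a = 0"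
    and linear_cj: "linear cj"
    and cj_real: "cj (r *\<^sub>R e) = r *\<^sub>R e"
    and cj_cj: "cj (cj a) = a"
    and cj_mul: "cj (mul a b) = mul (cj b) (cj a)"
    and imaginary_units_nonempty: "imaginary_units mul e cj \<noteq> {}"

text \<open>\<open>v 0, \<dots>, v m\<close> is the hypercomplex basis of \<open>M\<close>; its completion to a basis of the
  whole algebra is \<open>v 0, \<dots>, v (DIM('a) - 1)\<close>. The scalar product (and norm) of the type
  \<open>'a\<close> is the one making this completed basis orthonormal; an orthonormal family of
  \<open>DIM('a)\<close> vectors is automatically a basis.\<close>

locale hypercomplex_subspace = alternative_star_algebra mul e cj
  for mul :: "'a::euclidean_space \<Rightarrow> 'a \<Rightarrow> 'a" and e :: 'a and cj :: "'a \<Rightarrow> 'a" +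
  fixes M :: "'a set" and m :: nat and v :: "nat \<Rightarrow> 'a"
  assumes subspace_M: "subspace M"
    and real_line_psubset_M: "real_line e \<subset> M"
    and M_subset_cone: "M \<subseteq> quadratic_cone mul e cj"
    and m_ge_1: "m \<ge> 1"
    and basis_inj: "inj_on v {0..m}"
    and basis_independent: "independent (v ` {0..m})"
    and basis_span: "span (v ` {0..m}) = M"
    and v_0: "v 0 = e"
    and v_imaginary_unit: "s \<in> {1..m} \<Longrightarrow> v s \<in> imaginary_units mul e cj"
    and v_anticommute:
      "s \<in> {1..m} \<Longrightarrow> t \<in> {1..m} \<Longrightarrow> s \<noteq> t \<Longrightarrow> mul (v s) (v t) = - mul (v t) (v s)"
    and completed_basis_orthonormal:
      "i < DIM('a) \<Longrightarrow> j < DIM('a) \<Longrightarrow> v i \<bullet> v j = (if i = j then 1 else 0)"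

text \<open>Functions on subsets of \<open>M\<close> are represented by total functions on \<open>'a\<close>. Partial
  derivatives are taken along \<open>v s\<close> with \<open>s \<le> m\<close>, so at points of a relatively open
  subset of \<open>M\<close> they depend only on the values of the function on that subset.\<close>

definition partial :: "(nat \<Rightarrow> 'a::euclidean_space) \<Rightarrow> nat \<Rightarrow> ('a \<Rightarrow> 'a) \<Rightarrow> 'a \<Rightarrow> 'a" where
  "partial v s f x = vector_derivative (\<lambda>t::real. f (x + t *\<^sub>R v s)) (at 0)"

definition C1_on :: "nat \<Rightarrow> (nat \<Rightarrow> 'a::euclidean_space) \<Rightarrow> 'a set \<Rightarrow> ('a \<Rightarrow> 'a) \<Rightarrow> bool" where
  "C1_on m v \<Omega> f \<longleftrightarrow> continuous_on \<Omega> f \<and>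
     (\<forall>s\<in>{0..m}. (\<forall>x\<in>\<Omega>. (\<lambda>t::real. f (x + t *\<^sub>R v s)) differentiable (at 0)) \<and>
                 continuous_on \<Omega> (partial v s f))"

definition monogenic_on ::
  "('a::euclidean_space \<Rightarrow> 'a \<Rightarrow> 'a) \<Rightarrow> nat \<Rightarrow> (nat \<Rightarrow> 'a) \<Rightarrow> 'a set \<Rightarrow> ('a \<Rightarrow> 'a) \<Rightarrow> bool" where
  "monogenic_on mul m v \<Omega> f \<longleftrightarrow>
     C1_on m v \<Omega> f \<and> (\<forall>x\<in>\<Omega>. (\<Sum>s=0..m. mul (v s) (partial v s f x)) = 0)"

text \<open>Multi-indices \<open>(k\<^sub>1, \<dots>, k\<^sub>m)\<close> are functions vanishing outside \<open>{1..m}\<close>.\<close>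

definition multi_indices :: "nat \<Rightarrow> nat \<Rightarrow> (nat \<Rightarrow> nat) set" where
  "multi_indices m n = {\<kappa>. (\<forall>l. l \<notin> {1..m} \<longrightarrow> \<kappa> l = 0) \<and> (\<Sum>l=1..m. \<kappa> l) = n}"

text \<open>\<open>\<partial>\<^sub>1\<close> is applied last.\<close>

definition multi_partial ::
  "nat \<Rightarrow> (nat \<Rightarrow> 'a::euclidean_space) \<Rightarrow> (nat \<Rightarrow> nat) \<Rightarrow> ('a \<Rightarrow> 'a) \<Rightarrow> 'a \<Rightarrow> 'a" where
  "multi_partial m v \<kappa> f = foldr (\<lambda>l. partial v l ^^ \<kappa> l) [1..<Suc m] f"

text \<open>For \<open>x \<in> M\<close> the coordinate \<open>x\<^sub>l\<close> is \<open>x \<bullet> v l\<close>, the basis being orthonormal.\<close>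

definition fueter_var ::
  "'a::euclidean_space \<Rightarrow> (nat \<Rightarrow> 'a) \<Rightarrow> nat \<Rightarrow> 'a \<Rightarrow> 'a" where
  "fueter_var e v l x = (x \<bullet> v l) *\<^sub>R e - (x \<bullet> v 0) *\<^sub>R v l"

text \<open>Products are formed from the left; the initial factor \<open>e\<close> is the unit. For
  \<open>\<kappa> = 0\<close> the only sequence is \<open>[]\<close>, so the polynomial is the constant \<open>e\<close>.\<close>

definition fueter_poly ::
  "('a::euclidean_space \<Rightarrow> 'a \<Rightarrow> 'a) \<Rightarrow> 'a \<Rightarrow> nat \<Rightarrow> (nat \<Rightarrow> 'a) \<Rightarrow> (nat \<Rightarrow> nat) \<Rightarrow> 'a \<Rightarrow> 'a" where
  "fueter_poly mul e m v \<kappa> x =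
     (1 / fact (\<Sum>l=1..m. \<kappa> l)) *\<^sub>R
     (\<Sum>is\<in>{is. set is \<subseteq> {1..m} \<and> (\<forall>l\<in>{1..m}. count_list is l = \<kappa> l)}.
        foldl mul e (map (\<lambda>i. fueter_var e v i x) is))"

lemma fueter_poly_0: "fueter_poly mul e m v (\<lambda>_. 0) x = e"
proof -
  have "{is. set is \<subseteq> {1..m} \<and> (\<forall>l\<in>{1..m}. count_list is l = 0)} = {[]}"
    by (auto simp: count_list_0_iff) (metis list.set_intros(1) neq_Nil_conv subsetD)
  then show ?thesis
    by (simp add: fueter_poly_def)
qed

text \<open>The suprema and the sum are taken in \<open>[0, \<infinity>]\<close>.\<close>

definition normally_convergent_on ::
  "(nat \<Rightarrow> 'a::metric_space \<Rightarrow> 'b::real_normed_vector) \<Rightarrow> 'a set \<Rightarrow> bool" where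
  "normally_convergent_on g U \<longleftrightarrow>
     (\<forall>K. compact K \<and> K \<subseteq> U \<longrightarrow> (\<Sum>k. SUP x\<in>K. ennreal (norm (g k x))) < \<infinity>)"

end

theory Submission imports Defs begin

text \<open>By alternativity the left multiplications by \<open>v 1, \<dots>, v m\<close> satisfy the Clifford relations,
  so a monogenic \<open>f\<close>, extended to the whole algebra as a constant along the complement of \<open>M\<close>, is
  represented on a ball by integrating the Newtonian kernels \<open>(x - y) / norm (x - y) ^ DIM('a)\<close>
  against densities supported in a spherical shell just inside the boundary. To avoid singular
  integrals the kernels are smoothed near 0; their divergence then becomes an approximate identity.
  Differentiating the representation gives smoothness. Along a ray \<open>t x\<close> the kernel is a power
  series in \<open>t\<close>, by the binomial series for \<open>(1 - t w) powr (- DIM('a) / 2)\<close> and its conjugate, which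
  converges for \<open>\<bar>t\<bar> norm x < norm y\<close>; this gives the expansion into homogeneous terms on the full ball.
  Finally \<open>\<Sum>\<^sub>s x\<^sub>s \<partial>\<^sub>s f = \<Sum>\<^sub>l z\<^sub>l \<partial>\<^sub>l f\<close>, so the \<open>k\<close>-th term is the \<open>k\<close>-th power of \<open>\<Sum>\<^sub>l z\<^sub>l \<partial>\<^sub>l\<close>
  applied to \<open>f\<close> at 0, divided by \<open>k!\<close>. Polarizing \<open>Z (Z (\<dots> a)) = Z\<^sup>k a\<close>, which holds because
  elements of \<open>M\<close> are quadratic, identifies it with the sum over the Fueter polynomials.\<close>

subsection \<open>Directional derivatives and convolutions\<close>

text \<open>Non-associativity does no harm in the analytic part: the kernels are scalar and the
  algebra acts only through the linear maps \<open>A s = mul (v s)\<close> and their conjugates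
  \<open>Ab s\<close>, whose compositions are associative anyway. The decisive identity is that
  \<open>\<Sum>s. Ab s (\<Sum>t. A t (C s t))\<close> reduces to \<open>\<Sum>s. C s s\<close> for a
  symmetric array \<open>C\<close>. The array in question is
  \<open>C s t = convol (kern1 a (v s) (v t)) G\<close>, symmetric because the smoothed Newtonian
  field is a gradient. Since \<open>f\<close> is only assumed to be C1, further derivatives have to
  fall on the kernel. The dimension in the kernel is that of the algebra, not that of
  \<open>M\<close>; the directions outside \<open>M\<close> see only the cutoff. Sorting the series
  by total degree is essential: as a multiple power series in the coordinates the expansion in
  general converges absolutely only on a smaller ball, whereas along a ray only the ratio
  \<open>norm x / norm y\<close> matters.\<close>

definition has_partial :: "('a::real_normed_vector \<Rightarrow> 'b::real_normed_vector) \<Rightarrow> 'a \<Rightarrow> 'b \<Rightarrow> 'a \<Rightarrow> bool"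
  where "has_partial f h D x \<longleftrightarrow> ((\<lambda>t::real. f (x + t *\<^sub>R h)) has_vector_derivative D) (at 0)"

lemma has_partial_line:
  assumes "has_partial f h D (x + t *\<^sub>R h)"
  shows "((\<lambda>s::real. f (x + s *\<^sub>R h)) has_vector_derivative D) (at t)"
proof -
  have "((\<lambda>s. f (x + t *\<^sub>R h + s *\<^sub>R h)) has_vector_derivative D) (at (t - t))"
    using assms by (simp add: has_partial_def)
  moreover have "((\<lambda>s. s - t) has_vector_derivative 1) (at t)"
    by (auto intro!: derivative_eq_intros)
  ultimately have "((\<lambda>s. f (x + t *\<^sub>R h + (s - t) *\<^sub>R h)) has_vector_derivative D) (at t)"
    using vector_diff_chain_at[of "\<lambda>s. s - t" 1 t "\<lambda>s. f (x + t *\<^sub>R h + s *\<^sub>R h)" D] by (simp add: o_def)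
  then show ?thesis by (simp add: algebra_simps)
qed

lemma has_partial_partial: "has_partial f (v s) D x \<Longrightarrow> partial v s f x = D"
  by (simp add: has_partial_def partial_def vector_derivative_at)

lemma has_partial_cong:
  assumes "open S" "x \<in> S" "\<And>y. y \<in> S \<Longrightarrow> f y = g y" "has_partial f h D x"
  shows "has_partial g h D x"
proof -
  have "open ((\<lambda>t::real. x + t *\<^sub>R h) -` S)"
    by (intro open_vimage assms continuous_intros)
  moreover have "0 \<in> (\<lambda>t::real. x + t *\<^sub>R h) -` S" using assms by auto
  ultimately show ?thesis
    unfolding has_partial_def
    using has_vector_derivative_transform_within_open[OF assms(4)[unfolded has_partial_def]] assms(3)
    by (metis (no_types, lifting) vimageE)
qed

lemma has_partial_scaleR:
  fixes k :: "'a::real_normed_vector \<Rightarrow> real"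
  assumes "has_partial k h k' x" "has_partial g h g' x"
  shows "has_partial (\<lambda>y. k y *\<^sub>R g y) h (k' *\<^sub>R g x + k x *\<^sub>R g') x"
  using has_vector_derivative_scaleR[of "\<lambda>t. k (x + t *\<^sub>R h)" k' 0 UNIV "\<lambda>t. g (x + t *\<^sub>R h)" g'] assms
  by (simp add: has_partial_def has_real_derivative_iff_has_vector_derivative add.commute)

lemma has_partial_reflect:
  assumes "has_partial f h D (x - y)"
  shows "has_partial (\<lambda>y. f (x - y)) h (- D) y"
proof -
  have "((\<lambda>t. f ((x - y) + t *\<^sub>R h)) has_vector_derivative D) (at (- 0))"
    using assms by (simp add: has_partial_def)
  moreover have "(uminus has_vector_derivative -1) (at (0::real))"
    by (auto intro!: derivative_eq_intros)
  ultimately have "((\<lambda>t. f ((x - y) + (- t) *\<^sub>R h)) has_vector_derivative - D) (at 0)"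
    using vector_diff_chain_at[of uminus "-1" 0 "\<lambda>t. f ((x - y) + t *\<^sub>R h)" D] by (simp add: o_def)
  then show ?thesis by (simp add: has_partial_def algebra_simps)
qed

lemma integral_cbox_eq_UNIV:
  fixes h :: "'a::euclidean_space \<Rightarrow> 'b::banach"
  assumes "\<And>y. y \<notin> cbox a b \<Longrightarrow> h y = 0"
  shows "integral (cbox a b) h = integral UNIV h"
proof -
  have "integral (cbox a b) h = integral UNIV (\<lambda>x. if x \<in> cbox a b then h x else 0)"
    by (simp add: integral_restrict_UNIV)
  also have "(\<lambda>x. if x \<in> cbox a b then h x else 0) = h" using assms by auto
  finally show ?thesis .
qed

lemma integral_UNIV_translate:
  fixes h :: "'a::euclidean_space \<Rightarrow> 'b::banach"
  assumes "\<And>y. y \<notin> cbox a b \<Longrightarrow> h y = 0"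
  shows "integral UNIV (\<lambda>y. h (y + c)) = integral UNIV h"
proof -
  have "integral UNIV (\<lambda>y. h (y + c)) = integral (cbox (a - c) (b - c)) (\<lambda>y. h (y + c))"
    by (rule integral_cbox_eq_UNIV[symmetric], rule assms) (auto simp: mem_box algebra_simps)
  also have "\<dots> = integral (cbox a b) h"
    using integral_shift_cbox_plus[of "a - c" "b - c" h c] by (simp add: o_def add.commute)
  also have "\<dots> = integral UNIV h" using assms by (rule integral_cbox_eq_UNIV)
  finally show ?thesis .
qed

text \<open>Compact support turns this into the Leibniz rule on a box. Only
  \<open>\<bar>t\<bar> \<le> 1\<close> matters for a derivative at 0, so the supports of a moving
  integrand have to fit into one box for these parameters alone.\<close>

lemma leibniz_UNIV:
  fixes f :: "real \<Rightarrow> 'a::euclidean_space \<Rightarrow> 'b::banach"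
  assumes "\<And>t y. \<bar>t\<bar> \<le> 1 \<Longrightarrow> ((\<lambda>t. f t y) has_vector_derivative f' t y) (at t)"
    and f: "\<And>t. continuous_on UNIV (f t)"
    and f': "continuous_on UNIV (\<lambda>(t, y). f' t y)"
    and supp: "\<And>t y. y \<notin> cbox a b \<Longrightarrow> \<bar>t\<bar> \<le> 1 \<Longrightarrow> f t y = 0" "\<And>y. y \<notin> cbox a b \<Longrightarrow> f' 0 y = 0"
  shows "((\<lambda>t. integral UNIV (f t)) has_vector_derivative integral UNIV (f' 0)) (at 0)"
proof -
  let ?U = "ball (0::real) 1"
  have "((\<lambda>t. integral (cbox a b) (f t)) has_vector_derivative integral (cbox a b) (f' 0)) (at 0 within ?U)"
  proof (rule leibniz_rule_vector_derivative)
    show "((\<lambda>t. f t y) has_vector_derivative f' t y) (at t within ?U)" if "t \<in> ?U" for t y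
      using assms(1)[of t y] that by (auto intro: has_vector_derivative_at_within)
    show "f t integrable_on cbox a b" for t
      using continuous_on_subset[OF f] by (intro integrable_continuous) auto
    show "continuous_on (?U \<times> cbox a b) (\<lambda>(t, y). f' t y)"
      using f' by (rule continuous_on_subset) auto
  qed auto
  then have "((\<lambda>t. integral (cbox a b) (f t)) has_vector_derivative integral (cbox a b) (f' 0)) (at 0)"
    using at_within_open[of "0::real" ?U] by (metis centre_in_ball open_ball zero_less_one)
  note D = this
  have e1: "integral (cbox a b) (f' 0) = integral UNIV (f' 0)"
    using supp by (intro integral_cbox_eq_UNIV) auto
  have e2: "integral (cbox a b) (f t) = integral UNIV (f t)" if "t \<in> ?U" for t
    using supp that by (intro integral_cbox_eq_UNIV) auto
  from D have "((\<lambda>t. integral UNIV (f t)) has_vector_derivative integral (cbox a b) (f' 0)) (at 0)"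
    by (rule has_vector_derivative_transform_within_open[where S = ?U, OF _ _ _ e2]) simp_all
  then show ?thesis unfolding e1 .
qed

text \<open>Translating \<open>W\<close> along \<open>h\<close> does not change its integral, so the
  derivative of the translated integral, which is the integral of \<open>W'\<close>, vanishes. This
  works for every direction \<open>h\<close>, without iterated integrals.\<close>

lemma integral_partial_eq_0:
  fixes W :: "'a::euclidean_space \<Rightarrow> 'b::banach"
  assumes W: "\<And>y. has_partial W h (W' y) y" "continuous_on UNIV W"
    and W': "continuous_on UNIV W'"
    and supp: "\<And>y. y \<notin> cbox a b \<Longrightarrow> W y = 0"
  shows "integral UNIV W' = 0"
proof -
  have W'0: "W' y = 0" if "y \<notin> cbox a b" for y
  proof -
    have "has_partial W h 0 y"
      by (rule has_partial_cong[of "- cbox a b" _ "\<lambda>_. 0"]) (use that supp in \<open>auto simp: has_partial_def open_Compl closed_cbox\<close>)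
    with W show ?thesis unfolding has_partial_def by (metis vector_derivative_unique_at)
  qed
  \<comment> \<open>All points that some translation by \<open>t *\<^sub>R h\<close> with
    \<open>\<bar>t\<bar> \<le> 1\<close> carries into the box; one box around \<open>S\<close> then
    supports every translate.\<close>
  define S where "S = (\<lambda>(y, t). y - t *\<^sub>R h) ` (cbox a b \<times> cbox (-1::real) 1)"
  have "compact S" unfolding S_def case_prod_unfold
    by (intro compact_continuous_image continuous_intros compact_Times compact_cbox)
  then obtain c where c: "S \<subseteq> cbox (-c) c"
    using bounded_subset_cbox_symmetric compact_imp_bounded by metis
  have out: "y + t *\<^sub>R h \<notin> cbox a b" if "y \<notin> cbox (-c) c" "\<bar>t\<bar> \<le> 1" for y t
  proof
    assume "y + t *\<^sub>R h \<in> cbox a b"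
    then have "(y + t *\<^sub>R h) - t *\<^sub>R h \<in> S"
      unfolding S_def using that by (auto intro!: image_eqI[where x="(y + t *\<^sub>R h, t)"])
    then show False using c that by auto
  qed
  have "((\<lambda>t. integral UNIV (\<lambda>y. W (y + t *\<^sub>R h))) has_vector_derivative
         integral UNIV (\<lambda>y. W' (y + 0 *\<^sub>R h))) (at 0)"
  proof (rule leibniz_UNIV[where a="-c" and b=c and f="\<lambda>t y. W (y + t *\<^sub>R h)" and f'="\<lambda>t y. W' (y + t *\<^sub>R h)"])
    show "((\<lambda>t. W (y + t *\<^sub>R h)) has_vector_derivative W' (y + t *\<^sub>R h)) (at t)" for t y
      by (rule has_partial_line) (rule W)
    show "continuous_on UNIV (\<lambda>y. W (y + t *\<^sub>R h))" for t
      by (intro continuous_on_compose2[OF W(2)] continuous_intros) auto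
    show "continuous_on UNIV (\<lambda>(t, y). W' (y + t *\<^sub>R h))"
      unfolding case_prod_unfold by (intro continuous_on_compose2[OF W'] continuous_intros) auto
    show "W (y + t *\<^sub>R h) = 0" if "y \<notin> cbox (-c) c" "\<bar>t\<bar> \<le> 1" for t y
      using out[OF that] supp by auto
    show "W' (y + 0 *\<^sub>R h) = 0" if "y \<notin> cbox (-c) c" for y
      using out[OF that, of 0] W'0 by auto
  qed
  moreover have "integral UNIV (\<lambda>y. W (y + t *\<^sub>R h)) = integral UNIV W" for t
    using supp by (rule integral_UNIV_translate)
  ultimately have "((\<lambda>t::real. integral UNIV W) has_vector_derivative integral UNIV W') (at 0)" by simp
  then show ?thesis using has_vector_derivative_const vector_derivative_unique_at by blast
qed

section \<open>Convolution of a scalar kernel with a compactly supported density\<close>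

definition convol :: "('a::euclidean_space \<Rightarrow> real) \<Rightarrow> ('a \<Rightarrow> 'b::banach) \<Rightarrow> 'a \<Rightarrow> 'b" where
  "convol k H x = integral UNIV (\<lambda>y. k (x - y) *\<^sub>R H y)"

lemma integrable_UNIV_compact_support:
  fixes h :: "'a::euclidean_space \<Rightarrow> 'b::banach"
  assumes "continuous_on UNIV h" "\<And>y. y \<notin> cbox a b \<Longrightarrow> h y = 0"
  shows "h integrable_on UNIV"
proof -
  have "h integrable_on cbox a b"
    using assms(1) continuous_on_subset by (intro integrable_continuous) blast
  then have "(\<lambda>x. if x \<in> cbox a b then h x else 0) integrable_on UNIV"
    by (simp add: integrable_restrict_UNIV)
  moreover have "(\<lambda>x. if x \<in> cbox a b then h x else 0) = h" using assms by auto
  ultimately show ?thesis by simp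
qed

lemma continuous_convol:
  fixes H :: "'a::euclidean_space \<Rightarrow> 'b::banach"
  assumes k: "continuous_on UNIV k" and H: "continuous_on UNIV H" "\<And>y. y \<notin> cbox a b \<Longrightarrow> H y = 0"
  shows "continuous_on UNIV (convol k H)"
proof -
  have "continuous_on UNIV (\<lambda>x. integral (cbox a b) (\<lambda>y. k (x - y) *\<^sub>R H y))"
  proof (rule integral_continuous_on_param)
    show "continuous_on (UNIV \<times> cbox a b) (\<lambda>(x, y). k (x - y) *\<^sub>R H y)"
      unfolding case_prod_unfold
      by (intro continuous_intros continuous_on_compose2[OF k] continuous_on_compose2[OF H(1)]) auto
  qed
  moreover have "integral (cbox a b) (\<lambda>y. k (x - y) *\<^sub>R H y) = convol k H x" for x
    unfolding convol_def by (rule integral_cbox_eq_UNIV) (simp add: H)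
  ultimately show ?thesis by simp
qed

text \<open>The derivative falls on the kernel alone and the density merely has to be continuous;
  all regularity of null solutions comes from here.\<close>

lemma convol_partial:
  fixes H :: "'a::euclidean_space \<Rightarrow> 'b::banach"
  assumes k: "continuous_on UNIV k" "\<And>u. has_partial k h (k' u) u" "continuous_on UNIV k'"
    and H: "continuous_on UNIV H" "\<And>y. y \<notin> cbox a b \<Longrightarrow> H y = 0"
  shows "has_partial (convol k H) h (convol k' H x) x"
proof -
  have "((\<lambda>t. integral UNIV (\<lambda>y. k (x + t *\<^sub>R h - y) *\<^sub>R H y)) has_vector_derivative
         integral UNIV (\<lambda>y. k' (x + 0 *\<^sub>R h - y) *\<^sub>R H y)) (at 0)"
  proof (rule leibniz_UNIV[where f'="\<lambda>t y. k' (x + t *\<^sub>R h - y) *\<^sub>R H y" and a=a and b=b])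
    show "((\<lambda>t. k (x + t *\<^sub>R h - y) *\<^sub>R H y) has_vector_derivative k' (x + t *\<^sub>R h - y) *\<^sub>R H y) (at t)" for t y
    proof -
      have "((\<lambda>t. k ((x - y) + t *\<^sub>R h)) has_vector_derivative k' ((x - y) + t *\<^sub>R h)) (at t)"
        by (rule has_partial_line) (rule k)
      then have "((\<lambda>t. k (x + t *\<^sub>R h - y)) has_vector_derivative k' (x + t *\<^sub>R h - y)) (at t)"
        by (simp add: algebra_simps)
      then show ?thesis by (auto intro!: derivative_eq_intros simp: has_real_derivative_iff_has_vector_derivative)
    qed
    show "continuous_on UNIV (\<lambda>y. k (x + t *\<^sub>R h - y) *\<^sub>R H y)" for t
      by (intro continuous_intros continuous_on_compose2[OF k(1)] H) auto
    show "continuous_on UNIV (\<lambda>(t, y). k' (x + t *\<^sub>R h - y) *\<^sub>R H y)"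
      unfolding case_prod_unfold
      by (intro continuous_intros continuous_on_compose2[OF k(3)] continuous_on_compose2[OF H(1)]) auto
  qed (auto simp: H)
  then show ?thesis by (simp add: has_partial_def convol_def)
qed

text \<open>The \<open>h\<close>-derivative in \<open>y\<close> of
  \<open>k (x - y) *\<^sub>R G y\<close> integrates to 0. Reflecting the argument of
  \<open>k\<close> produces a minus sign that cancels the usual one of integration by parts.\<close>

lemma convol_by_parts:
  fixes G :: "'a::euclidean_space \<Rightarrow> 'b::banach"
  assumes k: "continuous_on UNIV k" "\<And>u. has_partial k h (k' u) u" "continuous_on UNIV k'"
    and G: "continuous_on UNIV G" "\<And>y. has_partial G h (G' y) y" "continuous_on UNIV G'"
    and supp: "\<And>y. y \<notin> cbox a b \<Longrightarrow> G y = 0" "\<And>y. y \<notin> cbox a b \<Longrightarrow> G' y = 0"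
  shows "convol k G' x = convol k' G x"
proof -
  have kc: "continuous_on UNIV (\<lambda>y. k (x - y))" "continuous_on UNIV (\<lambda>y. k' (x - y))"
    by (intro continuous_intros continuous_on_compose2[OF k(1)] continuous_on_compose2[OF k(3)], auto)+
  have "integral UNIV (\<lambda>y. (- k' (x - y)) *\<^sub>R G y + k (x - y) *\<^sub>R G' y) = 0"
  proof (rule integral_partial_eq_0[where a=a and b=b and h=h])
    show "has_partial (\<lambda>y. k (x - y) *\<^sub>R G y) h ((- k' (x - y)) *\<^sub>R G y + k (x - y) *\<^sub>R G' y) y" for y
      by (intro has_partial_scaleR has_partial_reflect k G)
  qed (auto intro!: continuous_intros kc G simp: supp)
  moreover have "(\<lambda>y. (- k' (x - y)) *\<^sub>R G y) integrable_on UNIV" "(\<lambda>y. k (x - y) *\<^sub>R G' y) integrable_on UNIV"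
    by (rule integrable_UNIV_compact_support[where a=a and b=b]; auto intro!: continuous_intros kc G simp: supp)+
  ultimately have "integral UNIV (\<lambda>y. (- k' (x - y)) *\<^sub>R G y) + convol k G' x = 0"
    unfolding convol_def by (subst integral_add[symmetric]) auto
  then show ?thesis by (simp add: convol_def)
qed

subsection \<open>The Newtonian kernel and its smoothing\<close>

lemma DERIV_if_less:
  fixes f g :: "real \<Rightarrow> real"
  assumes f: "\<And>t. t \<le> a \<Longrightarrow> (f has_real_derivative f' t) (at t)"
    and g: "\<And>t. t \<ge> a \<Longrightarrow> (g has_real_derivative g' t) (at t)"
    and eq: "f a = g a" "f' a = g' a"
  shows "((\<lambda>t. if t < a then f t else g t) has_real_derivative (if t < a then f' t else g' t)) (at t)"
proof -
  have "((\<lambda>t. if t \<in> {..<a} then f t else g t) has_vector_derivative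
      (if t \<in> {..<a} then f' t else g' t)) (at t within UNIV)"
  proof (rule has_vector_derivative_If_within_closures[where T="{a..}"])
    show "(f has_vector_derivative f' t) (at t within {..<a} \<union> (closure {..<a} \<inter> closure {a..}))"
      if "t \<in> {..<a} \<union> (closure {..<a} \<inter> closure {a..})"
      using f[of t] that
      by (auto simp: has_real_derivative_iff_has_vector_derivative[symmetric] intro: has_field_derivative_at_within)
    show "(g has_vector_derivative g' t) (at t within {a..} \<union> (closure {..<a} \<inter> closure {a..}))"
      if "t \<in> {a..} \<union> (closure {..<a} \<inter> closure {a..})"
      using g[of t] that
      by (auto simp: has_real_derivative_iff_has_vector_derivative[symmetric] intro: has_field_derivative_at_within)
  qed (use eq in auto)
  then show ?thesis by (simp add: has_real_derivative_iff_has_vector_derivative)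
qed

text \<open>The singularity of \<open>t powr (-p)\<close> at 0 is removed by a quadratic Taylor polynomial, the least
  degree that makes the resulting kernel twice continuously differentiable.\<close>

definition kprof :: "real \<Rightarrow> real \<Rightarrow> real \<Rightarrow> real" where
  "kprof p a t = (if t < a then a powr (-p) * (1 - p * (t/a - 1) + p * (p+1) / 2 * (t/a - 1)^2) else t powr (-p))"

definition kprof1 :: "real \<Rightarrow> real \<Rightarrow> real \<Rightarrow> real" where
  "kprof1 p a t = (if t < a then a powr (-p-1) * (- p + p * (p+1) * (t/a - 1)) else - p * t powr (-p-1))"

definition kprof2 :: "real \<Rightarrow> real \<Rightarrow> real \<Rightarrow> real" where
  "kprof2 p a t = (if t < a then p * (p+1) * a powr (-p-2) else p * (p+1) * t powr (-p-2))"

lemma powr_shift: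
  fixes a :: real assumes "a > 0" shows "a powr (-p-1) = a powr (-p) / a" "a powr (-p-2) = a powr (-p) / a^2"
  using assms by (auto simp: powr_diff powr_numeral)

lemma DERIV_kprof:
  assumes "a > 0" shows "(kprof p a has_real_derivative kprof1 p a t) (at t)"
  unfolding kprof_def[abs_def] kprof1_def
proof (rule DERIV_if_less)
  show "((\<lambda>t. t powr - p) has_real_derivative - p * t powr (- p - 1)) (at t)" if "a \<le> t" for t
    using that assms by (auto intro!: derivative_eq_intros)
  show "((\<lambda>t. a powr - p * (1 - p * (t / a - 1) + p * (p + 1) / 2 * (t / a - 1)\<^sup>2)) has_real_derivative
      a powr (- p - 1) * (- p + p * (p + 1) * (t / a - 1))) (at t)" for t
    using assms by (auto intro!: derivative_eq_intros simp: powr_shift field_simps power2_eq_square)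
qed (use assms in auto)

lemma DERIV_kprof1:
  assumes "a > 0" shows "(kprof1 p a has_real_derivative kprof2 p a t) (at t)"
  unfolding kprof1_def[abs_def] kprof2_def
proof (rule DERIV_if_less)
  show "((\<lambda>t. - p * t powr (- p - 1)) has_real_derivative p * (p+1) * t powr (- p - 2)) (at t)" if "a \<le> t" for t
    using that assms by (auto intro!: derivative_eq_intros simp: algebra_simps)
  show "((\<lambda>t. a powr (- p - 1) * (- p + p * (p + 1) * (t / a - 1))) has_real_derivative
      p * (p + 1) * a powr (- p - 2)) (at t)" for t
    using assms by (auto intro!: derivative_eq_intros simp: powr_shift field_simps power2_eq_square)
qed (use assms in auto)

lemma continuous_kprof2: assumes "a > 0" shows "continuous_on UNIV (kprof2 p a)"
proof -
  have "kprof2 p a = (\<lambda>t. p * (p+1) * (max t a) powr (-p-2))"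
    by (auto simp: kprof2_def max_def)
  then show ?thesis using assms by (auto intro!: continuous_intros)
qed

lemma continuous_kprof: "a > 0 \<Longrightarrow> continuous_on UNIV (kprof p a)"
  by (meson DERIV_continuous_on DERIV_kprof has_field_derivative_at_within)

lemma continuous_kprof1: "a > 0 \<Longrightarrow> continuous_on UNIV (kprof1 p a)"
  by (meson DERIV_continuous_on DERIV_kprof1 has_field_derivative_at_within)

text \<open>With \<open>t = u \<bullet> u\<close>, the left side is the divergence of the field
  \<open>kprof p a t *\<^sub>R u\<close> in dimension \<open>2 * p\<close>. It vanishes beyond
  \<open>a\<close> because \<open>t powr (-p)\<close> is homogeneous of degree \<open>-p\<close>;
  below \<open>a\<close> only the error of the quadratic Taylor polynomial in the homogeneity
  equation is left, a multiple of \<open>(t/a - 1)^2\<close>, which is nonnegative for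
  \<open>p > 0\<close> and fades continuously at \<open>a\<close>.\<close>

lemma kprof_divergence:
  assumes "a > 0"
  shows "2 * p * kprof p a t + 2 * t * kprof1 p a t =
    (if t < a then a powr (-p) * p * (p+1) * (p+2) * (t/a - 1)^2 else 0)"
proof (cases "t < a")
  case True
  define s where "s = t/a - 1"
  have t: "t = a * (s + 1)" using assms by (simp add: s_def)
  show ?thesis using True assms
    by (simp add: kprof_def kprof1_def powr_shift flip: s_def)
      (simp add: t power2_eq_square field_simps)
next
  case False
  then show ?thesis using assms by (simp add: kprof_def kprof1_def powr_diff field_simps)
qed

text \<open>For \<open>norm u \<ge> sqrt a\<close> this is the component along \<open>w\<close> of the Newtonian field
  \<open>u / norm u ^ DIM('a)\<close>.\<close>

definition kern :: "real \<Rightarrow> 'a::euclidean_space \<Rightarrow> 'a \<Rightarrow> real" where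
  "kern a w u = (u \<bullet> w) * kprof (DIM('a) / 2) a (u \<bullet> u)"

definition kern1 :: "real \<Rightarrow> 'a::euclidean_space \<Rightarrow> 'a \<Rightarrow> 'a \<Rightarrow> real" where
  "kern1 a w h u = (h \<bullet> w) * kprof (DIM('a) / 2) a (u \<bullet> u) + 2 * (u \<bullet> w) * (u \<bullet> h) * kprof1 (DIM('a) / 2) a (u \<bullet> u)"

definition kern2 :: "real \<Rightarrow> 'a::euclidean_space \<Rightarrow> 'a \<Rightarrow> 'a \<Rightarrow> 'a \<Rightarrow> real" where
  "kern2 a w h k u = 2 * ((h \<bullet> w) * (u \<bullet> k) + (k \<bullet> w) * (u \<bullet> h) + (u \<bullet> w) * (k \<bullet> h)) * kprof1 (DIM('a) / 2) a (u \<bullet> u)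
     + 4 * (u \<bullet> w) * (u \<bullet> h) * (u \<bullet> k) * kprof2 (DIM('a) / 2) a (u \<bullet> u)"

lemma has_partial_kern:
  fixes w h u :: "'a::euclidean_space"
  assumes "a > 0" shows "has_partial (kern a w) h (kern1 a w h u) u"
  unfolding has_partial_def kern_def kern1_def has_real_derivative_iff_has_vector_derivative[symmetric]
  by (rule derivative_eq_intros DERIV_chain'[OF _ DERIV_kprof[OF assms]] refl
     | simp add: has_real_derivative_iff_has_vector_derivative inner_commute algebra_simps)+

lemma has_partial_kern1:
  fixes w h k u :: "'a::euclidean_space"
  assumes "a > 0" shows "has_partial (kern1 a w h) k (kern2 a w h k u) u"
  unfolding has_partial_def kern1_def kern2_def has_real_derivative_iff_has_vector_derivative[symmetric]
  by (rule derivative_eq_intros DERIV_chain'[OF _ DERIV_kprof[OF assms]] DERIV_chain'[OF _ DERIV_kprof1[OF assms]] refl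
     | simp add: has_real_derivative_iff_has_vector_derivative inner_commute algebra_simps)+

lemma continuous_kern:
  fixes w :: "'a::euclidean_space"
  assumes "a > 0" shows "continuous_on UNIV (kern a w)"
  unfolding kern_def[abs_def]
  by (intro continuous_intros continuous_on_compose2[OF continuous_kprof[OF assms]]) auto

lemma continuous_kern1:
  fixes w :: "'a::euclidean_space"
  assumes "a > 0" shows "continuous_on UNIV (kern1 a w h)"
  unfolding kern1_def[abs_def]
  by (intro continuous_intros continuous_on_compose2[OF continuous_kprof[OF assms]]
     continuous_on_compose2[OF continuous_kprof1[OF assms]]) auto

lemma continuous_kern2:
  fixes w :: "'a::euclidean_space"
  assumes "a > 0" shows "continuous_on UNIV (kern2 a w h k)"
  unfolding kern2_def[abs_def]
  by (intro continuous_intros continuous_on_compose2[OF continuous_kprof1[OF assms]]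
     continuous_on_compose2[OF continuous_kprof2[OF assms]]) auto

text \<open>The field is half the gradient of a primitive of \<open>kprof\<close> taken at
  \<open>u \<bullet> u\<close>, so its derivative is a symmetric bilinear form; the cancellation of
  mixed Clifford terms rests on this.\<close>

lemma kern1_commute: "kern1 a w h u = kern1 a h w u"
  by (simp add: kern1_def inner_commute)

lemma kern2_commute: "kern2 a w h k u = kern2 a w k h u"
  by (simp add: kern2_def inner_commute algebra_simps)

lemma kern_eq_newton:
  fixes u w :: "'a::euclidean_space"
  assumes "0 < a" "a \<le> u \<bullet> u"
  shows "kern a w u = (u \<bullet> w) * norm u powr (- real DIM('a))"
proof -
  have "u \<noteq> 0" using assms by auto
  then have "(u \<bullet> u) powr (- (real DIM('a) / 2)) = norm u powr (- real DIM('a))"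
    by (simp add: dot_square_norm powr_powr flip: powr_numeral)
  then show ?thesis using assms by (simp add: kern_def kprof_def)
qed

text \<open>The divergence of the vector field with components \<open>kern a\<close>.\<close>

definition bump :: "real \<Rightarrow> 'a::euclidean_space \<Rightarrow> real" where
  "bump a u = (let p = real DIM('a) / 2 in
     if u \<bullet> u < a then a powr (-p) * p * (p+1) * (p+2) * (u \<bullet> u / a - 1)^2 else 0)"

section \<open>Orthonormal expansions and the approximate identity\<close>

locale orthonormal_basis =
  fixes v :: "nat \<Rightarrow> 'a::euclidean_space"
  assumes orthonormal: "i < DIM('a) \<Longrightarrow> j < DIM('a) \<Longrightarrow> v i \<bullet> v j = (if i = j then 1 else 0)"
begin

lemma expansion: "(\<Sum>i<DIM('a). (x \<bullet> v i) *\<^sub>R v i) = x"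
proof -
  have inj: "inj_on v {..<DIM('a)}"
    using orthonormal by (intro inj_onI) (metis lessThan_iff zero_neq_one)
  let ?B = "v ` {..<DIM('a)}"
  have card: "card ?B = DIM('a)" using inj by (simp add: card_image)
  have "pairwise orthogonal ?B"
    using orthonormal unfolding pairwise_def orthogonal_def by auto
  moreover have "0 \<notin> ?B" using orthonormal by force
  ultimately have ind: "independent ?B" by (rule pairwise_orthogonal_independent)
  have "span ?B = UNIV"
    using card ind card_ge_dim_independent[of ?B UNIV] by auto
  then have "x \<in> span ?B" by simp
  then obtain c where "x = (\<Sum>b\<in>?B. c b *\<^sub>R b)" by (auto simp: span_finite)
  then have x: "x = (\<Sum>i<DIM('a). c (v i) *\<^sub>R v i)" by (simp add: sum.reindex[OF inj])
  have "x \<bullet> v j = c (v j)" if "j < DIM('a)" for j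
  proof -
    have "x \<bullet> v j = (\<Sum>i<DIM('a). c (v i) * (if i = j then 1 else 0))"
      by (subst x) (use that in \<open>auto simp: inner_sum_left orthonormal intro!: sum.cong\<close>)
    also have "\<dots> = (\<Sum>i<DIM('a). if i = j then c (v i) else 0)" by (intro sum.cong) auto
    finally show ?thesis using that by simp
  qed
  then have "(\<Sum>i<DIM('a). (x \<bullet> v i) *\<^sub>R v i) = (\<Sum>i<DIM('a). c (v i) *\<^sub>R v i)" by simp
  then show ?thesis using x by simp
qed

lemma inner_expansion: "(\<Sum>i<DIM('a). (x \<bullet> v i) * (y \<bullet> v i)) = x \<bullet> y"
  using arg_cong[OF expansion[of x], of "\<lambda>z. z \<bullet> y"]
  unfolding inner_sum_left inner_scaleR_left by (simp add: inner_commute)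

lemma bump_eq_divergence:
  assumes "a > 0" shows "bump a u = (\<Sum>s<DIM('a). kern1 a (v s) (v s) u)"
proof -
  let ?p = "real DIM('a) / 2"
  have "(\<Sum>s<DIM('a). kern1 a (v s) (v s) u) = 2 * ?p * kprof ?p a (u \<bullet> u) + 2 * (u \<bullet> u) * kprof1 ?p a (u \<bullet> u)"
  proof -
    have "(\<Sum>s<DIM('a). kern1 a (v s) (v s) u) =
        (\<Sum>s<DIM('a). kprof ?p a (u \<bullet> u) + 2 * kprof1 ?p a (u \<bullet> u) * ((u \<bullet> v s) * (u \<bullet> v s)))"
      by (intro sum.cong) (auto simp: kern1_def orthonormal)
    also have "\<dots> = real DIM('a) * kprof ?p a (u \<bullet> u) + 2 * kprof1 ?p a (u \<bullet> u) * (u \<bullet> u)"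
      unfolding sum.distrib sum_distrib_left[symmetric] inner_expansion by simp
    finally show ?thesis by simp
  qed
  also have "\<dots> = bump a u"
    unfolding kprof_divergence[OF assms] bump_def Let_def ..
  finally show ?thesis ..
qed

lemma continuous_bump: "a > 0 \<Longrightarrow> continuous_on UNIV (bump a :: 'a \<Rightarrow> real)"
proof -
  assume a: "a > 0"
  have "continuous_on UNIV (\<lambda>u. \<Sum>s<DIM('a). kern1 a (v s) (v s) u)"
    by (intro continuous_intros continuous_kern1[OF a])
  then show ?thesis using bump_eq_divergence[OF a] by simp
qed

end

lemma bump_minus: "bump a (- u) = bump a u"
  unfolding bump_def inner_minus_left inner_minus_right minus_minus ..

lemma bump_nonneg: "a > 0 \<Longrightarrow> bump a u \<ge> 0"
  by (simp add: bump_def Let_def)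

lemma outside_cbox_norm:
  fixes y :: "'a::euclidean_space"
  assumes "y \<notin> cbox (- (r *\<^sub>R One)) (r *\<^sub>R One)" shows "r < norm y"
proof -
  obtain i where i: "i \<in> Basis" "\<not> (-r \<le> y \<bullet> i \<and> y \<bullet> i \<le> r)"
    using assms by (auto simp: mem_box)
  then have "r < \<bar>y \<bullet> i\<bar>" by auto
  also have "\<dots> \<le> norm y" using i Basis_le_norm by blast
  finally show ?thesis .
qed

lemma bump_outside:
  assumes "r > 0" "r \<le> norm u" shows "bump (r^2) u = 0"
proof -
  have "r^2 \<le> u \<bullet> u" using assms power_mono[of r "norm u" 2] unfolding dot_square_norm by simp
  then show ?thesis by (simp add: bump_def)
qed

text \<open>By the divergence theorem this is the area of the unit sphere, but it enters only as a
  positive normalizing factor.\<close>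

definition bump_mass :: "'a::euclidean_space itself \<Rightarrow> real" where
  "bump_mass _ = integral UNIV (bump 1 :: 'a \<Rightarrow> real)"

context orthonormal_basis
begin

lemma bump_integrable:
  assumes "r > 0" shows "(bump (r^2) :: 'a \<Rightarrow> real) integrable_on UNIV"
  by (rule integrable_UNIV_compact_support[where a="- (r *\<^sub>R One)" and b="r *\<^sub>R One"])
    (use assms in \<open>auto intro!: continuous_bump bump_outside dest: outside_cbox_norm[THEN less_imp_le]\<close>)

text \<open>Beyond \<open>R\<close> the smoothed kernels for the scales \<open>r\<close> and 1 both
  equal the Newtonian one, so their difference has compact support and the integral of its
  divergence is 0.\<close>

lemma integral_bump:
  assumes "r > 0" shows "integral UNIV (bump (r^2) :: 'a \<Rightarrow> real) = bump_mass TYPE('a)"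
proof -
  define R where "R = max r 1"
  have r2: "r^2 > 0" and R: "R > 0" using assms by (auto simp: R_def)
  have eq: "kern (r^2) w u = kern 1 w u" if "R < norm u" for w u :: 'a
  proof -
    have "r \<le> norm u" "1 \<le> norm u" using that by (auto simp: R_def)
    then have "r^2 \<le> u \<bullet> u" "1 \<le> u \<bullet> u" using assms
      using power_mono[of r "norm u" 2] power_mono[of 1 "norm u" 2] by (auto simp: dot_square_norm)
    then show ?thesis using r2 by (simp add: kern_eq_newton)
  qed
  have out: "kern (r^2) w u - kern 1 w u = 0" if "u \<notin> cbox (- (R *\<^sub>R One)) (R *\<^sub>R One)" for w u :: 'a
    using eq[OF outside_cbox_norm[OF that]] by simp
  have zero: "integral UNIV (\<lambda>u. kern1 (r^2) w w u - kern1 1 w w u) = 0" for w :: 'a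
  proof (rule integral_partial_eq_0)
    show "has_partial (\<lambda>u. kern (r^2) w u - kern 1 w u) w (kern1 (r^2) w w u - kern1 1 w w u) u" for u
      using has_partial_kern[OF r2, of w w u] has_partial_kern[of 1 w w u]
      unfolding has_partial_def by (auto intro: has_vector_derivative_diff)
  qed (use out in \<open>auto intro!: continuous_intros continuous_kern continuous_kern1 r2\<close>)
  have intg: "(\<lambda>u. kern1 (r^2) w w u - kern1 1 w w u) integrable_on UNIV" for w :: 'a
  proof (rule integrable_UNIV_compact_support[where a="- ((R+1) *\<^sub>R One)" and b="(R+1) *\<^sub>R One"])
    fix u :: 'a assume "u \<notin> cbox (- ((R + 1) *\<^sub>R One)) ((R + 1) *\<^sub>R One)"
    then have u: "u \<in> {u. R < norm u}" using outside_cbox_norm[of u "R+1"] by auto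
    have "open {u::'a. R < norm u}" by (intro open_Collect_less continuous_intros)
    then have "has_partial (kern 1 w) w (kern1 (r^2) w w u) u"
      using has_partial_kern[OF r2, of w w u] has_partial_cong[OF _ u, of "kern (r^2) w" "kern 1 w" w] eq by simp
    then have "kern1 (r^2) w w u = kern1 1 w w u"
      using has_partial_kern[of 1 w w u] vector_derivative_unique_at unfolding has_partial_def by fastforce
    then show "kern1 (r^2) w w u - kern1 1 w w u = 0" by simp
  qed (use r2 in \<open>auto intro!: continuous_intros continuous_kern1\<close>)
  have "integral UNIV (\<lambda>u::'a. bump (r^2) u - bump 1 u) =
    integral UNIV (\<lambda>u. \<Sum>s<DIM('a). kern1 (r^2) (v s) (v s) u - kern1 1 (v s) (v s) u)"
    by (simp add: bump_eq_divergence[OF r2] bump_eq_divergence[of 1] sum_subtractf)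
  also have "\<dots> = 0"
    by (subst integral_sum) (use intg zero in auto)
  finally show ?thesis
    using bump_integrable[OF assms] bump_integrable[of 1]
    by (simp add: integral_diff bump_mass_def)
qed

lemma bump_mass_pos: "bump_mass TYPE('a) > 0"
proof -
  have *: "bump 1 (0::'a) > 0"
    by (simp add: bump_def Let_def add_pos_pos)
  let ?a = "- ((1::real) *\<^sub>R (One::'a))" and ?b = "(1::real) *\<^sub>R (One::'a)"
  have out: "bump 1 u = 0" if "u \<notin> cbox ?a ?b" for u :: 'a
    using outside_cbox_norm[OF that] bump_outside[of 1 u] by simp
  have eq: "integral (cbox ?a ?b) (bump 1 :: 'a \<Rightarrow> real) = bump_mass TYPE('a)"
    unfolding bump_mass_def by (rule integral_cbox_eq_UNIV) (rule out)
  have "0 \<in> cbox ?a ?b" "box ?a ?b \<noteq> {}"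
    by (auto simp: mem_box box_ne_empty)
  then have "integral (cbox ?a ?b) (bump 1 :: 'a \<Rightarrow> real) \<noteq> 0"
    using * by (subst integral_cbox_eq_0_iff) (auto intro!: continuous_on_subset[OF continuous_bump] bump_nonneg)
  moreover have "integral (cbox ?a ?b) (bump 1 :: 'a \<Rightarrow> real) \<ge> 0"
    by (rule integral_nonneg) (auto intro!: integrable_continuous continuous_on_subset[OF continuous_bump] bump_nonneg)
  ultimately show ?thesis using eq by simp
qed

text \<open>The convolutions are assumed to be constant for small \<open>r\<close> instead of merely
  convergent, which is what the representation supplies. So no limit is taken: a fixed vector whose
  distance to \<open>bump_mass TYPE('a) *\<^sub>R G x\<close> is below every positive bound equals
  it.\<close>

lemma convol_bump_limit:
  fixes G :: "'a \<Rightarrow> 'a"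
  assumes G: "continuous_on UNIV G"
    and R: "r0 > 0" "\<And>r. 0 < r \<Longrightarrow> r < r0 \<Longrightarrow> convol (bump (r^2)) G x = R"
  shows "R = bump_mass TYPE('a) *\<^sub>R G x"
proof -
  let ?m = "bump_mass TYPE('a)"
  have bound: "norm (R - ?m *\<^sub>R G x) \<le> ?m * \<epsilon>" if "\<epsilon> > 0" for \<epsilon>
  proof -
    have "\<exists>d>0. \<forall>y. dist y x < d \<longrightarrow> dist (G y) (G x) < \<epsilon>"
      using G[unfolded continuous_on_iff, rule_format, of x \<epsilon>] that by simp
    then obtain d where d: "d > 0" "\<And>y. dist y x < d \<Longrightarrow> dist (G y) (G x) < \<epsilon>"
      by blast
    define r where "r = min d r0 / 2"
    have r: "r > 0" "r < r0" "r < d" using d R by (auto simp: r_def min_def)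
    have r2: "r^2 > 0" using r by simp
    have out: "bump (r^2) (x - y) = 0" if "y \<notin> cbox (- ((norm x + r) *\<^sub>R One)) ((norm x + r) *\<^sub>R One)" for y
      using outside_cbox_norm[OF that] norm_triangle_ineq2[of y x] r bump_outside[of r "x - y"]
      by (simp add: norm_minus_commute)
    have cont: "continuous_on UNIV (\<lambda>y. bump (r^2) (x - y))"
      by (intro continuous_on_compose2[OF continuous_bump[OF r2]] continuous_intros) auto
    note intg = integrable_UNIV_compact_support[where a="- ((norm x + r) *\<^sub>R One)" and b="(norm x + r) *\<^sub>R One"]
    have mass: "((\<lambda>y. bump (r^2) (x - y)) has_integral ?m) UNIV"
    proof -
      have "(\<lambda>y. bump (r^2) (x - y)) = (\<lambda>y. bump (r^2) (y + - x))"
        using bump_minus[of "r^2" "x - y" for y] by simp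
      moreover have "integral UNIV (\<lambda>y. bump (r^2) (y + - x)) = integral UNIV (bump (r^2) :: 'a \<Rightarrow> real)"
        by (rule integral_UNIV_translate[of "- (r *\<^sub>R One)" "r *\<^sub>R One"])
          (use r in \<open>auto intro!: bump_outside dest: outside_cbox_norm[THEN less_imp_le]\<close>)
      moreover have "(\<lambda>y. bump (r^2) (x - y)) integrable_on UNIV"
        using cont out by (rule intg)
      ultimately show ?thesis using integral_bump[OF r(1)] by (simp add: has_integral_iff)
    qed
    have 1: "((\<lambda>y. bump (r^2) (x - y) *\<^sub>R G y) has_integral R) UNIV"
      using R(2)[OF r(1,2)] out unfolding convol_def has_integral_iff
      by (auto intro!: intg continuous_intros cont G)
    have 2: "((\<lambda>y. bump (r^2) (x - y) *\<^sub>R G x) has_integral ?m *\<^sub>R G x) UNIV"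
      using mass by (rule has_integral_scaleR_left)
    have 3: "((\<lambda>y. bump (r^2) (x - y) *\<^sub>R G y - bump (r^2) (x - y) *\<^sub>R G x) has_integral R - ?m *\<^sub>R G x) UNIV"
      by (rule has_integral_diff[OF 1 2])
    have 4: "((\<lambda>y. bump (r^2) (x - y) * \<epsilon>) has_integral ?m * \<epsilon>) UNIV"
      using mass by (rule has_integral_mult_left)
    have 5: "norm (bump (r^2) (x - y) *\<^sub>R G y - bump (r^2) (x - y) *\<^sub>R G x) \<le> bump (r^2) (x - y) * \<epsilon>" for y
    proof (cases "dist y x < d")
      case True
      then have "norm (G y - G x) \<le> \<epsilon>" using d(2)[of y] by (simp add: dist_norm)
      then show ?thesis using bump_nonneg[OF r2, of "x - y"]
        by (simp add: scaleR_diff_right[symmetric] mult_left_mono)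
    next
      case False
      then have "bump (r^2) (x - y) = 0"
        using r by (intro bump_outside) (auto simp: dist_norm norm_minus_commute)
      then show ?thesis by simp
    qed
    show ?thesis
      using integral_norm_bound_integral[of "\<lambda>y. bump (r^2) (x - y) *\<^sub>R G y - bump (r^2) (x - y) *\<^sub>R G x" UNIV
          "\<lambda>y. bump (r^2) (x - y) * \<epsilon>"] 3 4 5
      by (auto simp: has_integral_iff)
  qed
  have "norm (R - ?m *\<^sub>R G x) \<le> 0"
  proof (rule field_le_epsilon)
    fix e :: real assume "e > 0"
    then show "norm (R - ?m *\<^sub>R G x) \<le> 0 + e"
      using bound[of "e / ?m"] bump_mass_pos by simp
  qed
  then show ?thesis by simp
qed

end

subsection \<open>Integral representation of null solutions of a Dirac operator\<close>

lemma has_partial_sum: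
  assumes "\<And>i. i \<in> I \<Longrightarrow> has_partial (f i) h (f' i) x"
  shows "has_partial (\<lambda>y. \<Sum>i\<in>I. f i y) h (\<Sum>i\<in>I. f' i) x"
  using assms unfolding has_partial_def by (intro has_vector_derivative_sum) auto

lemma has_partial_linear:
  fixes L :: "'a::euclidean_space \<Rightarrow> 'b::real_normed_vector"
  assumes "linear L" "has_partial f h D x" shows "has_partial (\<lambda>y. L (f y)) h (L D) x"
  using assms bounded_linear.has_vector_derivative[of L] linear_conv_bounded_linear
  unfolding has_partial_def by blast

lemma continuous_on_linear:
  fixes L :: "'a::euclidean_space \<Rightarrow> 'b::real_normed_vector"
  assumes "linear L" "continuous_on S f" shows "continuous_on S (\<lambda>x. L (f x))"
  using assms by (simp add: linear_conv_bounded_linear bounded_linear.continuous_on)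

lemma convol_linear:
  fixes L :: "'b::euclidean_space \<Rightarrow> 'c::euclidean_space"
  assumes "linear L" "continuous_on UNIV k" "continuous_on UNIV H" "\<And>y. y \<notin> cbox a b \<Longrightarrow> H y = 0"
  shows "convol k (\<lambda>y. L (H y)) x = L (convol k H x)"
proof -
  have "(\<lambda>y. k (x - y) *\<^sub>R H y) integrable_on UNIV"
    by (rule integrable_UNIV_compact_support[where a=a and b=b])
      (auto intro!: continuous_intros continuous_on_compose2[OF assms(2)] assms)
  then have "integral UNIV (L \<circ> (\<lambda>y. k (x - y) *\<^sub>R H y)) = L (integral UNIV (\<lambda>y. k (x - y) *\<^sub>R H y))"
    using assms(1) by (intro integral_linear) (auto simp: linear_conv_bounded_linear)
  then show ?thesis using assms(1) by (simp add: convol_def o_def linear_scale)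
qed

lemma convol_sum_left:
  fixes H :: "'a::euclidean_space \<Rightarrow> 'b::banach"
  assumes "finite I" "\<And>i. i \<in> I \<Longrightarrow> continuous_on UNIV (k i)" "continuous_on UNIV H" "\<And>y. y \<notin> cbox a b \<Longrightarrow> H y = 0"
  shows "convol (\<lambda>u. \<Sum>i\<in>I. k i u) H x = (\<Sum>i\<in>I. convol (k i) H x)"
  unfolding convol_def scaleR_sum_left
proof (rule integral_sum)
  fix i assume "i \<in> I"
  then show "(\<lambda>y. k i (x - y) *\<^sub>R H y) integrable_on UNIV"
    by (intro integrable_UNIV_compact_support[where a=a and b=b])
      (auto intro!: continuous_intros continuous_on_compose2[OF assms(2)] assms)
qed (rule assms)

lemma convol_sum_right:
  fixes H :: "'i \<Rightarrow> 'a::euclidean_space \<Rightarrow> 'b::banach"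
  assumes "finite I" "continuous_on UNIV k" "\<And>i. i \<in> I \<Longrightarrow> continuous_on UNIV (H i)" "\<And>i y. i \<in> I \<Longrightarrow> y \<notin> cbox a b \<Longrightarrow> H i y = 0"
  shows "convol k (\<lambda>y. \<Sum>i\<in>I. H i y) x = (\<Sum>i\<in>I. convol k (H i) x)"
  unfolding convol_def scaleR_sum_right
proof (rule integral_sum)
  fix i assume "i \<in> I"
  then show "(\<lambda>y. k (x - y) *\<^sub>R H i y) integrable_on UNIV"
    by (intro integrable_UNIV_compact_support[where a=a and b=b])
      (auto intro!: continuous_intros continuous_on_compose2[OF assms(2)] assms)
qed (rule assms)

lemma convol_scaleR_right: "convol k (\<lambda>y. c *\<^sub>R H y) x = c *\<^sub>R convol k H x"
  unfolding convol_def integral_cmul[symmetric] scaleR_left_commute[of c] ..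

section \<open>A continuously differentiable radial cutoff\<close>

definition plus_sq :: "real \<Rightarrow> real" where "plus_sq t = (if t < 0 then 0 else t^2)"

lemma DERIV_plus_sq: "(plus_sq has_real_derivative 2 * max 0 t) (at t)"
proof -
  have "((\<lambda>t. if t < 0 then 0 else t^2) has_real_derivative (if t < 0 then 0 else 2 * t)) (at t)"
    by (rule DERIV_if_less) (auto intro!: derivative_eq_intros)
  moreover have "(if t < 0 then 0 else 2 * t) = 2 * max 0 t" by auto
  ultimately show ?thesis by (simp add: plus_sq_def[abs_def])
qed

text \<open>A quadratic spline with the equally spaced knots \<open>\<alpha>\<close>,
  \<open>\<gamma>\<close>, \<open>\<beta>\<close>: left of all knots the second difference of a
  square is the constant \<open>2 * h^2\<close>, right of them every truncated square is 0.\<close>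

lemma cutoff_profile:
  fixes \<alpha> \<beta> :: real
  assumes "\<alpha> < \<beta>"
  obtains \<eta> \<eta>' where "\<And>t. (\<eta> has_real_derivative \<eta>' t) (at t)" "continuous_on UNIV \<eta>'"
    "\<And>t. t \<le> \<alpha> \<Longrightarrow> \<eta> t = 1" "\<And>t. t \<le> \<alpha> \<Longrightarrow> \<eta>' t = 0" "\<And>t. t \<ge> \<beta> \<Longrightarrow> \<eta> t = 0" "\<And>t. t \<ge> \<beta> \<Longrightarrow> \<eta>' t = 0"
proof
  define h where "h = (\<beta> - \<alpha>) / 2"
  define \<gamma> where "\<gamma> = (\<beta> + \<alpha>) / 2"
  have h: "h > 0" "\<beta> = \<gamma> + h" "\<alpha> = \<gamma> - h" using assms by (auto simp: h_def \<gamma>_def field_simps)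
  let ?\<eta> = "\<lambda>t. (plus_sq (\<beta> - t) - 2 * plus_sq (\<gamma> - t) + plus_sq (\<alpha> - t)) / (2 * h^2)"
  let ?\<eta>' = "\<lambda>t. - (max 0 (\<beta> - t) - 2 * max 0 (\<gamma> - t) + max 0 (\<alpha> - t)) / h^2"
  show "(?\<eta> has_real_derivative ?\<eta>' t) (at t)" for t
    by (rule derivative_eq_intros DERIV_chain'[OF _ DERIV_plus_sq] refl)+ (use h in \<open>auto simp: field_simps\<close>)
  show "continuous_on UNIV ?\<eta>'" using h by (auto intro!: continuous_intros)
  show "?\<eta> t = 1" if "t \<le> \<alpha>" for t using that h
    by (simp add: plus_sq_def) (simp add: power2_eq_square field_simps)
  show "?\<eta>' t = 0" if "t \<le> \<alpha>" for t using that h by (simp add: max_def)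
  show "?\<eta> t = 0" if "t \<ge> \<beta>" for t using that h by (simp add: plus_sq_def)
  show "?\<eta>' t = 0" if "t \<ge> \<beta>" for t using that h by (simp add: max_def)
qed

lemma cutoff_function:
  fixes r1 r2 :: real
  assumes "0 < r1" "r1 < r2"
  obtains \<psi> :: "'a::euclidean_space \<Rightarrow> real" and \<psi>' :: "'a \<Rightarrow> 'a \<Rightarrow> real"
  where "\<And>h y. has_partial \<psi> h (\<psi>' h y) y" "continuous_on UNIV \<psi>" "\<And>h. continuous_on UNIV (\<psi>' h)"
    "\<And>y. norm y \<le> r1 \<Longrightarrow> \<psi> y = 1" "\<And>h y. norm y \<le> r1 \<Longrightarrow> \<psi>' h y = 0"
    "\<And>y. norm y \<ge> r2 \<Longrightarrow> \<psi> y = 0" "\<And>h y. norm y \<ge> r2 \<Longrightarrow> \<psi>' h y = 0"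
proof -
  have "r1^2 < r2^2" using assms by (intro power_strict_mono) auto
  then obtain \<eta> \<eta>' where \<eta>: "\<And>t. (\<eta> has_real_derivative \<eta>' t) (at t)" "continuous_on UNIV \<eta>'"
    "\<And>t. t \<le> r1^2 \<Longrightarrow> \<eta> t = 1" "\<And>t. t \<le> r1^2 \<Longrightarrow> \<eta>' t = 0" "\<And>t. t \<ge> r2^2 \<Longrightarrow> \<eta> t = 0" "\<And>t. t \<ge> r2^2 \<Longrightarrow> \<eta>' t = 0"
    by (rule cutoff_profile) blast
  have \<eta>c: "continuous_on UNIV \<eta>" using \<eta>(1) by (meson DERIV_continuous_on has_field_derivative_at_within)
  have le: "y \<bullet> y \<le> r1^2" if "norm y \<le> r1" for y :: 'a
    using that unfolding dot_square_norm by (intro power_mono) auto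
  have ge: "y \<bullet> y \<ge> r2^2" if "norm y \<ge> r2" for y :: 'a
    using that assms unfolding dot_square_norm by (intro power_mono) auto
  show thesis
  proof (rule that[of "\<lambda>y. \<eta> (y \<bullet> y)" "\<lambda>h y. \<eta>' (y \<bullet> y) * (2 * (y \<bullet> h))"])
    show "has_partial (\<lambda>y. \<eta> (y \<bullet> y)) h (\<eta>' (y \<bullet> y) * (2 * (y \<bullet> h))) y" for h y :: 'a
    proof -
      have "((\<lambda>t. (y + t *\<^sub>R h) \<bullet> (y + t *\<^sub>R h)) has_real_derivative 2 * (y \<bullet> h)) (at 0)"
        unfolding has_field_derivative_def
        by (auto intro!: derivative_eq_intros simp: inner_commute algebra_simps)
      from DERIV_chain'[OF this \<eta>(1)] show ?thesis
        unfolding has_partial_def has_real_derivative_iff_has_vector_derivative[symmetric] by simp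
    qed
    show "continuous_on UNIV (\<lambda>y::'a. \<eta> (y \<bullet> y))"
      by (intro continuous_on_compose2[OF \<eta>c] continuous_intros) auto
    show "continuous_on UNIV (\<lambda>y::'a. \<eta>' (y \<bullet> y) * (2 * (y \<bullet> h)))" for h
      by (intro continuous_intros continuous_on_compose2[OF \<eta>(2)]) auto
  qed (use \<eta> le ge in auto)
qed

text \<open>\<open>F\<close> is uncontrolled outside the ball, but there the product is 0; since
  \<open>r < \<rho>\<close>, two open sets with continuous restrictions cover the space.\<close>

lemma continuous_on_cutoff:
  fixes F :: "'a::euclidean_space \<Rightarrow> 'b::real_normed_vector"
  assumes \<phi>: "continuous_on UNIV \<phi>" "\<And>y. norm y \<ge> r \<Longrightarrow> \<phi> y = 0" and "r < \<rho>"
    and F: "continuous_on (ball 0 \<rho>) F"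
  shows "continuous_on UNIV (\<lambda>y. \<phi> y *\<^sub>R F y)"
proof -
  have "continuous_on (- cball 0 r) (\<lambda>y. \<phi> y *\<^sub>R F y)"
    by (rule continuous_on_eq[of _ "\<lambda>_. 0"]) (use \<phi> in auto)
  moreover have "continuous_on (ball 0 \<rho>) (\<lambda>y. \<phi> y *\<^sub>R F y)"
    by (intro continuous_intros F continuous_on_subset[OF \<phi>(1)]) auto
  ultimately have "continuous_on (ball 0 \<rho> \<union> - cball 0 r) (\<lambda>y. \<phi> y *\<^sub>R F y)"
    by (intro continuous_on_open_Un) auto
  moreover have "ball 0 \<rho> \<union> - cball 0 r = (UNIV :: 'a set)" using assms(3) by auto
  ultimately show ?thesis by metis
qed

definition newton :: "'a::euclidean_space \<Rightarrow> 'a \<Rightarrow> real" where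
  "newton w u = (u \<bullet> w) * norm u powr (- real DIM('a))"

text \<open>Points of the support of \<open>H\<close> are at distance at least \<open>r\<close> from
  \<open>x\<close>, where smoothing at scale \<open>r\<close> has not changed the kernel.\<close>

lemma convol_newton:
  fixes H :: "'a::euclidean_space \<Rightarrow> 'a"
  assumes "0 < r" "norm x + r \<le> r1" "\<And>y. norm y < r1 \<Longrightarrow> H y = 0"
  shows "convol (newton w) H x = convol (kern (r^2) w) H x"
  unfolding convol_def
proof (rule integral_cong)
  fix y :: 'a
  show "newton w (x - y) *\<^sub>R H y = kern (r^2) w (x - y) *\<^sub>R H y"
  proof (cases "norm y < r1")
    case False
    then have "r \<le> norm (x - y)"
      using norm_triangle_ineq2[of y x] assms(2) by (simp add: norm_minus_commute)
    then have "r^2 \<le> (x - y) \<bullet> (x - y)" unfolding dot_square_norm using assms(1) by (intro power_mono) auto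
    then show ?thesis using assms(1) by (simp add: newton_def kern_eq_newton)
  qed (simp add: assms)
qed

text \<open>Linear maps take the place of algebra elements, so that composition is associative and
  alternativity is hidden in the two composition laws. \<open>Ab s\<close> stands for left
  multiplication by the conjugate of \<open>v s\<close>.\<close>

locale clifford_system = orthonormal_basis v for v :: "nat \<Rightarrow> 'a::euclidean_space" +
  fixes m :: nat and A Ab :: "nat \<Rightarrow> 'a \<Rightarrow> 'a"
  assumes m_less: "m < DIM('a)"
    and linear_A: "s \<le> m \<Longrightarrow> linear (A s)" and linear_Ab: "s \<le> m \<Longrightarrow> linear (Ab s)"
    and Ab_A: "s \<le> m \<Longrightarrow> Ab s (A s z) = z"
    and Ab_A_anti: "s \<le> m \<Longrightarrow> t \<le> m \<Longrightarrow> s \<noteq> t \<Longrightarrow> Ab s (A t z) + Ab t (A s z) = 0"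
begin

text \<open>The double sum is added to its transpose: by symmetry of \<open>C\<close> and
  \<open>Ab_A_anti\<close> the off-diagonal terms cancel, and by \<open>Ab_A\<close> the diagonal is
  doubled.\<close>

lemma clifford_sum:
  assumes "\<And>s t. s \<le> m \<Longrightarrow> t \<le> m \<Longrightarrow> C s t = C t s"
  shows "(\<Sum>s\<le>m. Ab s (\<Sum>t\<le>m. A t (C s t))) = (\<Sum>s\<le>m. C s s)"
proof -
  let ?S = "\<Sum>s\<le>m. \<Sum>t\<le>m. Ab s (A t (C s t))"
  have eq: "(\<Sum>s\<le>m. Ab s (\<Sum>t\<le>m. A t (C s t))) = ?S"
    by (intro sum.cong) (auto simp: linear_sum[OF linear_Ab])
  have "?S = (\<Sum>s\<le>m. \<Sum>t\<le>m. Ab t (A s (C t s)))" by (rule sum.swap)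
  then have "?S + ?S = (\<Sum>s\<le>m. \<Sum>t\<le>m. Ab s (A t (C s t)) + Ab t (A s (C t s)))"
    by (simp add: sum.distrib)
  also have "\<dots> = (\<Sum>s\<le>m. \<Sum>t\<le>m. if t = s then C s s + C s s else 0)"
  proof (intro sum.cong refl)
    fix s t assume "s \<in> {..m}" "t \<in> {..m}"
    then show "Ab s (A t (C s t)) + Ab t (A s (C t s)) = (if t = s then C s s + C s s else 0)"
      using assms[of s t] by (auto simp: Ab_A Ab_A_anti)
  qed
  also have "\<dots> = (\<Sum>s\<le>m. C s s + C s s)" by (intro sum.cong) auto
  also have "\<dots> = (\<Sum>s\<le>m. C s s) + (\<Sum>s\<le>m. C s s)" by (simp add: sum.distrib)
  finally have "2 *\<^sub>R ?S = 2 *\<^sub>R (\<Sum>s\<le>m. C s s)" by (simp add: scaleR_2)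
  then show ?thesis unfolding eq by simp
qed

lemma sum_split: "(\<Sum>s<DIM('a). g s) = (\<Sum>s\<le>m. g s) + (\<Sum>s\<in>{m<..<DIM('a)}. g s :: 'b::comm_monoid_add)"
proof -
  have "{..<DIM('a)} = {..m} \<union> {m<..<DIM('a)}" using m_less by auto
  then show ?thesis by (simp add: sum.union_disjoint ivl_disj_int)
qed

text \<open>The bump is the divergence of the kernels, so integration by parts moves each derivative
  to \<open>G\<close>. In the directions of \<open>M\<close> the array of convolutions of
  \<open>kern a (v s)\<close> with \<open>G' t\<close> is symmetric, and
  \<open>clifford_sum\<close>, read backwards, turns its trace into an expression in the Dirac
  operator of \<open>G\<close>; the other directions keep the plain trace.\<close>

lemma convol_bump_dirac:
  fixes G :: "'a \<Rightarrow> 'a"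
  assumes "a > 0"
    and G: "continuous_on UNIV G" "\<And>s y. s < DIM('a) \<Longrightarrow> has_partial G (v s) (G' s y) y" "\<And>s. s < DIM('a) \<Longrightarrow> continuous_on UNIV (G' s)"
    and supp: "\<And>y. y \<notin> cbox c d \<Longrightarrow> G y = 0" "\<And>s y. s < DIM('a) \<Longrightarrow> y \<notin> cbox c d \<Longrightarrow> G' s y = 0"
  shows "convol (bump a) G x = (\<Sum>s<DIM('a). convol (kern a (v s))
           (\<lambda>y. if s \<le> m then Ab s (\<Sum>t\<le>m. A t (G' t y)) else G' s y) x)"
proof -
  let ?C = "\<lambda>s t. convol (kern a (v s)) (G' t) x"
  have ibp: "?C s t = convol (kern1 a (v s) (v t)) G x" if "s < DIM('a)" "t < DIM('a)" for s t
    by (rule convol_by_parts[where a=c and b=d and h="v t"])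
      (use that assms in \<open>auto intro!: continuous_kern continuous_kern1 has_partial_kern\<close>)
  have "convol (bump a) G x = convol (\<lambda>u. \<Sum>s<DIM('a). kern1 a (v s) (v s) u) G x"
    using bump_eq_divergence[OF assms(1)] by (simp add: convol_def)
  also have "\<dots> = (\<Sum>s<DIM('a). ?C s s)"
    using convol_sum_left[of "{..<DIM('a)}" "\<lambda>s. kern1 a (v s) (v s)" G c d x]
    by (simp add: ibp continuous_kern1 assms)
  also have "\<dots> = (\<Sum>s\<le>m. ?C s s) + (\<Sum>s\<in>{m<..<DIM('a)}. ?C s s)" by (rule sum_split)
  also have "(\<Sum>s\<le>m. ?C s s) = (\<Sum>s\<le>m. Ab s (\<Sum>t\<le>m. A t (?C s t)))"
  proof (rule clifford_sum[symmetric])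
    fix s t assume "s \<le> m" "t \<le> m"
    then have st: "s < DIM('a)" "t < DIM('a)" using m_less by auto
    have "kern1 a (v s) (v t) = kern1 a (v t) (v s)" by (rule ext) (rule kern1_commute)
    with ibp[OF st] ibp[OF st(2,1)] show "?C s t = ?C t s" by (rule_tac trans) (simp_all only:)
  qed
  also have "\<dots> = (\<Sum>s\<le>m. convol (kern a (v s)) (\<lambda>y. Ab s (\<Sum>t\<le>m. A t (G' t y))) x)"
  proof (rule sum.cong[OF refl])
    fix s assume s: "s \<in> {..m}"
    have AG: "continuous_on UNIV (\<lambda>y. A t (G' t y))" "y \<notin> cbox c d \<Longrightarrow> A t (G' t y) = 0" if "t \<le> m" for t y
    proof -
      have t: "t < DIM('a)" using that m_less by simp
      show "continuous_on UNIV (\<lambda>y. A t (G' t y))"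
        by (rule continuous_on_linear[OF linear_A[OF that] G(3)[OF t]])
      show "A t (G' t y) = 0" if "y \<notin> cbox c d"
        using supp(2)[OF t that] linear_0[OF linear_A[OF \<open>t \<le> m\<close>]] by simp
    qed
    have "convol (kern a (v s)) (\<lambda>y. Ab s (\<Sum>t\<le>m. A t (G' t y))) x
        = Ab s (convol (kern a (v s)) (\<lambda>y. \<Sum>t\<le>m. A t (G' t y)) x)"
      by (rule convol_linear[where a=c and b=d])
        (use s AG in \<open>auto intro!: linear_Ab continuous_kern assms continuous_on_sum sum.neutral\<close>)
    also have "convol (kern a (v s)) (\<lambda>y. \<Sum>t\<le>m. A t (G' t y)) x = (\<Sum>t\<le>m. convol (kern a (v s)) (\<lambda>y. A t (G' t y)) x)"
      by (rule convol_sum_right[where a=c and b=d])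
        (use AG in \<open>auto intro!: continuous_kern assms\<close>)
    also have "\<dots> = (\<Sum>t\<le>m. A t (?C s t))"
      by (intro sum.cong refl convol_linear[where a=c and b=d])
        (use m_less in \<open>auto intro!: continuous_kern assms linear_A\<close>)
    finally show "Ab s (\<Sum>t\<le>m. A t (?C s t)) = convol (kern a (v s)) (\<lambda>y. Ab s (\<Sum>t\<le>m. A t (G' t y))) x" ..
  qed
  finally show ?thesis unfolding sum_split by simp
qed

end

section \<open>The Cauchy-type formula for null solutions on \<open>M\<close>\<close>

context clifford_system
begin

definition proj :: "'a \<Rightarrow> 'a" where "proj z = (\<Sum>s\<le>m. (z \<bullet> v s) *\<^sub>R v s)"

lemma linear_proj: "linear proj"
  unfolding proj_def by (intro linear_compose_sum linearI ballI) (auto simp: inner_add_left algebra_simps)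

lemma proj_v: "s < DIM('a) \<Longrightarrow> proj (v s) = (if s \<le> m then v s else 0)"
proof -
  assume s: "s < DIM('a)"
  have "proj (v s) = (\<Sum>t\<le>m. if t = s then v t else 0)"
    unfolding proj_def using s m_less by (intro sum.cong) (auto simp: orthonormal)
  then show ?thesis by simp
qed

lemma inner_proj_v: "t \<le> m \<Longrightarrow> proj z \<bullet> v t = z \<bullet> v t"
proof -
  assume t: "t \<le> m"
  have "proj z \<bullet> v t = (\<Sum>s\<le>m. (z \<bullet> v s) * (v s \<bullet> v t))" by (simp add: proj_def inner_sum_left)
  also have "\<dots> = (\<Sum>s\<le>m. if s = t then z \<bullet> v t else 0)"
    using t m_less by (intro sum.cong) (auto simp: orthonormal)
  finally show ?thesis using t by simp
qed

lemma proj_proj: "proj (proj z) = proj z"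
  by (simp add: proj_def[of "proj z"] inner_proj_v) (simp add: proj_def)

lemma norm_proj_le: "norm (proj z) \<le> norm z"
proof -
  have "proj z \<bullet> proj z = (\<Sum>s\<le>m. (z \<bullet> v s) * (v s \<bullet> proj z))"
    by (subst (1) proj_def) (simp add: inner_sum_left)
  also have "\<dots> = (\<Sum>s\<le>m. (z \<bullet> v s) * (z \<bullet> v s))"
    by (intro sum.cong) (auto simp: inner_proj_v inner_commute[of "v _" "proj z"])
  also have "\<dots> \<le> (\<Sum>s<DIM('a). (z \<bullet> v s) * (z \<bullet> v s))"
    using m_less by (intro sum_mono2) auto
  also have "\<dots> = z \<bullet> z" by (rule inner_expansion)
  finally show ?thesis by (simp add: norm_le)
qed

text \<open>The condition \<open>proj x = x\<close> stands for membership in \<open>M\<close>.\<close>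

definition rball :: "real \<Rightarrow> 'a set" where "rball \<rho> = {x. proj x = x \<and> norm x < \<rho>}"

lemma proj_rball: "z \<in> ball 0 \<rho> \<Longrightarrow> proj z \<in> rball \<rho>"
  using norm_proj_le[of z] by (simp add: rball_def proj_proj)

definition dirac_null :: "real \<Rightarrow> ('a \<Rightarrow> 'a) \<Rightarrow> bool" where
  "dirac_null \<rho> f \<longleftrightarrow> C1_on m v (rball \<rho>) f \<and> (\<forall>x\<in>rball \<rho>. (\<Sum>s\<le>m. A s (partial v s f x)) = 0)"

text \<open>Functions on \<open>M\<close> are extended to the whole space as constants along the complement of \<open>M\<close>,
  so that all integrals can be taken over the type \<open>'a\<close>.\<close>

lemma dirac_null_extend:
  assumes "dirac_null \<rho> f"
  defines "F' \<equiv> \<lambda>s z. if s \<le> m then partial v s f (proj z) else 0"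
  shows "continuous_on (ball 0 \<rho>) (\<lambda>z. f (proj z))"
    and "\<And>s z. s < DIM('a) \<Longrightarrow> z \<in> ball 0 \<rho> \<Longrightarrow> has_partial (\<lambda>z. f (proj z)) (v s) (F' s z) z"
    and "\<And>s. continuous_on (ball 0 \<rho>) (F' s)"
    and "\<And>z. z \<in> ball 0 \<rho> \<Longrightarrow> (\<Sum>s\<le>m. A s (F' s z)) = 0"
proof -
  have c: "continuous_on (ball 0 \<rho>) proj"
    using linear_proj by (intro linear_continuous_on) (simp add: linear_conv_bounded_linear)
  have im: "proj ` ball 0 \<rho> \<subseteq> rball \<rho>" using proj_rball by auto
  have f: "continuous_on (rball \<rho>) f"
    "\<And>s x. s \<le> m \<Longrightarrow> x \<in> rball \<rho> \<Longrightarrow> (\<lambda>t::real. f (x + t *\<^sub>R v s)) differentiable (at 0)"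
    "\<And>s. s \<le> m \<Longrightarrow> continuous_on (rball \<rho>) (partial v s f)"
    using assms(1) unfolding dirac_null_def C1_on_def by auto
  show "continuous_on (ball 0 \<rho>) (\<lambda>z. f (proj z))"
    by (rule continuous_on_compose2[OF f(1) c im])
  show "has_partial (\<lambda>z. f (proj z)) (v s) (F' s z) z" if s: "s < DIM('a)" "z \<in> ball 0 \<rho>" for s z
  proof -
    have e: "proj (z + t *\<^sub>R v s) = proj z + t *\<^sub>R (if s \<le> m then v s else 0)" for t
      using s by (simp add: linear_add[OF linear_proj] linear_scale[OF linear_proj] proj_v)
    show ?thesis
    proof (cases "s \<le> m")
      case True
      then show ?thesis using f(2)[OF True proj_rball[OF s(2)]] unfolding has_partial_def e
        by (simp add: F'_def partial_def vector_derivative_works)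
    next
      case False
      then show ?thesis unfolding has_partial_def e by (simp add: F'_def)
    qed
  qed
  show "continuous_on (ball 0 \<rho>) (F' s)" for s
    using continuous_on_compose2[OF f(3) c im] by (cases "s \<le> m") (auto simp: F'_def)
  show "(\<Sum>s\<le>m. A s (F' s z)) = 0" if "z \<in> ball 0 \<rho>" for z
    using assms(1) proj_rball[OF that] unfolding dirac_null_def by (simp add: F'_def)
qed

text \<open>A Cauchy-type formula: multiplying by a cutoff that equals 1 on the ball of radius \<open>r1\<close>
  moves the singularity of the kernel away from the support of the density.\<close>

lemma shell_representation:
  assumes f: "dirac_null \<rho> f" and r: "0 < r1" "r1 < \<rho>"
  obtains H r2 where "r1 < r2" "\<And>s. continuous_on UNIV (H s)"
    "\<And>s y. norm y < r1 \<Longrightarrow> H s y = 0" "\<And>s y. norm y > r2 \<Longrightarrow> H s y = 0"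
    "\<And>x. norm x < r1 \<Longrightarrow> f (proj x) = (\<Sum>s<DIM('a). convol (newton (v s)) (H s) x)"
proof -
  define r2 where "r2 = (r1 + \<rho>) / 2"
  have r2: "r1 < r2" "r2 < \<rho>" using r by (auto simp: r2_def)
  obtain \<psi> :: "'a \<Rightarrow> real" and \<psi>' where \<psi>:
    "\<And>h y. has_partial \<psi> h (\<psi>' h y) y" "continuous_on UNIV \<psi>" "\<And>h. continuous_on UNIV (\<psi>' h)"
    "\<And>y. norm y \<le> r1 \<Longrightarrow> \<psi> y = 1" "\<And>h y. norm y \<le> r1 \<Longrightarrow> \<psi>' h y = 0"
    "\<And>y. norm y \<ge> r2 \<Longrightarrow> \<psi> y = 0" "\<And>h y. norm y \<ge> r2 \<Longrightarrow> \<psi>' h y = 0"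
    by (rule cutoff_function[OF r(1) r2(1), where 'a='a]) (rule that; assumption)
  define F where "F = (\<lambda>z. f (proj z))"
  define F' where "F' = (\<lambda>s z. if s \<le> m then partial v s f (proj z) else 0)"
  have F: "continuous_on (ball 0 \<rho>) F"
    "\<And>s z. s < DIM('a) \<Longrightarrow> z \<in> ball 0 \<rho> \<Longrightarrow> has_partial F (v s) (F' s z) z"
    "\<And>s. continuous_on (ball 0 \<rho>) (F' s)"
    "\<And>z. z \<in> ball 0 \<rho> \<Longrightarrow> (\<Sum>s\<le>m. A s (F' s z)) = 0"
    unfolding F_def F'_def by (fact dirac_null_extend[OF f])+
  define G where "G = (\<lambda>y. \<psi> y *\<^sub>R F y)"
  define G' where "G' = (\<lambda>s y. \<psi>' (v s) y *\<^sub>R F y + \<psi> y *\<^sub>R F' s y)"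
  \<comment> \<open>What the Dirac operator makes of \<open>G\<close>: the null equation for
    \<open>f\<close> removes all derivatives of \<open>F\<close>, and those of \<open>\<psi>\<close>
    live in the shell. For \<open>s > m\<close> the function \<open>F\<close> is constant along
    \<open>v s\<close>, with the same effect.\<close>
  define H0 where "H0 = (\<lambda>s y. if s \<le> m then Ab s (\<Sum>t\<le>m. A t (\<psi>' (v t) y *\<^sub>R F y))
      else if s < DIM('a) then \<psi>' (v s) y *\<^sub>R F y else 0)"
  let ?m = "bump_mass TYPE('a)"
  define H where "H = (\<lambda>s y. (1 / ?m) *\<^sub>R H0 s y)"
  have cF: "continuous_on UNIV (\<lambda>y. \<psi>' h y *\<^sub>R F y)" for h
    by (rule continuous_on_cutoff[OF \<psi>(3) \<psi>(7) r2(2) F(1)])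
  have H0c: "continuous_on UNIV (H0 s)" for s
  proof -
    have "continuous_on UNIV (\<lambda>y. A t (\<psi>' (v t) y *\<^sub>R F y))" if "t \<le> m" for t
      by (rule continuous_on_linear[OF linear_A[OF that] cF])
    then have "continuous_on UNIV (\<lambda>y. \<Sum>t\<le>m. A t (\<psi>' (v t) y *\<^sub>R F y))"
      by (intro continuous_on_sum) auto
    then show ?thesis
      using continuous_on_linear[OF linear_Ab[of s]] cF[of "v s"]
      unfolding H0_def by (cases "s \<le> m"; cases "s < DIM('a)") simp_all
  qed
  have H0z: "H0 s y = 0" if "norm y \<le> r1 \<or> norm y \<ge> r2" for s y
    using that \<psi> by (auto simp: H0_def linear_0[OF linear_A] linear_0[OF linear_Ab])
  have Gc: "continuous_on UNIV G" unfolding G_def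
    by (rule continuous_on_cutoff[OF \<psi>(2) \<psi>(6) r2(2) F(1)])
  have G'c: "continuous_on UNIV (G' s)" for s
    unfolding G'_def
    by (rule continuous_on_add[OF cF continuous_on_cutoff[OF \<psi>(2) \<psi>(6) r2(2) F(3)]])
  have GG': "has_partial G (v s) (G' s y) y" if s: "s < DIM('a)" for s y
  proof (cases "norm y < \<rho>")
    case True
    then show ?thesis unfolding G_def G'_def
      by (intro has_partial_scaleR \<psi>(1) F(2) s) auto
  next
    case False
    then have y: "y \<in> - cball 0 r2" using r2 by auto
    have "has_partial G (v s) 0 y"
      by (rule has_partial_cong[OF _ y, where f="\<lambda>_. 0"]) (auto simp: G_def \<psi> has_partial_def)
    moreover have "G' s y = 0" using y by (auto simp: G'_def \<psi>)
    ultimately show ?thesis by simp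
  qed
  have G'H: "(if s \<le> m then Ab s (\<Sum>t\<le>m. A t (G' t y)) else G' s y) = H0 s y" if "s < DIM('a)" for s y
  proof (cases "norm y < \<rho>")
    case True
    have "(\<Sum>t\<le>m. A t (G' t y)) = (\<Sum>t\<le>m. A t (\<psi>' (v t) y *\<^sub>R F y)) + \<psi> y *\<^sub>R (\<Sum>t\<le>m. A t (F' t y))"
      unfolding G'_def scaleR_sum_right sum.distrib[symmetric]
      by (intro sum.cong) (auto simp: linear_add[OF linear_A] linear_scale[OF linear_A])
    also have "(\<Sum>t\<le>m. A t (F' t y)) = 0" using F(4) True by simp
    finally show ?thesis using that by (simp add: H0_def) (simp add: G'_def F'_def)
  next
    case False
    then have "norm y \<ge> r2" using r2 by auto
    then show ?thesis
      by (auto simp: H0_def G'_def \<psi> linear_0[OF linear_A] linear_0[OF linear_Ab])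
  qed
  have rep: "convol (bump a) G x = (\<Sum>s<DIM('a). convol (kern a (v s)) (H0 s) x)" if "a > 0" for a x
  proof -
    have "convol (bump a) G x = (\<Sum>s<DIM('a). convol (kern a (v s))
           (\<lambda>y. if s \<le> m then Ab s (\<Sum>t\<le>m. A t (G' t y)) else G' s y) x)"
    proof (rule convol_bump_dirac[OF that Gc GG' G'c, where c="- (r2 *\<^sub>R One)" and d="r2 *\<^sub>R One"])
      fix y :: 'a and s assume "y \<notin> cbox (- (r2 *\<^sub>R One)) (r2 *\<^sub>R One)"
      then have "r2 < norm y" by (rule outside_cbox_norm)
      then show "G y = 0" "G' s y = 0" by (auto simp: G_def G'_def \<psi>)
    qed
    then show ?thesis using G'H by simp
  qed
  show thesis
  proof (rule that)
    show "r1 < r2" by (rule r2)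
    show "continuous_on UNIV (H s)" for s unfolding H_def by (intro continuous_intros H0c)
    show "H s y = 0" if "norm y < r1" for s y using H0z that by (simp add: H_def)
    show "H s y = 0" if "norm y > r2" for s y using H0z that by (simp add: H_def)
    fix x :: 'a assume x: "norm x < r1"
    have "(\<Sum>s<DIM('a). convol (newton (v s)) (H0 s) x) = ?m *\<^sub>R G x"
    \<comment> \<open>Balls about \<open>x\<close> of radius below \<open>r1 - norm x\<close> miss
      the densities, so for such \<open>r\<close> smoothing is invisible and the smoothed
      convolutions do not depend on \<open>r\<close>.\<close>
    proof (rule convol_bump_limit[OF Gc])
      show "0 < r1 - norm x" using x by simp
      fix r assume r: "0 < r" "r < r1 - norm x"
      have "convol (newton (v s)) (H0 s) x = convol (kern (r^2) (v s)) (H0 s) x" for s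
        by (rule convol_newton[of _ _ r1]) (use r H0z in auto)
      then show "convol (bump (r^2)) G x = (\<Sum>s<DIM('a). convol (newton (v s)) (H0 s) x)"
        using rep[of "r^2"] r by simp
    qed
    then have "(1 / ?m) *\<^sub>R (\<Sum>s<DIM('a). convol (newton (v s)) (H0 s) x) = G x"
      using bump_mass_pos by simp
    then show "f (proj x) = (\<Sum>s<DIM('a). convol (newton (v s)) (H s) x)"
      using x by (simp add: H_def convol_scaleR_right scaleR_sum_right G_def F_def \<psi>)
  qed
qed

text \<open>For \<open>norm x < r0\<close> the densities stay at distance at least
  \<open>r1 - r0\<close>, so the kernel smoothed at that scale gives the same values and may be
  differentiated twice. Two derivatives are enough, because partial derivatives turn out to be null
  solutions again and the argument repeats. \<open>\<Phi>1\<close> and \<open>\<Phi>2\<close> are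
  defined on the whole space, so no boundary intervenes.\<close>

lemma local_smooth:
  assumes f: "dirac_null \<rho> f" and r: "0 < r0" "r0 < \<rho>"
  obtains \<Phi>1 \<Phi>2 where
    "\<And>h x. norm x < r0 \<Longrightarrow> has_partial (\<lambda>z. f (proj z)) h (\<Phi>1 h x) x"
    "\<And>h k x. has_partial (\<Phi>1 h) k (\<Phi>2 h k x) x" "\<And>h k x. \<Phi>2 h k x = \<Phi>2 k h x"
    "\<And>h. continuous_on UNIV (\<Phi>1 h)" "\<And>h k. continuous_on UNIV (\<Phi>2 h k)" "\<And>x. linear (\<lambda>h. \<Phi>1 h x)"
proof -
  define r1 where "r1 = (r0 + \<rho>) / 2"
  have r1: "0 < r1" "r0 < r1" "r1 < \<rho>" using r by (auto simp: r1_def)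
  obtain H r2 where H: "r1 < r2" "\<And>s. continuous_on UNIV (H s)"
    "\<And>s y. norm y < r1 \<Longrightarrow> H s y = 0" "\<And>s y. norm y > r2 \<Longrightarrow> H s y = 0"
    "\<And>x. norm x < r1 \<Longrightarrow> f (proj x) = (\<Sum>s<DIM('a). convol (newton (v s)) (H s) x)"
    by (rule shell_representation[OF f r1(1,3)]) (rule that; assumption)
  have supp: "H s y = 0" if "y \<notin> cbox (- (r2 *\<^sub>R One)) (r2 *\<^sub>R One)" for s y
    using outside_cbox_norm[OF that] H by auto
  define a where "a = (r1 - r0)^2"
  have a: "a > 0" using r1 by (simp add: a_def)
  define \<Phi>1 where "\<Phi>1 = (\<lambda>h x. \<Sum>s<DIM('a). convol (kern1 a (v s) h) (H s) x)"
  define \<Phi>2 where "\<Phi>2 = (\<lambda>h k x. \<Sum>s<DIM('a). convol (kern2 a (v s) h k) (H s) x)"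
  show thesis
  proof (rule that)
    have rep: "f (proj x) = (\<Sum>s<DIM('a). convol (kern a (v s)) (H s) x)" if "x \<in> ball 0 r0" for x
    proof -
      have "convol (newton (v s)) (H s) x = convol (kern a (v s)) (H s) x" for s
        unfolding a_def by (rule convol_newton[of _ _ r1]) (use r1 H that in auto)
      then show ?thesis using H(5)[of x] that r1 by simp
    qed
    show "has_partial (\<lambda>z. f (proj z)) h (\<Phi>1 h x) x" if "norm x < r0" for h x
    proof (rule has_partial_cong)
      show "has_partial (\<lambda>x. \<Sum>s<DIM('a). convol (kern a (v s)) (H s) x) h (\<Phi>1 h x) x"
        unfolding \<Phi>1_def
        by (intro has_partial_sum convol_partial continuous_kern continuous_kern1 a has_partial_kern H(2) supp)
      show "x \<in> ball 0 r0" "open (ball 0 r0)" using that by auto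
    qed (use rep in auto)
    show "has_partial (\<Phi>1 h) k (\<Phi>2 h k x) x" for h k x
      unfolding \<Phi>1_def \<Phi>2_def
      by (intro has_partial_sum convol_partial continuous_kern1 continuous_kern2 a has_partial_kern1 H(2) supp)
    show "\<Phi>2 h k x = \<Phi>2 k h x" for h k x
      by (simp add: \<Phi>2_def convol_def kern2_commute[of a "v _" h k])
    show "continuous_on UNIV (\<Phi>1 h)" for h
      unfolding \<Phi>1_def by (intro continuous_on_sum continuous_convol continuous_kern1 a H(2) supp)
    show "continuous_on UNIV (\<Phi>2 h k)" for h k
      unfolding \<Phi>2_def by (intro continuous_on_sum continuous_convol continuous_kern2 a H(2) supp)
    show "linear (\<lambda>h. \<Phi>1 h x)" for x
    proof -
      have intg: "(\<lambda>y. kern1 a (v s) h (x - y) *\<^sub>R H s y) integrable_on UNIV" for s h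
      proof (rule integrable_UNIV_compact_support[where a="- (r2 *\<^sub>R One)" and b="r2 *\<^sub>R One"])
        show "continuous_on UNIV (\<lambda>y. kern1 a (v s) h (x - y) *\<^sub>R H s y)"
          by (intro continuous_intros continuous_on_compose2[OF continuous_kern1[OF a]] H(2)) auto
      qed (simp add: supp)
      have add: "kern1 a w (h + k) u = kern1 a w h u + kern1 a w k u" for w h k u :: 'a
        by (simp add: kern1_def inner_add_left inner_add_right algebra_simps)
      have scl: "kern1 a w (c *\<^sub>R h) u = c * kern1 a w h u" for w h u :: 'a and c
        by (simp add: kern1_def algebra_simps)
      show ?thesis
      proof (rule linearI)
        fix h k :: 'a and c :: real
        have "convol (kern1 a (v s) (h + k)) (H s) x = convol (kern1 a (v s) h) (H s) x + convol (kern1 a (v s) k) (H s) x" for s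
          unfolding convol_def add scaleR_add_left by (rule integral_add[OF intg intg])
        then show "\<Phi>1 (h + k) x = \<Phi>1 h x + \<Phi>1 k x"
          unfolding \<Phi>1_def by (simp only: sum.distrib)
        have "convol (kern1 a (v s) (c *\<^sub>R h)) (H s) x = c *\<^sub>R convol (kern1 a (v s) h) (H s) x" for s
          unfolding convol_def scl scaleR_scaleR[symmetric] by (rule integral_cmul)
        then show "\<Phi>1 (c *\<^sub>R h) x = c *\<^sub>R \<Phi>1 h x"
          unfolding \<Phi>1_def by (simp only: scaleR_sum_right)
      qed
    qed
  qed
qed

end

context clifford_system
begin

subsection \<open>Regularity\<close>

lemma proj_v_le: "s \<le> m \<Longrightarrow> proj (v s) = v s"
  using proj_v m_less by simp

lemma partial_eq: "has_partial f (v s) D x \<Longrightarrow> partial v s f x = D"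
  by (rule has_partial_partial)

lemma proj_line: "proj x = x \<Longrightarrow> proj h = h \<Longrightarrow> proj (x + t *\<^sub>R h) = x + t *\<^sub>R h"
  by (simp add: linear_add[OF linear_proj] linear_scale[OF linear_proj])

text \<open>The two functions agree only at points of \<open>M\<close>, which need not be open in
  the whole space; inserting \<open>proj\<close> reduces this to agreement on an open set.\<close>

lemma has_partial_cong_proj:
  assumes "open S" "x \<in> S" "proj x = x" "proj h = h"
    and "\<And>y. y \<in> S \<Longrightarrow> proj y = y \<Longrightarrow> f y = g y" "has_partial f h D x"
  shows "has_partial g h D x"
proof -
  have "has_partial (\<lambda>y. f (proj y)) h D x"
    using assms by (simp add: has_partial_def proj_line)
  then have "has_partial (\<lambda>y. if y \<in> S then g (proj y) else f (proj y)) h D x" 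
    unfolding has_partial_def
  proof (rule has_vector_derivative_transform_within_open)
    show "open ((\<lambda>t::real. x + t *\<^sub>R h) -` S)" by (intro open_vimage assms continuous_intros)
    show "0 \<in> (\<lambda>t::real. x + t *\<^sub>R h) -` S" using assms by simp
  qed (use assms proj_line in auto)
  then have "has_partial (\<lambda>y. g (proj y)) h D x"
    by (rule has_partial_cong[OF assms(1,2), rotated]) simp
  then show ?thesis using assms by (simp add: has_partial_def proj_line)
qed

lemma rball_alt: "x \<in> rball r \<longleftrightarrow> x \<in> ball 0 r \<and> proj x = x"
  by (auto simp: rball_def)

text \<open>Differentiability is not at issue: \<open>vector_derivative\<close> chooses among the
  derivatives, and both functions have the same ones, if any.\<close>

lemma partial_cong_rball:
  assumes "\<And>y. y \<in> rball \<rho> \<Longrightarrow> f y = g y" "x \<in> rball \<rho>" "l \<le> m"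
  shows "partial v l f x = partial v l g x"
proof -
  have "has_partial f (v l) D x \<longleftrightarrow> has_partial g (v l) D x" for D
    using has_partial_cong_proj[of "ball 0 \<rho>" x "v l" f g D] has_partial_cong_proj[of "ball 0 \<rho>" x "v l" g f D]
      assms proj_v_le[OF assms(3)] by (auto simp: rball_alt)
  then show ?thesis by (simp add: has_partial_def partial_def vector_derivative_def)
qed

lemma continuous_on_rball:
  assumes "\<And>r. 0 < r \<Longrightarrow> r < \<rho> \<Longrightarrow> continuous_on (rball r) g"
  shows "continuous_on (rball \<rho>) g"
  unfolding continuous_on_eq_continuous_within
proof
  fix x assume x: "x \<in> rball \<rho>"
  define r where "r = (norm x + \<rho>) / 2"
  have r: "norm x < r" "r < \<rho>" using x by (auto simp: rball_def r_def)
  then have "0 < r" using norm_ge_zero[of x] by linarith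
  have xr: "x \<in> rball r" using x r by (auto simp: rball_def)
  have "continuous (at x within rball r) g"
    using assms[OF \<open>0 < r\<close> r(2)] xr by (simp add: continuous_on_eq_continuous_within)
  moreover have "at x within rball r = at x within rball \<rho>"
    by (rule at_within_nhd[of _ "ball 0 r"]) (use r in \<open>auto simp: rball_def\<close>)
  ultimately show "continuous (at x within rball \<rho>) g" by (simp add: continuous_within)
qed

lemma dirac_null_smooth:
  assumes f: "dirac_null \<rho> f" and r: "0 < r0" "r0 < \<rho>"
  obtains \<Phi>1 \<Phi>2 where
    "\<And>h x. proj h = h \<Longrightarrow> x \<in> rball r0 \<Longrightarrow> has_partial f h (\<Phi>1 h x) x"
    "\<And>l x. l \<le> m \<Longrightarrow> x \<in> rball r0 \<Longrightarrow> partial v l f x = \<Phi>1 (v l) x"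
    "\<And>l h x. l \<le> m \<Longrightarrow> proj h = h \<Longrightarrow> x \<in> rball r0 \<Longrightarrow> has_partial (partial v l f) h (\<Phi>2 (v l) h x) x"
    "\<And>h k x. \<Phi>2 h k x = \<Phi>2 k h x"
    "\<And>h. continuous_on UNIV (\<Phi>1 h)" "\<And>h k. continuous_on UNIV (\<Phi>2 h k)" "\<And>x. linear (\<lambda>h. \<Phi>1 h x)"
proof -
  obtain \<Phi>1 \<Phi>2 where \<Phi>:
    "\<And>h x. norm x < r0 \<Longrightarrow> has_partial (\<lambda>z. f (proj z)) h (\<Phi>1 h x) x"
    "\<And>h k x. has_partial (\<Phi>1 h) k (\<Phi>2 h k x) x" "\<And>h k x. \<Phi>2 h k x = \<Phi>2 k h x"
    "\<And>h. continuous_on UNIV (\<Phi>1 h)" "\<And>h k. continuous_on UNIV (\<Phi>2 h k)" "\<And>x. linear (\<lambda>h. \<Phi>1 h x)"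
    by (rule local_smooth[OF f r]) (rule that; assumption)
  have 1: "has_partial f h (\<Phi>1 h x) x" if "proj h = h" "x \<in> rball r0" for h x
    using \<Phi>(1)[of x h] that by (simp add: has_partial_def proj_line rball_def)
  have 2: "partial v l f x = \<Phi>1 (v l) x" if "l \<le> m" "x \<in> rball r0" for l x
    by (rule partial_eq) (use that in \<open>auto intro: 1 proj_v_le\<close>)
  have 3: "has_partial (partial v l f) h (\<Phi>2 (v l) h x) x" if "l \<le> m" "proj h = h" "x \<in> rball r0" for l h x
    by (rule has_partial_cong_proj[OF _ _ _ that(2) _ \<Phi>(2), of "ball 0 r0"]) (use that 2 in \<open>auto simp: rball_alt\<close>)
  show thesis by (rule that[OF 1 2 3 \<Phi>(3-6)])
qed

lemma rball_radius:
  assumes "x \<in> rball \<rho>" obtains r where "0 < r" "r < \<rho>" "x \<in> rball r"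
proof
  have n: "norm x < \<rho>" using assms by (auto simp: rball_def)
  show "(norm x + \<rho>) / 2 < \<rho>" "x \<in> rball ((norm x + \<rho>) / 2)" using n assms by (auto simp: rball_def)
  have "0 < \<rho>" using n norm_ge_zero[of x] by (rule le_less_trans[rotated])
  then show "0 < (norm x + \<rho>) / 2" using norm_ge_zero[of x] by (simp add: add_nonneg_pos)
qed

lemma dirac_null_smooth_at:
  assumes f: "dirac_null \<rho> f" and x: "x \<in> rball \<rho>"
  obtains \<Phi>1 \<Phi>2 where "linear \<Phi>1"
    "\<And>h. proj h = h \<Longrightarrow> has_partial f h (\<Phi>1 h) x" "\<And>l. l \<le> m \<Longrightarrow> partial v l f x = \<Phi>1 (v l)"
    "\<And>l h. l \<le> m \<Longrightarrow> proj h = h \<Longrightarrow> has_partial (partial v l f) h (\<Phi>2 (v l) h) x"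
    "\<And>h k. \<Phi>2 h k = \<Phi>2 k h"
proof -
  obtain r where r: "0 < r" "r < \<rho>" "x \<in> rball r" using rball_radius[OF x] .
  obtain \<Phi>1 \<Phi>2 where \<Phi>:
    "\<And>h x. proj h = h \<Longrightarrow> x \<in> rball r \<Longrightarrow> has_partial f h (\<Phi>1 h x) x"
    "\<And>l x. l \<le> m \<Longrightarrow> x \<in> rball r \<Longrightarrow> partial v l f x = \<Phi>1 (v l) x"
    "\<And>l h x. l \<le> m \<Longrightarrow> proj h = h \<Longrightarrow> x \<in> rball r \<Longrightarrow> has_partial (partial v l f) h (\<Phi>2 (v l) h x) x"
    "\<And>h k x. \<Phi>2 h k x = \<Phi>2 k h x"
    "\<And>h. continuous_on UNIV (\<Phi>1 h)" "\<And>h k. continuous_on UNIV (\<Phi>2 h k)" "\<And>x. linear (\<lambda>h. \<Phi>1 h x)"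
    by (rule dirac_null_smooth[OF f r(1,2)]) (rule that; assumption)
  show thesis
    by (rule that[of "\<lambda>h. \<Phi>1 h x" "\<lambda>h k. \<Phi>2 h k x"]) (use \<Phi>(1-4)[of _ x] \<Phi>(3)[OF _ _ r(3)] \<Phi>(4,7) r(3) in \<open>simp_all only:\<close>)
qed

lemma continuous_on_partial2:
  assumes f: "dirac_null \<rho> f" and l: "l \<le> m" "s \<le> m"
  shows "continuous_on (rball \<rho>) (partial v s (partial v l f))"
proof (rule continuous_on_rball)
  fix r assume r: "0 < r" "r < \<rho>"
  obtain \<Phi>1 \<Phi>2 where \<Phi>:
    "\<And>h x. proj h = h \<Longrightarrow> x \<in> rball r \<Longrightarrow> has_partial f h (\<Phi>1 h x) x"
    "\<And>l x. l \<le> m \<Longrightarrow> x \<in> rball r \<Longrightarrow> partial v l f x = \<Phi>1 (v l) x"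
    "\<And>l h x. l \<le> m \<Longrightarrow> proj h = h \<Longrightarrow> x \<in> rball r \<Longrightarrow> has_partial (partial v l f) h (\<Phi>2 (v l) h x) x"
    "\<And>h k x. \<Phi>2 h k x = \<Phi>2 k h x"
    "\<And>h. continuous_on UNIV (\<Phi>1 h)" "\<And>h k. continuous_on UNIV (\<Phi>2 h k)" "\<And>x. linear (\<lambda>h. \<Phi>1 h x)"
    by (rule dirac_null_smooth[OF f r]) (rule that; assumption)
  have "continuous_on (rball r) (\<Phi>2 (v l) (v s))" using \<Phi>(6) by (rule continuous_on_subset) simp
  then show "continuous_on (rball r) (partial v s (partial v l f))"
    by (rule continuous_on_eq) (rule partial_eq[symmetric, OF \<Phi>(3)[OF l(1) proj_v_le[OF l(2)]]])
qed

text \<open>Differentiating the null equation along \<open>v l\<close> gives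
  \<open>(\<Sum>s\<le>m. A s (\<Phi> (v s) (v l))) = 0\<close>, and the symmetry of
  \<open>\<Phi>\<close> exchanges the order of the two derivatives.\<close>

lemma dirac_null_partial:
  assumes f: "dirac_null \<rho> f" and l: "l \<le> m"
  shows "dirac_null \<rho> (partial v l f)"
proof -
  have "C1_on m v (rball \<rho>) (partial v l f)"
    unfolding C1_on_def
  proof (intro conjI ballI)
    show "continuous_on (rball \<rho>) (partial v l f)"
      using f l by (auto simp: dirac_null_def C1_on_def)
    fix s assume "s \<in> {0..m}" then have s: "s \<le> m" by simp
    show "(\<lambda>t. partial v l f (x + t *\<^sub>R v s)) differentiable at 0" if x: "x \<in> rball \<rho>" for x
    proof -
      obtain \<Phi>1 \<Phi>2 where "linear \<Phi>1"
        "\<And>h. proj h = h \<Longrightarrow> has_partial f h (\<Phi>1 h) x" "\<And>l. l \<le> m \<Longrightarrow> partial v l f x = \<Phi>1 (v l)"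
        "\<And>l h. l \<le> m \<Longrightarrow> proj h = h \<Longrightarrow> has_partial (partial v l f) h (\<Phi>2 (v l) h) x"
        "\<And>h k. \<Phi>2 h k = \<Phi>2 k h"
        by (rule dirac_null_smooth_at[OF f x]) (rule that; assumption)
      note this(4)[OF l proj_v_le[OF s]]
      then show ?thesis unfolding has_partial_def by (rule differentiableI_vector)
    qed
    show "continuous_on (rball \<rho>) (partial v s (partial v l f))"
      by (rule continuous_on_partial2[OF f l s])
  qed
  moreover have "(\<Sum>s\<le>m. A s (partial v s (partial v l f) x)) = 0" if x: "x \<in> rball \<rho>" for x
  proof -
    obtain \<Phi>1 \<Phi> where "linear \<Phi>1"
      "\<And>h. proj h = h \<Longrightarrow> has_partial f h (\<Phi>1 h) x" "\<And>l. l \<le> m \<Longrightarrow> partial v l f x = \<Phi>1 (v l)"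
      and \<Phi>: "\<And>l h. l \<le> m \<Longrightarrow> proj h = h \<Longrightarrow> has_partial (partial v l f) h (\<Phi> (v l) h) x"
        "\<And>h k. \<Phi> h k = \<Phi> k h"
      by (rule dirac_null_smooth_at[OF f x]) (rule that; assumption)
    have "has_partial (\<lambda>y. \<Sum>s\<le>m. A s (partial v s f y)) (v l) (\<Sum>s\<le>m. A s (\<Phi> (v s) (v l))) x"
    proof (rule has_partial_sum)
      fix s assume "s \<in> {..m}" then have s: "s \<le> m" by simp
      show "has_partial (\<lambda>y. A s (partial v s f y)) (v l) (A s (\<Phi> (v s) (v l))) x"
        by (rule has_partial_linear[OF linear_A[OF s] \<Phi>(1)[OF s proj_v_le[OF l]]])
    qed
    moreover have "has_partial (\<lambda>y. \<Sum>s\<le>m. A s (partial v s f y)) (v l) 0 x"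
    proof (rule has_partial_cong_proj[of "ball 0 \<rho>" x "v l" "\<lambda>_. 0"])
      show "has_partial (\<lambda>_. 0) (v l) 0 x" by (simp add: has_partial_def)
    qed (use x f l in \<open>auto simp: rball_alt dirac_null_def proj_v_le\<close>)
    ultimately have "(\<Sum>s\<le>m. A s (\<Phi> (v s) (v l))) = 0"
      unfolding has_partial_def using vector_derivative_unique_at by blast
    moreover have "partial v s (partial v l f) x = \<Phi> (v s) (v l)" if "s \<le> m" for s
      using partial_eq[OF \<Phi>(1)[OF l proj_v_le[OF that]]] \<Phi>(2) by simp
    ultimately show ?thesis by simp
  qed
  ultimately show ?thesis by (simp add: dirac_null_def)
qed

lemma partial_commute:
  assumes f: "dirac_null \<rho> f" and l: "i \<le> m" "j \<le> m" and x: "x \<in> rball \<rho>"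
  shows "partial v i (partial v j f) x = partial v j (partial v i f) x"
proof -
  obtain \<Phi>1 \<Phi> where "linear \<Phi>1"
    "\<And>h. proj h = h \<Longrightarrow> has_partial f h (\<Phi>1 h) x" "\<And>l. l \<le> m \<Longrightarrow> partial v l f x = \<Phi>1 (v l)"
    and \<Phi>: "\<And>l h. l \<le> m \<Longrightarrow> proj h = h \<Longrightarrow> has_partial (partial v l f) h (\<Phi> (v l) h) x"
      "\<And>h k. \<Phi> h k = \<Phi> k h"
    by (rule dirac_null_smooth_at[OF f x]) (rule that; assumption)
  show ?thesis
    using partial_eq[OF \<Phi>(1)[OF l(1) proj_v_le[OF l(2)]]] partial_eq[OF \<Phi>(1)[OF l(2) proj_v_le[OF l(1)]]] \<Phi>(2)
    by simp
qed

lemma directional_derivative: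
  assumes f: "dirac_null \<rho> f" and h: "proj h = h" and x: "x \<in> rball \<rho>"
  shows "has_partial f h (\<Sum>s\<le>m. (h \<bullet> v s) *\<^sub>R partial v s f x) x"
proof -
  obtain \<Phi> \<Phi>2 where \<Phi>: "linear \<Phi>"
    "\<And>h. proj h = h \<Longrightarrow> has_partial f h (\<Phi> h) x" "\<And>l. l \<le> m \<Longrightarrow> partial v l f x = \<Phi> (v l)"
    and "\<And>l h. l \<le> m \<Longrightarrow> proj h = h \<Longrightarrow> has_partial (partial v l f) h (\<Phi>2 (v l) h) x"
    "\<And>h k. \<Phi>2 h k = \<Phi>2 k h"
    by (rule dirac_null_smooth_at[OF f x]) (rule that; assumption)
  have "\<Phi> h = \<Phi> (\<Sum>s\<le>m. (h \<bullet> v s) *\<^sub>R v s)" using h by (simp add: proj_def)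
  also have "\<dots> = (\<Sum>s\<le>m. (h \<bullet> v s) *\<^sub>R partial v s f x)"
    by (simp add: linear_sum[OF \<Phi>(1)] linear_scale[OF \<Phi>(1)] \<Phi>(3))
  finally show ?thesis using \<Phi>(2)[OF h] by simp
qed

section \<open>Iterated partial derivatives and their independence of the order\<close>

abbreviation iter_partial :: "nat list \<Rightarrow> ('a \<Rightarrow> 'a) \<Rightarrow> 'a \<Rightarrow> 'a" where
  "iter_partial is f \<equiv> foldr (partial v) is f"

lemma dirac_null_iter: "dirac_null \<rho> f \<Longrightarrow> set is \<subseteq> {..m} \<Longrightarrow> dirac_null \<rho> (iter_partial is f)"
  by (induction "is") (auto intro: dirac_null_partial)

lemma iter_partial_move:
  assumes "dirac_null \<rho> f" "set xs \<subseteq> {..m}" "set ys \<subseteq> {..m}" "l \<le> m" "x \<in> rball \<rho>"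
  shows "iter_partial (xs @ l # ys) f x = partial v l (iter_partial (xs @ ys) f) x"
  using assms(2,5)
proof (induction xs arbitrary: x)
  case (Cons j xs)
  have "partial v j (iter_partial (xs @ l # ys) f) x = partial v j (partial v l (iter_partial (xs @ ys) f)) x"
    by (rule partial_cong_rball[of \<rho>]) (use Cons in auto)
  also have "\<dots> = partial v l (partial v j (iter_partial (xs @ ys) f)) x"
    by (rule partial_commute[of \<rho>]) (use Cons assms in \<open>auto intro!: dirac_null_iter\<close>)
  finally show ?case by simp
qed simp

lemma iter_partial_mset:
  assumes "dirac_null \<rho> f" "mset xs = mset ys" "set xs \<subseteq> {..m}" "x \<in> rball \<rho>"
  shows "iter_partial xs f x = iter_partial ys f x"
  using assms(2-)
proof (induction xs arbitrary: ys x)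
  case (Cons l xs)
  then have "l \<in> set ys" by (metis list.set_intros(1) mset_eq_setD)
  then obtain us ws where ys: "ys = us @ l # ws" by (meson split_list)
  have m: "mset xs = mset (us @ ws)" using Cons.prems(1) by (simp add: ys)
  have set: "set us \<subseteq> {..m}" "set ws \<subseteq> {..m}" "l \<le> m"
    using Cons.prems(2) mset_eq_setD[OF Cons.prems(1)] by (auto simp: ys)
  have "iter_partial (l # xs) f x = partial v l (iter_partial xs f) x" by simp
  also have "\<dots> = partial v l (iter_partial (us @ ws) f) x"
    by (rule partial_cong_rball[of \<rho>]) (use Cons.IH[OF m] Cons.prems set in auto)
  also have "\<dots> = iter_partial ys f x"
    unfolding ys using iter_partial_move[OF assms(1) set(1,2,3) Cons.prems(3)] by simp
  finally show ?case .
qed simp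

end

subsection \<open>Expansion of the kernel along rays\<close>

text \<open>Since \<open>\<bar>1 - t w\<bar> powr (2 \<alpha>)\<close> is the squared modulus of \<open>(1 - t w) powr \<alpha>\<close>, its
  coefficients (Gegenbauer polynomials) come from a Cauchy product of binomial series.\<close>

definition gegen :: "real \<Rightarrow> complex \<Rightarrow> nat \<Rightarrow> real" where
  "gegen \<alpha> w k = Re (\<Sum>i\<le>k. (of_real (\<alpha> gchoose i) * (- w) ^ i) * (of_real (\<alpha> gchoose (k - i)) * (- cnj w) ^ (k - i)))"

text \<open>The Cauchy square of the binomial series with coefficients made nonnegative; it bounds
  \<open>gegen\<close> uniformly over all \<open>w\<close> of modulus 1, and its power series still
  converges for arguments below 1.\<close>

definition gegen_bound :: "real \<Rightarrow> nat \<Rightarrow> real" where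
  "gegen_bound \<alpha> k = (\<Sum>i\<le>k. \<bar>\<alpha> gchoose i\<bar> * \<bar>\<alpha> gchoose (k - i)\<bar>)"

lemma of_real_gbinomial: "of_real (\<alpha> gchoose n) = (of_real \<alpha> gchoose n :: complex)"
  by (simp add: gbinomial_prod_rev)

lemma gbinomial_abs_summable:
  fixes z :: complex
  assumes "norm z < 1" shows "summable (\<lambda>n. norm ((of_real \<alpha> gchoose n) * z ^ n))"
proof -
  obtain r where r: "norm z < r" "r < 1" using dense[OF assms] by auto
  have r0: "0 < r" using norm_ge_zero[of z] r(1) by (rule le_less_trans)
  have "summable (\<lambda>n. (of_real \<alpha> gchoose n :: complex) * of_real r ^ n)"
    using gen_binomial_complex[of "of_real r" "of_real \<alpha>"] r r0 by (auto intro: sums_summable)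
  moreover have "norm z < norm (of_real r :: complex)" using r r0 by simp
  ultimately show ?thesis by (rule powser_insidea)
qed

lemma gegen_bound_nonneg: "gegen_bound \<alpha> k \<ge> 0"
  by (simp add: gegen_bound_def sum_nonneg)

lemma gegen_bound_summable:
  assumes "0 \<le> \<theta>" "\<theta> < 1" shows "summable (\<lambda>k. gegen_bound \<alpha> k * \<theta> ^ k)"
proof -
  have s: "summable (\<lambda>n. norm (\<bar>\<alpha> gchoose n\<bar> * \<theta> ^ n))"
    using gbinomial_abs_summable[of "of_real \<theta>" \<alpha>] assms
    by (simp add: norm_mult norm_power flip: of_real_gbinomial)
  have "(\<Sum>i\<le>k. (\<bar>\<alpha> gchoose i\<bar> * \<theta> ^ i) * (\<bar>\<alpha> gchoose (k - i)\<bar> * \<theta> ^ (k - i))) = gegen_bound \<alpha> k * \<theta> ^ k" for k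
    unfolding gegen_bound_def sum_distrib_right
    by (intro sum.cong) (auto simp: mult_ac simp flip: power_add)
  then show ?thesis using summable_Cauchy_product[OF s s] by simp
qed

lemma gegen_le: "\<bar>gegen \<alpha> w k\<bar> \<le> gegen_bound \<alpha> k * norm w ^ k"
proof -
  have "\<bar>gegen \<alpha> w k\<bar> \<le> norm (\<Sum>i\<le>k. (of_real (\<alpha> gchoose i) * (- w) ^ i) * (of_real (\<alpha> gchoose (k - i)) * (- cnj w) ^ (k - i)))"
    unfolding gegen_def by (rule abs_Re_le_cmod)
  also have "\<dots> \<le> (\<Sum>i\<le>k. norm ((of_real (\<alpha> gchoose i) * (- w) ^ i) * (of_real (\<alpha> gchoose (k - i)) * (- cnj w) ^ (k - i))))"
    by (rule norm_sum)
  also have "\<dots> = gegen_bound \<alpha> k * norm w ^ k"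
    unfolding gegen_bound_def sum_distrib_right
    by (intro sum.cong) (auto simp: norm_mult norm_power mult_ac simp flip: power_add)
  finally show ?thesis .
qed

lemma gegen_sums:
  assumes "\<bar>t\<bar> * norm w < 1"
  shows "(\<lambda>k. t ^ k * gegen \<alpha> w k) sums (norm (1 - of_real t * w) powr (2 * \<alpha>))"
proof -
  define z where "z = - (of_real t * w)"
  have z: "norm z < 1" "norm (cnj z) < 1" using assms by (auto simp: z_def norm_mult)
  let ?a = "\<lambda>z n. (of_real \<alpha> gchoose n) * z ^ n :: complex"
  let ?S = "(1 + z) powr (of_real \<alpha>)"
  have s: "?a z sums ?S" by (rule gen_binomial_complex[OF z(1)])
  have cs: "?a (cnj z) sums cnj ?S"
  proof -
    have "(\<lambda>n. cnj (?a z n)) sums cnj ?S" using s by (simp only: sums_cnj)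
    moreover have "(\<lambda>n. cnj (?a z n)) = ?a (cnj z)"
      by (rule ext) (simp flip: of_real_gbinomial)
    ultimately show ?thesis by (simp only:)
  qed
  have "(\<lambda>k. \<Sum>i\<le>k. ?a z i * ?a (cnj z) (k - i)) sums ((\<Sum>k. ?a z k) * (\<Sum>k. ?a (cnj z) k))"
    by (rule Cauchy_product_sums) (use gbinomial_abs_summable z in auto)
  also have "(\<Sum>k. ?a z k) * (\<Sum>k. ?a (cnj z) k) = of_real ((norm ?S)\<^sup>2)"
    unfolding complex_norm_square using s cs by (simp only: sums_iff)
  finally have "(\<lambda>k. \<Sum>i\<le>k. ?a z i * ?a (cnj z) (k - i)) sums of_real ((norm ?S)\<^sup>2)" .
  from sums_Re[OF this] have "(\<lambda>k. Re (\<Sum>i\<le>k. ?a z i * ?a (cnj z) (k - i))) sums (norm ?S)\<^sup>2"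
    by (simp only: Re_complex_of_real)
  moreover have "Re (\<Sum>i\<le>k. ?a z i * ?a (cnj z) (k - i)) = t ^ k * gegen \<alpha> w k" for k
  proof -
    have "(\<Sum>i\<le>k. ?a z i * ?a (cnj z) (k - i)) = of_real (t ^ k) *
       (\<Sum>i\<le>k. (of_real (\<alpha> gchoose i) * (- w) ^ i) * (of_real (\<alpha> gchoose (k - i)) * (- cnj w) ^ (k - i)))"
      unfolding sum_distrib_left
    proof (intro sum.cong refl)
      fix i assume "i \<in> {..k}"
      then have l: "(of_real t :: complex) ^ k = of_real t ^ i * of_real t ^ (k - i)" by (simp flip: power_add)
      have "z ^ i = of_real t ^ i * (- w) ^ i" "cnj z ^ (k - i) = of_real t ^ (k - i) * (- cnj w) ^ (k - i)"
        by (simp_all add: z_def flip: power_mult_distrib)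
      then show "?a z i * ?a (cnj z) (k - i) = of_real (t ^ k) *
          ((of_real (\<alpha> gchoose i) * (- w) ^ i) * (of_real (\<alpha> gchoose (k - i)) * (- cnj w) ^ (k - i)))"
        by (simp add: l of_real_gbinomial)
    qed
    then show ?thesis by (simp add: gegen_def)
  qed
  moreover have "(norm ?S)\<^sup>2 = norm (1 - of_real t * w) powr (2 * \<alpha>)"
  proof -
    have "norm ?S = norm (1 + z) powr \<alpha>" by (subst norm_powr_real_powr') auto
    then show ?thesis by (simp add: z_def power2_eq_square flip: powr_add)
  qed
  ultimately show ?thesis by simp
qed

text \<open>The position of \<open>x\<close> in the plane spanned by \<open>x\<close> and \<open>y\<close>, with \<open>y\<close> as the unit.\<close>

definition planar :: "'a::euclidean_space \<Rightarrow> 'a \<Rightarrow> complex" where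
  "planar x y = Complex ((x \<bullet> y) / (y \<bullet> y)) (sqrt ((x \<bullet> x) * (y \<bullet> y) - (x \<bullet> y)\<^sup>2) / (y \<bullet> y))"

lemma norm_planar_diff:
  assumes "y \<noteq> 0" shows "norm (1 - of_real t * planar x y) = norm (y - t *\<^sub>R x) / norm y"
proof -
  let ?q = "y \<bullet> y"
  have q: "?q > 0" using assms by simp
  have cs: "(x \<bullet> x) * ?q - (x \<bullet> y)\<^sup>2 \<ge> 0" using Cauchy_Schwarz_ineq[of x y] by simp
  have "(norm (1 - of_real t * planar x y))\<^sup>2 = (1 - t * ((x \<bullet> y) / ?q))\<^sup>2 + t\<^sup>2 * ((x \<bullet> x) * ?q - (x \<bullet> y)\<^sup>2) / ?q\<^sup>2"
    using cs by (simp add: cmod_power2 planar_def power_mult_distrib power_divide)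
  also have "\<dots> = (?q - 2 * t * (x \<bullet> y) + t\<^sup>2 * (x \<bullet> x)) / ?q"
    using q by (simp add: field_simps power2_eq_square)
  also have "\<dots> = ((y - t *\<^sub>R x) \<bullet> (y - t *\<^sub>R x)) / ?q"
    by (simp add: inner_diff_left inner_diff_right inner_commute power2_eq_square algebra_simps)
  also have "\<dots> = (norm (y - t *\<^sub>R x) / norm y)\<^sup>2"
    by (simp add: power_divide dot_square_norm)
  finally show ?thesis by (simp add: power2_eq_iff_nonneg)
qed

lemma norm_planar:
  assumes "y \<noteq> 0" shows "norm (planar x y) = norm x / norm y"
proof -
  have q: "y \<bullet> y > 0" using assms by simp
  have cs: "(x \<bullet> x) * (y \<bullet> y) - (x \<bullet> y)\<^sup>2 \<ge> 0" using Cauchy_Schwarz_ineq[of x y] by simp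
  have "(norm (planar x y))\<^sup>2 = (x \<bullet> x) / (y \<bullet> y)"
    using cs q by (simp add: cmod_power2 planar_def power_divide) (simp add: field_simps power2_eq_square)
  also have "\<dots> = (norm x / norm y)\<^sup>2" by (simp add: power_divide dot_square_norm)
  finally show ?thesis by (simp add: power2_eq_iff_nonneg)
qed

lemma continuous_on_planar: "continuous_on (- {0}) (planar x)"
  unfolding planar_def[abs_def] Complex_eq
  by (intro continuous_intros) auto

text \<open>The coefficient of \<open>t ^ k\<close> in \<open>newton u (t *\<^sub>R x - y)\<close>.
  The numerator \<open>t * (x \<bullet> u) - y \<bullet> u\<close> uses the series of the norm
  factor twice, once shifted by one degree; \<open>planar\<close> takes \<open>y\<close> as unit,
  whence the factor \<open>norm y powr (- real DIM('a))\<close>.\<close>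

definition newton_coeff :: "'a::euclidean_space \<Rightarrow> 'a \<Rightarrow> nat \<Rightarrow> 'a \<Rightarrow> real" where
  "newton_coeff u x k y = norm y powr (- real DIM('a)) *
     ((if k = 0 then 0 else (x \<bullet> u) * gegen (- real DIM('a) / 2) (planar x y) (k - 1))
       - (y \<bullet> u) * gegen (- real DIM('a) / 2) (planar x y) k)"

lemma newton_sums:
  fixes x y :: "'a::euclidean_space"
  assumes "\<bar>t\<bar> * norm x < norm y"
  shows "(\<lambda>k. t ^ k * newton_coeff u x k y) sums newton u (t *\<^sub>R x - y)"
proof -
  have "0 \<le> \<bar>t\<bar> * norm x" by simp
  then have "0 < norm y" using assms by (rule le_less_trans)
  then have y: "y \<noteq> 0" by simp
  let ?\<alpha> = "- real DIM('a) / 2"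
  let ?c = "gegen ?\<alpha> (planar x y)"
  let ?N = "norm y powr (- real DIM('a))"
  let ?P = "norm (1 - of_real t * planar x y) powr (2 * ?\<alpha>)"
  have c: "(\<lambda>k. t ^ k * ?c k) sums ?P"
    by (rule gegen_sums) (use assms y in \<open>simp add: norm_planar field_simps\<close>)
  have P: "?N * ?P = norm (t *\<^sub>R x - y) powr (- real DIM('a))"
    by (simp add: norm_planar_diff[OF y] powr_divide norm_minus_commute y)
  define g where "g k = t ^ k * (if k = 0 then 0 else ?c (k - 1))" for k
  have "(\<lambda>k. g (Suc k)) sums (t * ?P)"
    using sums_mult[OF c, of t] by (simp add: g_def mult_ac)
  then have "g sums (t * ?P + g 0)" by (rule sums_Suc)
  then have g: "g sums (t * ?P)" by (simp add: g_def)
  have "(\<lambda>k. ?N * ((x \<bullet> u) * g k - (y \<bullet> u) * (t ^ k * ?c k))) sums (?N * ((x \<bullet> u) * (t * ?P) - (y \<bullet> u) * ?P))"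
    by (intro sums_mult sums_diff g c)
  moreover have "?N * ((x \<bullet> u) * g k - (y \<bullet> u) * (t ^ k * ?c k)) = t ^ k * newton_coeff u x k y" for k
    by (simp add: newton_coeff_def g_def algebra_simps)
  moreover have "?N * ((x \<bullet> u) * (t * ?P) - (y \<bullet> u) * ?P) = newton u (t *\<^sub>R x - y)"
    unfolding newton_def P[symmetric] by (simp add: inner_diff_left algebra_simps)
  ultimately show ?thesis by simp
qed

definition newton_bound :: "real \<Rightarrow> nat \<Rightarrow> real" where
  "newton_bound \<alpha> k = gegen_bound \<alpha> k + (if k = 0 then 0 else gegen_bound \<alpha> (k - 1))"

lemma newton_bound_nonneg: "newton_bound \<alpha> k \<ge> 0"
  by (simp add: newton_bound_def gegen_bound_nonneg)

lemma newton_bound_summable: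
  assumes "0 \<le> \<theta>" "\<theta> < 1" shows "summable (\<lambda>k. newton_bound \<alpha> k * \<theta> ^ k)"
proof -
  note s = gegen_bound_summable[OF assms, of \<alpha>]
  have "summable (\<lambda>k. (\<lambda>k. (if k = 0 then 0 else gegen_bound \<alpha> (k - 1)) * \<theta> ^ k) (Suc k))"
    using summable_mult[OF s, of \<theta>] by (simp add: mult_ac)
  then have "summable (\<lambda>k. (if k = 0 then 0 else gegen_bound \<alpha> (k - 1)) * \<theta> ^ k)"
    by (subst (asm) summable_Suc_iff)
  from summable_add[OF s this] show ?thesis by (simp add: newton_bound_def distrib_right)
qed

text \<open>The right side depends neither on the position of \<open>y\<close> in the shell nor on
  its angle with \<open>x\<close>; this uniformity gives convergence for all
  \<open>norm x < r1\<close>.\<close>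

lemma newton_coeff_le:
  fixes u x y :: "'a::euclidean_space"
  assumes r: "0 < r1" "r1 \<le> norm y" "norm y \<le> r2"
  shows "\<bar>newton_coeff u x k y\<bar> \<le> r1 powr (- real DIM('a)) * r2 * norm u * newton_bound (- real DIM('a) / 2) k * (norm x / r1) ^ k"
proof -
  have y: "y \<noteq> 0" "norm y > 0" using r by auto
  let ?\<alpha> = "- real DIM('a) / 2"
  let ?c = "gegen ?\<alpha> (planar x y)" and ?b = "gegen_bound ?\<alpha>"
  let ?t = "norm x / norm y"
  have c: "\<bar>?c k\<bar> \<le> ?b k * ?t ^ k" for k using gegen_le[of ?\<alpha> "planar x y" k] y by (simp add: norm_planar)
  have 1: "\<bar>(y \<bullet> u) * ?c k\<bar> \<le> norm y * norm u * (?b k * ?t ^ k)"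
    unfolding abs_mult by (intro mult_mono Cauchy_Schwarz_ineq2 c) auto
  have 2: "\<bar>if k = 0 then 0 else (x \<bullet> u) * ?c (k - 1)\<bar> \<le> norm y * norm u * ((if k = 0 then 0 else ?b (k - 1)) * ?t ^ k)"
  proof (cases k)
    case (Suc j)
    have "\<bar>(x \<bullet> u) * ?c j\<bar> \<le> (norm x * norm u) * (?b j * ?t ^ j)"
      unfolding abs_mult by (intro mult_mono Cauchy_Schwarz_ineq2 c) auto
    \<comment> \<open>The extra factor \<open>norm x\<close> is \<open>norm y\<close> times the
      quotient \<open>norm x / norm y\<close>, which makes up for the index shift.\<close>
    also have "\<dots> = norm y * norm u * (?b j * ?t ^ Suc j)" using y by simp
    finally show ?thesis using Suc by simp
  qed simp
  have "\<bar>(if k = 0 then 0 else (x \<bullet> u) * ?c (k - 1)) - (y \<bullet> u) * ?c k\<bar>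
      \<le> norm y * norm u * ((if k = 0 then 0 else ?b (k - 1)) * ?t ^ k) + norm y * norm u * (?b k * ?t ^ k)"
    using 1 2 by linarith
  also have "\<dots> = norm y * (norm u * (newton_bound ?\<alpha> k * ?t ^ k))"
    by (simp add: newton_bound_def algebra_simps)
  also have "\<dots> \<le> r2 * (norm u * (newton_bound ?\<alpha> k * (norm x / r1) ^ k))"
    using r y by (intro mult_mono mult_left_mono power_mono frac_le) (auto simp: newton_bound_nonneg)
  finally have 3: "\<bar>(if k = 0 then 0 else (x \<bullet> u) * ?c (k - 1)) - (y \<bullet> u) * ?c k\<bar>
      \<le> r2 * (norm u * (newton_bound ?\<alpha> k * (norm x / r1) ^ k))" .
  have 4: "norm y powr (- real DIM('a)) \<le> r1 powr (- real DIM('a))"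
    using r by (intro powr_mono2') auto
  have "\<bar>newton_coeff u x k y\<bar> \<le> r1 powr (- real DIM('a)) * (r2 * (norm u * (newton_bound ?\<alpha> k * (norm x / r1) ^ k)))"
    unfolding newton_coeff_def abs_mult using 3 4 by (intro mult_mono) auto
  then show ?thesis by (simp add: mult_ac)
qed

lemma continuous_on_newton_coeff: "continuous_on (- {0}) (newton_coeff u x k)"
proof -
  have "continuous_on (- {0}) (\<lambda>y. gegen \<alpha> (planar x y) j)" for \<alpha> j
    unfolding gegen_def by (intro continuous_intros continuous_on_planar)
  then show ?thesis
    unfolding newton_coeff_def[abs_def] by (cases "k = 0") (auto intro!: continuous_intros)
qed

text \<open>The density lives in a shell on which the series of the kernel is dominated uniformly in
  \<open>y\<close>, so it may be integrated term by term. The constant in the second claim depends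
  on neither \<open>x\<close> nor \<open>k\<close>, as normal convergence will require.\<close>

lemma convol_newton_sums:
  fixes H :: "'a::euclidean_space \<Rightarrow> 'a" and u :: 'a
  assumes r1: "0 < r1" and H: "continuous_on UNIV H" "\<And>y. norm y < r1 \<Longrightarrow> H y = 0" "\<And>y. norm y > r2 \<Longrightarrow> H y = 0"
  defines "I \<equiv> \<lambda>x k. integral UNIV (\<lambda>y. newton_coeff u x k y *\<^sub>R H y)"
  shows "\<And>x t. \<bar>t\<bar> * norm x < r1 \<Longrightarrow> (\<lambda>k. t ^ k *\<^sub>R I x k) sums convol (newton u) H (t *\<^sub>R x)"
    and "\<exists>C\<ge>0. \<forall>x k. norm (I x k) \<le> C * (newton_bound (- real DIM('a) / 2) k * (norm x / r1) ^ k)"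
proof -
  let ?Q = "cbox (- (r2 *\<^sub>R One)) (r2 *\<^sub>R One) :: 'a set"
  let ?\<beta> = "newton_bound (- real DIM('a) / 2)"
  have supp: "H y = 0" if "y \<notin> ?Q" for y using outside_cbox_norm[OF that] H(3) by simp
  have cont: "continuous_on UNIV (\<lambda>y. newton_coeff u x k y *\<^sub>R H y)" for x k
  proof -
    have "continuous_on (- {0}) (\<lambda>y. newton_coeff u x k y *\<^sub>R H y)"
      by (intro continuous_intros continuous_on_newton_coeff continuous_on_subset[OF H(1)]) auto
    moreover have "continuous_on (ball 0 r1) (\<lambda>y. newton_coeff u x k y *\<^sub>R H y)"
      by (rule continuous_on_eq[of _ "\<lambda>_. 0"]) (use H(2) in auto)
    ultimately have "continuous_on (- {0} \<union> ball 0 r1) (\<lambda>y. newton_coeff u x k y *\<^sub>R H y)"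
      by (intro continuous_on_open_Un) auto
    moreover have "- {0} \<union> ball 0 r1 = (UNIV :: 'a set)" using r1 by auto
    ultimately show ?thesis by metis
  qed
  have "bounded (H ` ?Q)"
    by (intro compact_imp_bounded compact_continuous_image continuous_on_subset[OF H(1)]) auto
  then obtain K0 where K0: "\<And>y. y \<in> ?Q \<Longrightarrow> norm (H y) \<le> K0" by (auto simp: bounded_iff)
  define K where "K = max K0 0"
  have K: "norm (H y) \<le> K" "K \<ge> 0" for y using K0[of y] supp[of y] by (cases "y \<in> ?Q"; force simp: K_def)+
  \<comment> \<open>\<open>r2\<close> may be negative, in which case \<open>H\<close> vanishes
    everywhere; \<open>max\<close> keeps \<open>C\<close> nonnegative.\<close>
  define C where "C = r1 powr (- real DIM('a)) * max r2 0 * norm u * K"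
  have C: "C \<ge> 0" using K by (simp add: C_def)
  have bound: "norm (newton_coeff u x k y *\<^sub>R H y) \<le> C * (?\<beta> k * (norm x / r1) ^ k)" for x k y
  proof (cases "H y = 0")
    case True
    then show ?thesis using C r1 newton_bound_nonneg[of _ k] by simp
  next
    case False
    then have y: "r1 \<le> norm y" "norm y \<le> r2" using H(2,3) by (meson not_less)+
    then have "norm (newton_coeff u x k y *\<^sub>R H y) \<le> (r1 powr (- real DIM('a)) * r2 * norm u * ?\<beta> k * (norm x / r1) ^ k) * K"
      unfolding norm_scaleR using r1 newton_bound_nonneg[of _ k]
      by (intro mult_mono newton_coeff_le K(1)) auto
    moreover have "max r2 0 = r2" using y r1 by simp
    ultimately show ?thesis by (simp add: C_def mult_ac)
  qed
  have I: "I x k = integral ?Q (\<lambda>y. newton_coeff u x k y *\<^sub>R H y)" for x k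
    unfolding I_def by (rule integral_cbox_eq_UNIV[symmetric]) (simp add: supp)
  have "norm (I x k) \<le> C * (?\<beta> k * (norm x / r1) ^ k) * measure lborel ?Q" for x k
    unfolding I
    by (rule has_integral_bound[OF _ integrable_integral])
      (use bound C r1 newton_bound_nonneg[of _ k] in \<open>auto intro!: integrable_continuous continuous_on_subset[OF cont]\<close>)
  then have "\<forall>x k. norm (I x k) \<le> (C * measure lborel ?Q) * (?\<beta> k * (norm x / r1) ^ k)"
    by (simp add: mult_ac)
  then show "\<exists>C\<ge>0. \<forall>x k. norm (I x k) \<le> C * (?\<beta> k * (norm x / r1) ^ k)"
    using C by (intro exI[of _ "C * measure lborel ?Q"]) auto
  show "(\<lambda>k. t ^ k *\<^sub>R I x k) sums convol (newton u) H (t *\<^sub>R x)" if lx: "\<bar>t\<bar> * norm x < r1" for x t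
  proof -
    let ?g = "\<lambda>k y. t ^ k *\<^sub>R (newton_coeff u x k y *\<^sub>R H y)"
    let ?\<theta> = "\<bar>t\<bar> * norm x / r1"
    have \<theta>: "0 \<le> ?\<theta>" "?\<theta> < 1" using lx r1 by auto
    have lim: "(\<lambda>k. ?g k y) sums (newton u (t *\<^sub>R x - y) *\<^sub>R H y)" for y
    proof (cases "H y = 0")
      case False
      then have "r1 \<le> norm y" using H(2) by (meson not_less)
      then have "(\<lambda>k. t ^ k * newton_coeff u x k y) sums newton u (t *\<^sub>R x - y)"
        using lx by (intro newton_sums) auto
      from sums_scaleR_left[OF this, of "H y"] show ?thesis by simp
    qed simp
    have "uniform_limit ?Q (\<lambda>n y. \<Sum>k<n. ?g k y) (\<lambda>y. suminf (\<lambda>k. ?g k y)) sequentially"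
    proof (rule Weierstrass_m_test)
      show "summable (\<lambda>k. C * (?\<beta> k * ?\<theta> ^ k))"
        by (intro summable_mult newton_bound_summable \<theta>)
      fix k y
      have "norm (?g k y) \<le> \<bar>t\<bar> ^ k * (C * (?\<beta> k * (norm x / r1) ^ k))"
        unfolding norm_scaleR[of "t ^ k"] using bound[of x k y] by (simp add: power_abs mult_left_mono)
      also have "\<dots> = C * (?\<beta> k * ?\<theta> ^ k)" by (simp add: power_mult_distrib power_divide mult_ac)
      finally show "norm (?g k y) \<le> C * (?\<beta> k * ?\<theta> ^ k)" .
    qed
    then have ul: "uniform_limit ?Q (\<lambda>n y. \<Sum>k<n. ?g k y) (\<lambda>y. newton u (t *\<^sub>R x - y) *\<^sub>R H y) sequentially"
      using lim by (simp add: sums_iff)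
    obtain J J' where J: "\<And>n. ((\<lambda>y. \<Sum>k<n. ?g k y) has_integral J n) ?Q"
      "((\<lambda>y. newton u (t *\<^sub>R x - y) *\<^sub>R H y) has_integral J') ?Q" "J \<longlonglongrightarrow> J'"
    proof (rule uniform_limit_integral_cbox[OF ul])
      show "continuous_on ?Q (\<lambda>y. \<Sum>k<n. ?g k y)" for n
        by (intro continuous_intros continuous_on_subset[OF cont]) auto
    qed auto
    have "J = (\<lambda>n. \<Sum>k<n. t ^ k *\<^sub>R I x k)"
    proof (rule ext)
      fix n
      have "((\<lambda>y. \<Sum>k<n. ?g k y) has_integral (\<Sum>k<n. t ^ k *\<^sub>R I x k)) ?Q"
        unfolding I
        by (intro has_integral_sum has_integral_cmul integrable_integral integrable_continuous continuous_on_subset[OF cont]) auto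
      then show "J n = (\<Sum>k<n. t ^ k *\<^sub>R I x k)" using J(1) has_integral_unique by blast
    qed
    moreover have "convol (newton u) H (t *\<^sub>R x) = J'"
      unfolding convol_def using J(2) integral_cbox_eq_UNIV[of "- (r2 *\<^sub>R One)" "r2 *\<^sub>R One" "\<lambda>y. newton u (t *\<^sub>R x - y) *\<^sub>R H y"] supp
      by (auto dest: integral_unique)
    ultimately show ?thesis using J(3) by (simp add: sums_def)
  qed
qed

context clifford_system
begin

text \<open>The homogeneity of \<open>a\<close> in \<open>x\<close> and its relation to derivatives
  of \<open>f\<close> are left open, and \<open>a\<close> may depend on \<open>r1\<close>;
  uniqueness of power series in \<open>t\<close> settles this later.\<close>

lemma homogeneous_expansion:
  assumes f: "dirac_null \<rho> f" and r: "0 < r1" "r1 < \<rho>"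
  obtains a C where "C \<ge> 0"
    "\<And>x t. proj x = x \<Longrightarrow> \<bar>t\<bar> * norm x < r1 \<Longrightarrow> (\<lambda>k. t ^ k *\<^sub>R a x k) sums f (t *\<^sub>R x)"
    "\<And>x k. norm (a x k) \<le> C * (newton_bound (- real DIM('a) / 2) k * (norm x / r1) ^ k)"
proof -
  obtain H r2 where H: "r1 < r2" "\<And>s. continuous_on UNIV (H s)"
    "\<And>s y. norm y < r1 \<Longrightarrow> H s y = 0" "\<And>s y. norm y > r2 \<Longrightarrow> H s y = 0"
    "\<And>x. norm x < r1 \<Longrightarrow> f (proj x) = (\<Sum>s<DIM('a). convol (newton (v s)) (H s) x)"
    by (rule shell_representation[OF f r]) (rule that; assumption)
  define I where "I = (\<lambda>s x k. integral UNIV (\<lambda>y. newton_coeff (v s) x k y *\<^sub>R H s y))"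
  note cs = convol_newton_sums[OF r(1) H(2,3,4)]
  have "\<exists>C\<ge>0. \<forall>x k. norm (I s x k) \<le> C * (newton_bound (- real DIM('a) / 2) k * (norm x / r1) ^ k)" for s
    unfolding I_def by (rule cs(2))
  then obtain C where C: "\<And>s. C s \<ge> 0"
    "\<And>s x k. norm (I s x k) \<le> C s * (newton_bound (- real DIM('a) / 2) k * (norm x / r1) ^ k)" by metis
  show thesis
  proof (rule that[of "\<Sum>s<DIM('a). C s" "\<lambda>x k. \<Sum>s<DIM('a). I s x k"])
    show "(\<Sum>s<DIM('a). C s) \<ge> 0" using C by (simp add: sum_nonneg)
    show "norm (\<Sum>s<DIM('a). I s x k) \<le> (\<Sum>s<DIM('a). C s) * (newton_bound (- real DIM('a) / 2) k * (norm x / r1) ^ k)" for x k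
      unfolding sum_distrib_right by (rule sum_norm_le) (rule C(2))
    fix x :: 'a and t :: real assume x: "proj x = x" "\<bar>t\<bar> * norm x < r1"
    have "(\<lambda>k. \<Sum>s<DIM('a). t ^ k *\<^sub>R I s x k) sums (\<Sum>s<DIM('a). convol (newton (v s)) (H s) (t *\<^sub>R x))"
      unfolding I_def by (intro sums_sum cs(1) x)
    moreover have "(\<Sum>s<DIM('a). convol (newton (v s)) (H s) (t *\<^sub>R x)) = f (t *\<^sub>R x)"
      using H(5)[of "t *\<^sub>R x"] x by (simp add: linear_scale[OF linear_proj])
    ultimately show "(\<lambda>k. t ^ k *\<^sub>R (\<Sum>s<DIM('a). I s x k)) sums f (t *\<^sub>R x)"
      by (simp add: scaleR_sum_right)
  qed
qed

end

subsection \<open>Symmetrized products\<close>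

definition words :: "nat \<Rightarrow> nat \<Rightarrow> nat list set" where
  "words m k = {is. set is \<subseteq> {1..m} \<and> length is = k}"

lemma finite_words: "finite (words m k)"
  unfolding words_def by (rule finite_lists_length_eq) simp

lemma words_0: "words m 0 = {[]}"
  by (auto simp: words_def)

lemma sum_words_Cons: "(\<Sum>is\<in>words m (Suc k). g is) = (\<Sum>l=1..m. \<Sum>is\<in>words m k. g (l # is))"
proof -
  have "words m (Suc k) = (\<lambda>(l, is). l # is) ` ({1..m} \<times> words m k)"
  proof (intro set_eqI iffI)
    fix js assume "js \<in> words m (Suc k)"
    then show "js \<in> (\<lambda>(l, is). l # is) ` ({1..m} \<times> words m k)"
      by (cases js) (auto simp: words_def image_iff)
  qed (auto simp: words_def)
  moreover have "inj_on (\<lambda>(l, is). l # is) ({1..m} \<times> words m k)" by (auto simp: inj_on_def)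
  ultimately show ?thesis by (simp add: sum.reindex sum.cartesian_product case_prod_unfold)
qed

lemma sum_words_snoc: "(\<Sum>is\<in>words m (Suc k). g is) = (\<Sum>l=1..m. \<Sum>is\<in>words m k. g (is @ [l]))"
proof -
  have "words m (Suc k) = (\<lambda>(l, is). is @ [l]) ` ({1..m} \<times> words m k)"
  proof (intro set_eqI iffI)
    fix js assume "js \<in> words m (Suc k)"
    then show "js \<in> (\<lambda>(l, is). is @ [l]) ` ({1..m} \<times> words m k)"
      by (cases js rule: rev_cases) (auto simp: words_def image_iff)
  qed (auto simp: words_def)
  moreover have "inj_on (\<lambda>(l, is). is @ [l]) ({1..m} \<times> words m k)" by (auto simp: inj_on_def)
  ultimately show ?thesis by (simp add: sum.reindex sum.cartesian_product case_prod_unfold)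
qed

lemma digits_less:
  fixes c :: "nat \<Rightarrow> nat"
  assumes "\<And>l. c l < B" shows "(\<Sum>l=1..m. c l * B ^ l) < B ^ Suc m"
proof (induction m)
  case 0
  then show ?case using assms[of 0] by simp
next
  case (Suc m)
  have "(\<Sum>l=1..Suc m. c l * B ^ l) < B ^ Suc m + c (Suc m) * B ^ Suc m"
    using Suc by simp
  also have "\<dots> = (c (Suc m) + 1) * B ^ Suc m" by simp
  also have "\<dots> \<le> B * B ^ Suc m" using assms[of "Suc m"] by (intro mult_right_mono) auto
  finally show ?case by simp
qed

lemma digits_unique:
  fixes c d :: "nat \<Rightarrow> nat"
  assumes "\<And>l. c l < B" "\<And>l. d l < B" "(\<Sum>l=1..m. c l * B ^ l) = (\<Sum>l=1..m. d l * B ^ l)" "l \<in> {1..m}"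
  shows "c l = d l"
  using assms(3,4)
proof (induction m)
  case (Suc m)
  let ?c = "\<Sum>l=1..m. c l * B ^ l" and ?d = "\<Sum>l=1..m. d l * B ^ l"
  have B: "B ^ Suc m > 0" using assms(1)[of 0] by simp
  have lt: "?c < B ^ Suc m" "?d < B ^ Suc m" using digits_less assms(1,2) by auto
  have eq: "?c + c (Suc m) * B ^ Suc m = ?d + d (Suc m) * B ^ Suc m" using Suc.prems(1) by simp
  have top: "(?c + c (Suc m) * B ^ Suc m) div B ^ Suc m = c (Suc m)"
    "(?d + d (Suc m) * B ^ Suc m) div B ^ Suc m = d (Suc m)"
    using B by (simp_all only: div_mult_self1[OF less_imp_neq[OF B, symmetric]] div_less[OF lt(1)] div_less[OF lt(2)] add_0_right)
  then have cd: "c (Suc m) = d (Suc m)" using eq by simp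
  then have "?c = ?d" using eq by simp
  then show ?case using Suc.IH Suc.prems(2) cd by (cases "l = Suc m") auto
qed simp

lemma count_list_words:
  assumes "is \<in> words m k"
  shows "count_list is l \<le> k" "l \<notin> {1..m} \<Longrightarrow> count_list is l = 0"
  using assms count_le_length[of "is" l] by (auto simp: words_def count_list_0_iff)

text \<open>Kronecker substitution \<open>t l = T ^ (k + 1) ^ l\<close> separates the monomials.\<close>

lemma words_polynomial_eq_0:
  fixes D :: "nat list \<Rightarrow> 'a::euclidean_space"
  assumes "\<And>t :: nat \<Rightarrow> real. (\<Sum>is\<in>words m k. prod_list (map t is) *\<^sub>R D is) = 0"
  shows "(\<Sum>is\<in>{is \<in> words m k. count_list is = \<kappa>}. D is) = 0"
proof (cases "\<exists>js\<in>words m k. count_list js = \<kappa>")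
  case True
  then obtain js where js: "js \<in> words m k" "count_list js = \<kappa>" by blast
  \<comment> \<open>The exponent of \<open>T\<close> that the substitution gives to a word; letter
    counts are at most \<open>k\<close>, hence they are digits in base \<open>Suc k\<close>.\<close>
  define w where "w is = (\<Sum>l=1..m. count_list is l * Suc k ^ l)" for "is"
  have winj: "count_list is = count_list js" if "w is = w js" "is \<in> words m k" "js \<in> words m k" for "is" js
  proof
    fix l
    show "count_list is l = count_list js l"
    proof (cases "l \<in> {1..m}")
      case True
      show ?thesis
        by (rule digits_unique[of _ "Suc k" _ m])
          (use that count_list_words True in \<open>auto simp: w_def less_Suc_eq_le\<close>)
    qed (use that count_list_words in auto)
  qed
  define N where "N = Max (w ` words m k)"
  have N: "w is \<le> N" if "is \<in> words m k" for "is"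
    unfolding N_def using that finite_words by (intro Max_ge) auto
  show ?thesis
  proof (rule euclidean_eqI)
    fix b :: 'a assume "b \<in> Basis"
    define c where "c n = (\<Sum>is\<in>{is \<in> words m k. w is = n}. D is \<bullet> b)" for n
    have "(\<Sum>n\<le>N. c n * T ^ n) = 0" for T :: real
    proof -
      have "(\<Sum>n\<le>N. c n * T ^ n) = (\<Sum>n\<le>N. \<Sum>is\<in>{is \<in> words m k. w is = n}. T ^ w is * (D is \<bullet> b))"
        unfolding c_def sum_distrib_right by (intro sum.cong) auto
      also have "\<dots> = (\<Sum>is\<in>words m k. T ^ w is * (D is \<bullet> b))"
        by (rule sum.group) (use finite_words N in auto)
      also have "\<dots> = (\<Sum>is\<in>words m k. prod_list (map (\<lambda>l. T ^ (Suc k ^ l)) is) *\<^sub>R D is) \<bullet> b"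
        unfolding inner_sum_left
      proof (intro sum.cong refl)
        fix "is" assume i: "is \<in> words m k"
        have "prod_list (map (\<lambda>l. T ^ (Suc k ^ l)) is) = T ^ sum_list (map (\<lambda>l. Suc k ^ l) is)" for "is"
          by (induction "is") (auto simp: power_add)
        also have "sum_list (map (\<lambda>l. Suc k ^ l) is) = w is"
          unfolding w_def using i by (intro sum_list_map_eq_sum_count2) (auto simp: words_def)
        finally show "T ^ w is * (D is \<bullet> b) = prod_list (map (\<lambda>l. T ^ (Suc k ^ l)) is) *\<^sub>R D is \<bullet> b" by simp
      qed
      also have "\<dots> = 0" by (simp only: assms inner_zero_left)
      finally show ?thesis .
    qed
    then have "\<forall>n\<le>N. c n = 0" using polyfun_eq_0[of c N] by blast
    then have "c (w js) = 0" using N js by blast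
    moreover have "{is \<in> words m k. w is = w js} = {is \<in> words m k. count_list is = \<kappa>}"
    proof (intro Collect_cong conj_cong refl iffI)
      fix "is" assume i: "is \<in> words m k"
      show "count_list is = \<kappa>" if "w is = w js" using winj[OF that i js(1)] js by simp
      show "w is = w js" if "count_list is = \<kappa>" using that js by (simp add: w_def)
    qed
    ultimately show "(\<Sum>is\<in>{is \<in> words m k. count_list is = \<kappa>}. D is) \<bullet> b = 0 \<bullet> b"
      by (simp add: c_def inner_sum_left)
  qed
next
  case False
  then have "{is \<in> words m k. count_list is = \<kappa>} = {}" by auto
  then show ?thesis by (simp only: sum.empty)
qed

text \<open>Letters in increasing order: folded from the right, they apply the derivative along
  \<open>v 1\<close> last, as \<open>multi_partial\<close> does.\<close>

definition sorted_word :: "nat \<Rightarrow> (nat \<Rightarrow> nat) \<Rightarrow> nat list" where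
  "sorted_word m \<kappa> = concat (map (\<lambda>l. replicate (\<kappa> l) l) [1..<Suc m])"

lemma count_list_replicate_concat:
  "distinct xs \<Longrightarrow> count_list (concat (map (\<lambda>l. replicate (\<kappa> l) l) xs)) j = (if j \<in> set xs then \<kappa> j else 0)"
proof (induction xs)
  case (Cons a xs)
  have "count_list (replicate n a) j = (if j = a then n else 0)" for n by (induction n) auto
  then show ?case using Cons by auto
qed simp

lemma count_sorted_word:
  assumes "\<kappa> \<in> multi_indices m k" shows "count_list (sorted_word m \<kappa>) = \<kappa>"
proof
  fix j show "count_list (sorted_word m \<kappa>) j = \<kappa> j"
    unfolding sorted_word_def count_list_replicate_concat[OF distinct_upt] set_upt
    using assms by (auto simp: multi_indices_def)
qed

lemma length_eq_sum_count:
  fixes "is" :: "nat list"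
  assumes "set is \<subseteq> {1..m}" shows "length is = (\<Sum>l=1..m. count_list is l)"
  using sum_list_map_eq_sum_count2[OF assms, of "\<lambda>_. 1"] by (simp add: sum_list_triv)

lemma sorted_word_in_words:
  assumes "\<kappa> \<in> multi_indices m k" shows "sorted_word m \<kappa> \<in> words m k"
proof -
  have s: "set (sorted_word m \<kappa>) \<subseteq> {1..m}" by (auto simp: sorted_word_def)
  then show ?thesis
    using length_eq_sum_count[OF s] count_sorted_word[OF assms] assms by (simp add: words_def multi_indices_def)
qed

lemma count_list_multi_index: "is \<in> words m k \<Longrightarrow> count_list is \<in> multi_indices m k"
  using count_list_words(2)[of "is" m k] length_eq_sum_count[of "is" m] by (simp add: multi_indices_def words_def)

lemma multi_indices_eq: "multi_indices m k = count_list ` words m k"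
  using count_list_multi_index count_sorted_word sorted_word_in_words by (auto simp: image_iff) metis

text \<open>The length is not prescribed on the left; the letter counts force it.\<close>

lemma words_count_eq:
  assumes "\<kappa> \<in> multi_indices m k"
  shows "{is. set is \<subseteq> {1..m} \<and> (\<forall>l\<in>{1..m}. count_list is l = \<kappa> l)} = {is \<in> words m k. count_list is = \<kappa>}"
proof (intro Collect_cong iffI conjI)
  fix "is" assume i: "set is \<subseteq> {1..m} \<and> (\<forall>l\<in>{1..m}. count_list is l = \<kappa> l)"
  show w: "is \<in> words m k"
    using i length_eq_sum_count[of "is" m] assms by (auto simp: words_def multi_indices_def)
  show "count_list is = \<kappa>"
  proof
    fix l show "count_list is l = \<kappa> l"
      using i count_list_words(2)[OF w, of l] assms by (cases "l \<in> {1..m}") (auto simp: multi_indices_def)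
  qed
qed (auto simp: words_def)

section \<open>Powers in the algebra and iterated left multiplications\<close>

context hypercomplex_subspace
begin

lemma mul_linear: "linear (mul a)" "linear (\<lambda>a. mul a b)"
  using bilinear_mul by (auto simp: bilinear_def)

lemmas mul_simps = linear_add[OF mul_linear(1)] linear_add[OF mul_linear(2)] linear_diff[OF mul_linear(1)]
  linear_diff[OF mul_linear(2)] linear_scale[OF mul_linear(1)] linear_scale[OF mul_linear(2)]
  linear_neg[OF mul_linear(1)] linear_neg[OF mul_linear(2)] unit_left unit_right

lemma left_alternative: "mul a (mul a b) = mul (mul a a) b"
  using associator_alternating(1)[of a b] by (simp add: associator_def)

lemma left_alternative_polarized: "mul a (mul b c) + mul b (mul a c) = mul (mul a b + mul b a) c"
  using left_alternative[of "a + b" c] left_alternative[of a c] left_alternative[of b c]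
  by (simp add: mul_simps algebra_simps)

lemma v_square: assumes "s \<in> {1..m}" shows "mul (v s) (v s) = - e"
proof -
  have "cj (v s) = - v s" "mul (v s) (cj (v s)) = e"
    using v_imaginary_unit[OF assms] by (auto simp: imaginary_units_def alg_trace_def alg_norm_def add_eq_0_iff)
  then show ?thesis by (simp add: mul_simps) (metis minus_minus)
qed

lemma m_less_DIM: "m < DIM('a)"
proof -
  have "card (v ` {0..m}) \<le> DIM('a)" using independent_card_le[OF basis_independent] by simp
  then show ?thesis by (simp add: card_image[OF basis_inj])
qed

text \<open>Outside the real line the trace gives \<open>cj x = \<tau> *\<^sub>R e - x\<close>, and
  inserting this into the norm yields the equation; a real \<open>x = r *\<^sub>R e\<close>
  satisfies it with \<open>\<tau> = r\<close> and \<open>\<nu> = 0\<close>.\<close>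

lemma M_quadratic: assumes "x \<in> M" shows "\<exists>\<tau> \<nu>. mul x x = \<tau> *\<^sub>R x - \<nu> *\<^sub>R e"
proof -
  consider r where "x = r *\<^sub>R e" | \<tau> \<nu> where "x + cj x = \<tau> *\<^sub>R e" "mul x (cj x) = \<nu> *\<^sub>R e"
    using assms M_subset_cone unfolding quadratic_cone_def real_line_def alg_trace_def alg_norm_def by blast
  then show ?thesis
  proof cases
    case 1
    then show ?thesis by (intro exI[of _ r] exI[of _ 0]) (simp add: mul_simps)
  next
    case 2
    then have "cj x = \<tau> *\<^sub>R e - x" by (simp add: algebra_simps)
    then have "\<tau> *\<^sub>R x - mul x x = \<nu> *\<^sub>R e" using 2 by (simp add: mul_simps)
    then show ?thesis by (intro exI[of _ \<tau>] exI[of _ \<nu>]) (simp add: algebra_simps)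
  qed
qed

text \<open>By the quadratic equation the powers of \<open>Z\<close> stay in the span of
  \<open>e\<close> and \<open>Z\<close>. Left alternativity gives the operator powers the same
  recursion, so the coefficients, which do not depend on \<open>a\<close>, agree.\<close>

lemma power_action:
  assumes "Z \<in> M"
  shows "\<exists>\<alpha> \<beta>. foldl mul e (replicate k Z) = \<alpha> *\<^sub>R e + \<beta> *\<^sub>R Z \<and> (\<forall>a. (mul Z ^^ k) a = \<alpha> *\<^sub>R a + \<beta> *\<^sub>R mul Z a)"
proof (induction k)
  case 0
  show ?case by (intro exI[of _ 1] exI[of _ 0]) simp
next
  case (Suc k)
  then obtain \<alpha> \<beta> where IH: "foldl mul e (replicate k Z) = \<alpha> *\<^sub>R e + \<beta> *\<^sub>R Z"
    "\<And>a. (mul Z ^^ k) a = \<alpha> *\<^sub>R a + \<beta> *\<^sub>R mul Z a" by blast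
  obtain \<tau> \<nu> where q: "mul Z Z = \<tau> *\<^sub>R Z - \<nu> *\<^sub>R e" using M_quadratic[OF assms] by blast
  have "foldl mul e (replicate (Suc k) Z) = mul (\<alpha> *\<^sub>R e + \<beta> *\<^sub>R Z) Z"
    unfolding replicate_Suc replicate_append_same[symmetric] by (simp add: IH)
  also have "\<dots> = (- \<beta> * \<nu>) *\<^sub>R e + (\<alpha> + \<beta> * \<tau>) *\<^sub>R Z" by (simp add: mul_simps q algebra_simps)
  finally have 1: "foldl mul e (replicate (Suc k) Z) = (- \<beta> * \<nu>) *\<^sub>R e + (\<alpha> + \<beta> * \<tau>) *\<^sub>R Z" .
  have 2: "(mul Z ^^ Suc k) a = (- \<beta> * \<nu>) *\<^sub>R a + (\<alpha> + \<beta> * \<tau>) *\<^sub>R mul Z a" for a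
    by (simp add: IH mul_simps left_alternative q) (simp add: algebra_simps)
  from 1 2 show ?case by blast
qed

lemma mul_power_action: "Z \<in> M \<Longrightarrow> mul (foldl mul e (replicate k Z)) a = (mul Z ^^ k) a"
  using power_action[of Z k] by (auto simp: mul_simps)

text \<open>Distributivity only: left-nested products grow at the right end of a word, iterated left
  multiplications at the left end.\<close>

lemma foldl_power_expand:
  fixes t :: "nat \<Rightarrow> real" and z :: "nat \<Rightarrow> 'a"
  defines "Z \<equiv> \<Sum>l=1..m. t l *\<^sub>R z l"
  shows "foldl mul e (replicate k Z) = (\<Sum>is\<in>words m k. prod_list (map t is) *\<^sub>R foldl mul e (map z is))"
proof (induction k)
  case 0
  show ?case by (simp add: words_0)
next
  case (Suc k)
  have "foldl mul e (replicate (Suc k) Z) = mul (foldl mul e (replicate k Z)) Z"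
    unfolding replicate_Suc replicate_append_same[symmetric] by simp
  also have "\<dots> = (\<Sum>l=1..m. t l *\<^sub>R mul (foldl mul e (replicate k Z)) (z l))"
    unfolding Z_def by (simp add: linear_sum[OF mul_linear(1)] mul_simps)
  also have "\<dots> = (\<Sum>l=1..m. \<Sum>is\<in>words m k. (prod_list (map t is) * t l) *\<^sub>R mul (foldl mul e (map z is)) (z l))"
    unfolding Suc by (simp add: linear_sum[OF mul_linear(2)] mul_simps scaleR_sum_right mult.commute)
  also have "\<dots> = (\<Sum>is\<in>words m (Suc k). prod_list (map t is) *\<^sub>R foldl mul e (map z is))"
    unfolding sum_words_snoc by simp
  finally show ?case .
qed

lemma funpow_mul_expand:
  fixes t :: "nat \<Rightarrow> real" and z :: "nat \<Rightarrow> 'a"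
  defines "Z \<equiv> \<Sum>l=1..m. t l *\<^sub>R z l"
  shows "(mul Z ^^ k) a = (\<Sum>is\<in>words m k. prod_list (map t is) *\<^sub>R foldr (\<lambda>i. mul (z i)) is a)"
proof (induction k)
  case 0
  show ?case by (simp add: words_0)
next
  case (Suc k)
  have "(mul Z ^^ Suc k) a = mul Z ((mul Z ^^ k) a)" by simp
  also have "\<dots> = (\<Sum>l=1..m. t l *\<^sub>R mul (z l) ((mul Z ^^ k) a))"
    unfolding Z_def by (simp add: linear_sum[OF mul_linear(2)] mul_simps)
  also have "\<dots> = (\<Sum>l=1..m. \<Sum>is\<in>words m k. (t l * prod_list (map t is)) *\<^sub>R mul (z l) (foldr (\<lambda>i. mul (z i)) is a))"
    unfolding Suc by (simp add: linear_sum[OF mul_linear(1)] mul_simps scaleR_sum_right)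
  also have "\<dots> = (\<Sum>is\<in>words m (Suc k). prod_list (map t is) *\<^sub>R foldr (\<lambda>i. mul (z i)) is a)"
    unfolding sum_words_Cons by simp
  finally show ?case .
qed

text \<open>Polarization of the power law in \<open>mul_power_action\<close>: although the algebra is not associative,
  the symmetrized products act like the composition of the left multiplications.\<close>

lemma symmetrized_product_action:
  assumes "\<And>l. l \<in> {1..m} \<Longrightarrow> z l \<in> M"
  shows "mul (\<Sum>is\<in>{is \<in> words m k. count_list is = \<kappa>}. foldl mul e (map z is)) a
       = (\<Sum>is\<in>{is \<in> words m k. count_list is = \<kappa>}. foldr (\<lambda>i. mul (z i)) is a)"
proof -
  let ?D = "\<lambda>is. mul (foldl mul e (map z is)) a - foldr (\<lambda>i. mul (z i)) is a"
  have "(\<Sum>is\<in>words m k. prod_list (map t is) *\<^sub>R ?D is) = 0" for t :: "nat \<Rightarrow> real"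
  proof -
    let ?Z = "\<Sum>l=1..m. t l *\<^sub>R z l"
    have "?Z \<in> M" using assms by (intro subspace_sum subspace_M subspace_scale) auto
    from mul_power_action[OF this, of k a] show ?thesis
      unfolding foldl_power_expand funpow_mul_expand
      by (simp add: linear_sum[OF mul_linear(2)] mul_simps scaleR_diff_right sum_subtractf)
  qed
  from words_polynomial_eq_0[OF this, of \<kappa>] show ?thesis
    by (simp add: sum_subtractf linear_sum[OF mul_linear(2)])
qed

lemma v_in_M: "s \<le> m \<Longrightarrow> v s \<in> M"
  using basis_span span_base by (metis atLeastAtMost_iff imageI zero_le)

lemma fueter_var_in_M: "l \<in> {1..m} \<Longrightarrow> fueter_var e v l x \<in> M"
  using v_in_M[of 0] v_in_M[of l] v_0 subspace_M
  by (auto simp: fueter_var_def intro!: subspace_diff subspace_scale)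

lemma fueter_poly_action:
  assumes "\<kappa> \<in> multi_indices m k"
  shows "mul (fueter_poly mul e m v \<kappa> x) a = (1 / fact k) *\<^sub>R
    (\<Sum>is\<in>{is \<in> words m k. count_list is = \<kappa>}. foldr (\<lambda>i. mul (fueter_var e v i x)) is a)"
proof -
  have k: "(\<Sum>l=1..m. \<kappa> l) = k" using assms by (simp add: multi_indices_def)
  show ?thesis
    unfolding fueter_poly_def k words_count_eq[OF assms] mul_simps
    by (subst symmetrized_product_action[symmetric]) (auto intro: fueter_var_in_M)
qed

text \<open>For two distinct indices in \<open>{1..m}\<close>, polarized left alternativity reduces
  the mixed relation to the anticommutation of the units; if one index is 0, the sign in the
  conjugate makes the two terms cancel.\<close>

sublocale clifford_system v m "\<lambda>s. mul (v s)" "\<lambda>s z. if s = 0 then z else - mul (v s) z"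
proof (intro clifford_system.intro orthonormal_basis.intro clifford_system_axioms.intro)
  show "v i \<bullet> v j = (if i = j then 1 else 0)" if "i < DIM('a)" "j < DIM('a)" for i j
    using that by (rule completed_basis_orthonormal)
  show "m < DIM('a)" by (rule m_less_DIM)
  show "linear (mul (v s))" for s by (rule mul_linear)
  show "linear (\<lambda>z. if s = 0 then z else - mul (v s) z)" for s
    using mul_linear(1)[of "v s"] by (cases "s = 0") (auto simp: linear_compose_neg linear_ident)
  show "(if s = 0 then mul (v s) z else - mul (v s) (mul (v s) z)) = z" if "s \<le> m" for s z
    using that v_square[of s] by (cases "s = 0") (auto simp: v_0 mul_simps left_alternative)
  show "(if s = 0 then mul (v t) z else - mul (v s) (mul (v t) z)) +
      (if t = 0 then mul (v s) z else - mul (v t) (mul (v s) z)) = 0"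
    if st: "s \<le> m" "t \<le> m" "s \<noteq> t" for s t z
  proof -
    consider "s = 0" "t \<noteq> 0" | "s \<noteq> 0" "t = 0" | "s \<noteq> 0" "t \<noteq> 0" using st by linarith
    then show ?thesis
    proof cases
      case 3
      then have "mul (v s) (v t) + mul (v t) (v s) = 0" using v_anticommute[of s t] st by auto
      then have "mul (v s) (mul (v t) z) + mul (v t) (mul (v s) z) = 0"
        using left_alternative_polarized[of "v s" "v t" z] linear_0[OF mul_linear(2)] by simp
      then show ?thesis using 3 by (simp add: add_eq_0_iff)
    qed (auto simp: v_0 mul_simps)
  qed
qed

lemma M_eq_proj: "x \<in> M \<longleftrightarrow> proj x = x"
proof
  assume "x \<in> M"
  then have "x \<in> span (v ` {0..m})" using basis_span by simp
  then show "proj x = x"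
  proof (induction rule: span_induct)
    case base
    show ?case unfolding subspace_def using linear_proj by (auto simp: linear_0 linear_add linear_scale)
  next
    case (step y)
    then show ?case by (auto intro: proj_v_le)
  qed
next
  assume "proj x = x"
  moreover have "proj x \<in> M" unfolding proj_def
    by (intro subspace_sum subspace_M subspace_scale v_in_M) auto
  ultimately show "x \<in> M" by simp
qed

end

subsection \<open>The Taylor series\<close>

lemma diffs_funpow_0: "(diffs ^^ k) c n = fact (n + k) / fact n * (c (n + k) :: real)"
proof (induction k arbitrary: n)
  case (Suc k)
  have "(diffs ^^ Suc k) c n = real (Suc n) * (diffs ^^ k) c (Suc n)" by (simp add: diffs_def)
  also have "\<dots> = fact (n + Suc k) / fact n * c (n + Suc k)" unfolding Suc
    by (simp add: field_simps del: of_nat_Suc)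
  finally show ?case .
qed simp

text \<open>Termwise differentiation by induction on \<open>k\<close>, with uniqueness of
  derivatives. The derivatives are given as a chain \<open>T\<close> instead of by iterating an
  operator, so that an explicit formula for all of them can be inserted.\<close>

lemma power_series_derivatives_real:
  fixes T :: "nat \<Rightarrow> real \<Rightarrow> real"
  assumes deriv: "\<And>k t. \<bar>t\<bar> < 1 \<Longrightarrow> (T k has_real_derivative T (Suc k) t) (at t)"
    and sums: "\<And>t. \<bar>t\<bar> < 1 \<Longrightarrow> (\<lambda>n. c n * t ^ n) sums T 0 t"
  shows "T k 0 = fact k * c k"
proof -
  have *: "\<forall>t. \<bar>t\<bar> < 1 \<longrightarrow> (\<lambda>n. (diffs ^^ k) c n * t ^ n) sums T k t" for k
  proof (induction k)
    case (Suc k)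
    show ?case
    proof (intro allI impI)
      fix t :: real assume t: "\<bar>t\<bar> < 1"
      let ?d = "(diffs ^^ k) c"
      have s: "summable (\<lambda>n. ?d n * z ^ n)" if "norm z < 1" for z
        using Suc that by (auto dest: sums_summable)
      have "((\<lambda>z. \<Sum>n. ?d n * z ^ n) has_real_derivative (\<Sum>n. diffs ?d n * t ^ n)) (at t)"
        by (rule termdiffs_strong'[OF s]) (use t in auto)
      moreover have "((\<lambda>z. \<Sum>n. ?d n * z ^ n) has_real_derivative T (Suc k) t) (at t)"
      proof (rule has_field_derivative_transform_within[of "T k" _ t UNIV "1 - \<bar>t\<bar>"])
        show "(T k has_real_derivative T (Suc k) t) (at t)" by (rule deriv[OF t])
        show "0 < 1 - \<bar>t\<bar>" using t by simp
        show "T k z = (\<Sum>n. ?d n * z ^ n)" if "dist z t < 1 - \<bar>t\<bar>" for z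
        proof -
          have "\<bar>z\<bar> < 1" using that by (simp add: dist_real_def)
          then show ?thesis using Suc by (simp add: sums_iff)
        qed
      qed simp
      ultimately have "(\<Sum>n. diffs ?d n * t ^ n) = T (Suc k) t" by (rule DERIV_unique)
      moreover have "summable (\<lambda>n. diffs ?d n * t ^ n)"
        by (rule termdiff_converges[of t 1]) (use t s in auto)
      ultimately show "(\<lambda>n. (diffs ^^ Suc k) c n * t ^ n) sums T (Suc k) t" by (simp add: sums_iff)
    qed
  qed (use sums in simp)
  have "(\<lambda>n. (diffs ^^ k) c n * 0 ^ n) sums T k 0" by (rule *[rule_format]) simp
  then have "T k 0 = (diffs ^^ k) c 0" by (simp add: powser_sums_zero_iff)
  then show ?thesis by (simp add: diffs_funpow_0)
qed

lemma power_series_derivatives: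
  fixes T :: "nat \<Rightarrow> real \<Rightarrow> 'a::euclidean_space"
  assumes deriv: "\<And>k t. \<bar>t\<bar> < 1 \<Longrightarrow> (T k has_vector_derivative T (Suc k) t) (at t)"
    and sums: "\<And>t. \<bar>t\<bar> < 1 \<Longrightarrow> (\<lambda>n. t ^ n *\<^sub>R a n) sums T 0 t"
  shows "a k = (1 / fact k) *\<^sub>R T k 0"
proof (rule euclidean_eqI)
  fix b :: 'a assume "b \<in> Basis"
  have "T k 0 \<bullet> b = fact k * (a k \<bullet> b)"
  proof (rule power_series_derivatives_real[of "\<lambda>k t. T k t \<bullet> b"])
    show "((\<lambda>t. T k t \<bullet> b) has_real_derivative T (Suc k) t \<bullet> b) (at t)" if "\<bar>t\<bar> < 1" for k t
      using bounded_linear.has_vector_derivative[OF bounded_linear_inner_left deriv[OF that]]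
      by (simp add: has_real_derivative_iff_has_vector_derivative)
    show "(\<lambda>n. (a n \<bullet> b) * t ^ n) sums (T 0 t \<bullet> b)" if "\<bar>t\<bar> < 1" for t
      using bounded_linear.sums[OF bounded_linear_inner_left sums[OF that], of b] by (simp add: mult.commute)
  qed
  then show "a k \<bullet> b = (1 / fact k) *\<^sub>R T k 0 \<bullet> b" by simp
qed

lemma multi_partial_eq_iter: "multi_partial m v \<kappa> f = foldr (partial v) (sorted_word m \<kappa>) f"
proof -
  have "foldr (partial v) (concat (map (\<lambda>l. replicate (\<kappa> l) l) xs)) f = foldr (\<lambda>l. partial v l ^^ \<kappa> l) xs f" for xs
  proof (induction xs)
    case (Cons l xs)
    have "foldr (partial v) (replicate n l @ ys) f = (partial v l ^^ n) (foldr (partial v) ys f)" for n ys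
      by (induction n) auto
    then show ?case using Cons by simp
  qed simp
  then show ?thesis by (simp add: multi_partial_def sorted_word_def)
qed

section \<open>Derivatives along rays and the Taylor terms\<close>

context hypercomplex_subspace
begin

lemma monogenic_iff_dirac_null: "monogenic_on mul m v (rball \<rho>) f \<longleftrightarrow> dirac_null \<rho> f"
  by (simp add: monogenic_on_def dirac_null_def atLeast0AtMost)

text \<open>Substituting \<open>\<partial>\<^sub>0 f = - (\<Sum>l=1..m. v l * \<partial>\<^sub>l f)\<close> turns the Euler derivative into
  \<open>\<Sum>l=1..m. z l * \<partial>\<^sub>l f\<close> with the Fueter variables \<open>z l\<close> of the direction.\<close>

lemma fueter_direction:
  assumes f: "dirac_null \<rho> f" and x: "x \<in> rball \<rho>" and h: "proj h = h"
  shows "has_partial f h (\<Sum>l=1..m. mul (fueter_var e v l h) (partial v l f x)) x"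
proof -
  have split: "(\<Sum>s\<le>m. q s) = q 0 + (\<Sum>l=1..m. q l)" for q :: "nat \<Rightarrow> 'a"
    using sum.atLeast_Suc_atMost[of 0 m q] by (simp add: atLeast0AtMost)
  have "partial v 0 f x = - (\<Sum>l=1..m. mul (v l) (partial v l f x))"
    using f x unfolding dirac_null_def split by (simp add: v_0 unit_left add_eq_0_iff2)
  then have "(\<Sum>s\<le>m. (h \<bullet> v s) *\<^sub>R partial v s f x) = (\<Sum>l=1..m. mul (fueter_var e v l h) (partial v l f x))"
    unfolding split fueter_var_def mul_simps
    by (simp add: sum_subtractf scaleR_sum_right[symmetric])
  then show ?thesis using directional_derivative[OF f h x] by simp
qed

lemma linear_foldr_mul: "linear (\<lambda>a. foldr (\<lambda>i. mul (z i)) is a)"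
proof (induction "is")
  case (Cons i "is")
  then show ?case using linear_compose[OF Cons mul_linear(1)[of "z i"]] by (simp add: o_def)
qed (simp add: linear_ident)

text \<open>For a null solution, the \<open>k\<close>-th derivative of
  \<open>f (t *\<^sub>R x)\<close> in \<open>t\<close>. The Fueter variables are taken at the
  direction \<open>x\<close>, hence constant along the ray, so that differentiation acts on
  \<open>f\<close> alone.\<close>

definition ray_derivative :: "('a \<Rightarrow> 'a) \<Rightarrow> 'a \<Rightarrow> nat \<Rightarrow> real \<Rightarrow> 'a" where
  "ray_derivative f x k t = (\<Sum>is\<in>words m k. foldr (\<lambda>i. mul (fueter_var e v i x)) is (iter_partial is f (t *\<^sub>R x)))"

lemma ray_derivative_Suc:
  assumes f: "dirac_null \<rho> f" and x: "proj x = x" "t *\<^sub>R x \<in> rball \<rho>"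
  shows "(ray_derivative f x k has_vector_derivative ray_derivative f x (Suc k) t) (at t)"
proof -
  let ?L = "foldr (\<lambda>i. mul (fueter_var e v i x))"
  have d: "((\<lambda>t. ?L is (iter_partial is f (t *\<^sub>R x))) has_vector_derivative
      (\<Sum>l=1..m. ?L (is @ [l]) (iter_partial (is @ [l]) f (t *\<^sub>R x)))) (at t)" if i: "is \<in> words m k" for "is"
  proof -
    have i': "set is \<subseteq> {..m}" using i by (auto simp: words_def)
    let ?D = "\<Sum>l=1..m. mul (fueter_var e v l x) (partial v l (iter_partial is f) (t *\<^sub>R x))"
    have "has_partial (iter_partial is f) x ?D (0 + t *\<^sub>R x)"
      using fueter_direction[OF dirac_null_iter[OF f i'] x(2,1)] by simp
    from has_partial_line[OF this] have "((\<lambda>s. iter_partial is f (s *\<^sub>R x)) has_vector_derivative ?D) (at t)" by simp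
    from bounded_linear.has_vector_derivative[OF linear_foldr_mul[unfolded linear_conv_bounded_linear] this]
    have "((\<lambda>t. ?L is (iter_partial is f (t *\<^sub>R x))) has_vector_derivative ?L is ?D) (at t)" .
    moreover have "?L is ?D = (\<Sum>l=1..m. ?L (is @ [l]) (iter_partial (is @ [l]) f (t *\<^sub>R x)))"
      unfolding linear_sum[OF linear_foldr_mul]
    proof (intro sum.cong refl)
      fix l assume "l \<in> {1..m}"
      \<comment> \<open>Differentiation leaves the new partial derivative outermost; commuting it to
        the innermost place matches it with the new multiplication, which is applied first.\<close>
      then have "iter_partial (is @ l # []) f (t *\<^sub>R x) = partial v l (iter_partial (is @ []) f) (t *\<^sub>R x)"
        by (intro iter_partial_move[OF f i']) (use x in auto)
      then show "?L is (mul (fueter_var e v l x) (partial v l (iter_partial is f) (t *\<^sub>R x))) =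
          ?L (is @ [l]) (iter_partial (is @ [l]) f (t *\<^sub>R x))" by simp
    qed
    ultimately show ?thesis by simp
  qed
  have "(\<Sum>is\<in>words m k. \<Sum>l=1..m. ?L (is @ [l]) (iter_partial (is @ [l]) f (t *\<^sub>R x))) = ray_derivative f x (Suc k) t"
    unfolding ray_derivative_def sum_words_snoc by (rule sum.swap)
  then show ?thesis
    using has_vector_derivative_sum[of "words m k" "\<lambda>is t. ?L is (iter_partial is f (t *\<^sub>R x))", OF d]
    unfolding ray_derivative_def[abs_def] by simp
qed

definition taylor_term :: "('a \<Rightarrow> 'a) \<Rightarrow> nat \<Rightarrow> 'a \<Rightarrow> 'a" where
  "taylor_term f k x = (\<Sum>\<kappa>\<in>multi_indices m k. mul (fueter_poly mul e m v \<kappa> x) (multi_partial m v \<kappa> f 0))"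

text \<open>An iterated derivative at 0 depends only on the letter counts of its word, so words are
  collected by counts; each class is one symmetrized product acting on one derivative of
  \<open>f\<close>.\<close>

lemma taylor_term_eq:
  assumes f: "dirac_null \<rho> f" and "\<rho> > 0"
  shows "taylor_term f k x = (1 / fact k) *\<^sub>R ray_derivative f x k 0"
proof -
  let ?L = "foldr (\<lambda>i. mul (fueter_var e v i x))"
  have 0: "0 \<in> rball \<rho>" using assms(2) by (simp add: rball_def linear_0[OF linear_proj])
  have "taylor_term f k x = (\<Sum>\<kappa>\<in>multi_indices m k. (1 / fact k) *\<^sub>R
      (\<Sum>is\<in>{is \<in> words m k. count_list is = \<kappa>}. ?L is (iter_partial is f 0)))"
    unfolding taylor_term_def
  proof (intro sum.cong refl)
    fix \<kappa> assume \<kappa>: "\<kappa> \<in> multi_indices m k"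
    have "multi_partial m v \<kappa> f 0 = iter_partial is f 0" if i: "is \<in> words m k" "count_list is = \<kappa>" for "is"
    proof -
      have "mset (sorted_word m \<kappa>) = mset is"
        by (rule multiset_eqI) (simp add: count_sorted_word[OF \<kappa>] i count_mset)
      then show ?thesis unfolding multi_partial_eq_iter
        by (rule iter_partial_mset[OF f]) (use 0 in \<open>auto simp: sorted_word_def\<close>)
    qed
    then show "mul (fueter_poly mul e m v \<kappa> x) (multi_partial m v \<kappa> f 0) = (1 / fact k) *\<^sub>R
      (\<Sum>is\<in>{is \<in> words m k. count_list is = \<kappa>}. ?L is (iter_partial is f 0))"
      unfolding fueter_poly_action[OF \<kappa>] by (auto intro!: arg_cong2[where f=scaleR] sum.cong)
  qed
  also have "\<dots> = (1 / fact k) *\<^sub>R (\<Sum>\<kappa>\<in>multi_indices m k.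
      \<Sum>is\<in>{is \<in> words m k. count_list is = \<kappa>}. ?L is (iter_partial is f 0))"
    by (rule scaleR_sum_right[symmetric])
  also have "(\<Sum>\<kappa>\<in>multi_indices m k. \<Sum>is\<in>{is \<in> words m k. count_list is = \<kappa>}. ?L is (iter_partial is f 0))
      = (\<Sum>is\<in>words m k. ?L is (iter_partial is f 0))"
    unfolding multi_indices_eq by (rule sum.image_gen[OF finite_words, symmetric])
  finally show ?thesis by (simp add: ray_derivative_def)
qed

lemma taylor_bound:
  assumes f: "dirac_null \<rho> f" and r: "0 < r1" "r1 < \<rho>"
  obtains C where "C \<ge> 0"
    "\<And>x. x \<in> rball r1 \<Longrightarrow> (\<lambda>k. taylor_term f k x) sums f x"
    "\<And>x k. x \<in> rball r1 \<Longrightarrow> norm (taylor_term f k x) \<le> C * (newton_bound (- real DIM('a) / 2) k * (norm x / r1) ^ k)"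
proof -
  obtain a C where a: "C \<ge> 0"
    "\<And>x t. proj x = x \<Longrightarrow> \<bar>t\<bar> * norm x < r1 \<Longrightarrow> (\<lambda>k. t ^ k *\<^sub>R a x k) sums f (t *\<^sub>R x)"
    "\<And>x k. norm (a x k) \<le> C * (newton_bound (- real DIM('a) / 2) k * (norm x / r1) ^ k)"
    by (rule homogeneous_expansion[OF f r]) (rule that; assumption)
  have eq: "a x k = taylor_term f k x" if x: "x \<in> rball r1" for x k
  proof -
    have px: "proj x = x" "norm x < r1" using x by (auto simp: rball_def)
    \<comment> \<open>All \<open>\<bar>t\<bar> < 1\<close> are admissible because \<open>x\<close>
      lies within radius \<open>r1\<close>; comparing power series in \<open>t\<close> there
      identifies \<open>a x k\<close> regardless of how it was obtained.\<close>
    have small: "\<bar>t\<bar> * norm x < r1" if "\<bar>t\<bar> < 1" for t :: real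
      using mult_right_mono[of "\<bar>t\<bar>" 1 "norm x"] that px by simp
    have "a x k = (1 / fact k) *\<^sub>R ray_derivative f x k 0"
    proof (rule power_series_derivatives)
      fix t :: real assume t: "\<bar>t\<bar> < 1"
      have "t *\<^sub>R x \<in> rball \<rho>" using small[OF t] px r by (simp add: rball_def linear_scale[OF linear_proj])
      then show "(ray_derivative f x k has_vector_derivative ray_derivative f x (Suc k) t) (at t)" for k
        by (rule ray_derivative_Suc[OF f px(1)])
      show "(\<lambda>n. t ^ n *\<^sub>R a x n) sums ray_derivative f x 0 t"
        using a(2)[OF px(1) small[OF t]] by (simp add: ray_derivative_def words_0)
    qed
    then show ?thesis using taylor_term_eq[OF f] r by simp
  qed
  show thesis
  proof (rule that[OF a(1)])
    fix x assume x: "x \<in> rball r1"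
    then have "proj x = x" "\<bar>1\<bar> * norm x < r1" by (auto simp: rball_def)
    from a(2)[OF this] show "(\<lambda>k. taylor_term f k x) sums f x" using eq[OF x] by simp
    show "norm (taylor_term f k x) \<le> C * (newton_bound (- real DIM('a) / 2) k * (norm x / r1) ^ k)" for k
      using a(3)[of x k] eq[OF x] by simp
  qed
qed

lemma taylor_sums:
  assumes f: "dirac_null \<rho> f" and x: "x \<in> rball \<rho>"
  shows "(\<lambda>k. taylor_term f k x) sums f x"
proof -
  obtain r where r: "0 < r" "r < \<rho>" "x \<in> rball r" using rball_radius[OF x] .
  show ?thesis by (rule taylor_bound[OF f r(1,2)]) (use r(3) in blast)
qed

lemma taylor_normally_convergent:
  assumes f: "dirac_null \<rho> f" and "\<rho> > 0"
  shows "normally_convergent_on (taylor_term f) (rball \<rho>)"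
  unfolding normally_convergent_on_def
proof (intro allI impI)
  fix K assume K: "compact K \<and> K \<subseteq> rball \<rho>"
  show "(\<Sum>k. SUP x\<in>K. ennreal (norm (taylor_term f k x))) < \<infinity>"
  proof (cases "K = {}")
    case False
    have "\<exists>z\<in>K. \<forall>y\<in>K. norm y \<le> norm z"
      using K False by (intro continuous_attains_sup continuous_intros) auto
    then obtain z where z: "z \<in> K" "\<And>y. y \<in> K \<Longrightarrow> norm y \<le> norm z" by blast
    \<comment> \<open>\<open>K\<close> attains its largest norm \<open>r\<close> inside the ball,
      and a radius \<open>r1\<close> strictly between \<open>r\<close> and \<open>\<rho>\<close>
      gives a ratio \<open>r / r1 < 1\<close> and with it one summable majorant on all of
      \<open>K\<close>.\<close>
    define r where "r = norm z"
    define r1 where "r1 = (r + \<rho>) / 2"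
    have "r < \<rho>" using z K by (auto simp: r_def rball_def)
    moreover have "0 \<le> r" by (simp add: r_def)
    ultimately have r: "0 \<le> r" "r < r1" "0 < r1" "r1 < \<rho>" using assms(2) by (auto simp: r1_def)
    obtain C where C: "C \<ge> 0"
      "\<And>x. x \<in> rball r1 \<Longrightarrow> (\<lambda>k. taylor_term f k x) sums f x"
      "\<And>x k. x \<in> rball r1 \<Longrightarrow> norm (taylor_term f k x) \<le> C * (newton_bound (- real DIM('a) / 2) k * (norm x / r1) ^ k)"
      by (rule taylor_bound[OF f r(3,4)]) (rule that; assumption)
    let ?b = "\<lambda>k. C * (newton_bound (- real DIM('a) / 2) k * (r / r1) ^ k)"
    have b0: "0 \<le> ?b k" for k using C(1) r newton_bound_nonneg[of _ k] by simp
    have s: "summable ?b" using r by (intro summable_mult newton_bound_summable) auto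
    have "(SUP x\<in>K. ennreal (norm (taylor_term f k x))) \<le> ennreal (?b k)" for k
    proof (rule SUP_least)
      fix x assume x: "x \<in> K"
      then have xr: "norm x \<le> r" "x \<in> rball r1" using z(2)[OF x] K r by (auto simp: r_def rball_def)
      have "norm (taylor_term f k x) \<le> C * (newton_bound (- real DIM('a) / 2) k * (norm x / r1) ^ k)"
        by (rule C(3)[OF xr(2)])
      also have "\<dots> \<le> ?b k"
        using xr r C(1) newton_bound_nonneg[of _ k]
        by (intro mult_left_mono power_mono divide_right_mono) auto
      finally show "ennreal (norm (taylor_term f k x)) \<le> ennreal (?b k)" by (rule ennreal_leI)
    qed
    then have "(\<Sum>k. SUP x\<in>K. ennreal (norm (taylor_term f k x))) \<le> (\<Sum>k. ennreal (?b k))"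
      by (intro suminf_le) auto
    also have "\<dots> = ennreal (\<Sum>k. ?b k)" by (rule suminf_ennreal2[OF b0 s])
    also have "\<dots> < \<infinity>" by simp
    finally show ?thesis .
  \<comment> \<open>Suprema over the empty set are the bottom element, which is 0 in
    \<open>ennreal\<close>.\<close>
  qed (simp add: bot_ennreal)
qed

end

theorem theorem4p12:
  fixes mul :: "'a::euclidean_space \<Rightarrow> 'a \<Rightarrow> 'a" and e :: 'a and cj :: "'a \<Rightarrow> 'a"
    and M :: "'a set" and m :: nat and v :: "nat \<Rightarrow> 'a"
    and \<rho> :: real and B :: "'a set" and f :: "'a \<Rightarrow> 'a" and g :: "nat \<Rightarrow> 'a \<Rightarrow> 'a"
  assumes "hypercomplex_subspace mul e cj M m v"
    and "\<rho> > 0"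
    and B_def: "B = {x \<in> M. norm x < \<rho>}"
    and "monogenic_on mul m v B f"
    and g_def: "\<And>k x. g k x =
      (\<Sum>\<kappa>\<in>multi_indices m k. mul (fueter_poly mul e m v \<kappa> x) (multi_partial m v \<kappa> f 0))"
  shows "(\<forall>x\<in>B. (\<lambda>k. g k x) sums f x) \<and> normally_convergent_on g B"
proof -
  interpret hypercomplex_subspace mul e cj M m v by (rule assms(1))
  have B: "B = rball \<rho>" by (auto simp: B_def rball_def M_eq_proj)
  have f: "dirac_null \<rho> f" using assms(4) unfolding B monogenic_iff_dirac_null .
  have g: "g = taylor_term f" by (intro ext) (simp add: g_def taylor_term_def)
  show ?thesis
    unfolding B g using taylor_sums[OF f] taylor_normally_convergent[OF f assms(2)] by blast
qed

end
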